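(* Let $K$ be a local field with finite residue field of characteristic $p\neq2$ and cardinality $q$. Then $K$ has a $\mathfrak D_{4,2}$-extension or a $\mathfrak Q_{4,2}$-extension if and only if $q\equiv-1\pmod 4$. If $q\equiv -1\pmod 4$, then $K$ has (up to $K$-isomorphism) a unique $\mathfrak D_{4,2}$-extension and a unique $\mathfrak Q_{4,2}$-extension.
   Context: A local field is a field complete for a discrete valuation with finite residue field. $\mathfrak D_{4,2}$ is the dihedral group of order $8$ and $\mathfrak Q_{4,2}$ is the quaternion group of order $8$. For a finite group $G$, a $G$-extension of $K$ is a finite Galois extension of $K$ whose Galois group is isomorphic to $G$. *)

theory Defs
  imports "HOL-Algebra.Algebra" "HOL-Number_Theory.Cong"
begin

section \<open>Local fields\<close>

text \<open>
  A discrete valuation is normalised, i.e. surjective onto the integers.  It is integer-valued, so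
  its value at zero carries no meaning (mathematically it is infinite) and is never used.
\<close>

locale discretely_valued_field = field K for K :: "('a, 'm) ring_scheme" (structure) +
  fixes v :: "'a \<Rightarrow> int"
  assumes v_surj: "v ` (carrier K - {\<zero>}) = UNIV"
    and v_mult: "\<lbrakk>x \<in> carrier K - {\<zero>}; y \<in> carrier K - {\<zero>}\<rbrakk> \<Longrightarrow> v (x \<otimes> y) = v x + v y"
    and v_add: "\<lbrakk>x \<in> carrier K - {\<zero>}; y \<in> carrier K - {\<zero>}; x \<oplus> y \<noteq> \<zero>\<rbrakk>
                  \<Longrightarrow> min (v x) (v y) \<le> v (x \<oplus> y)"

definition valuation_ring :: "('a, 'm) ring_scheme \<Rightarrow> ('a \<Rightarrow> int) \<Rightarrow> ('a, 'm) ring_scheme" where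
  "valuation_ring K v = K\<lparr>carrier := {x \<in> carrier K. x = \<zero>\<^bsub>K\<^esub> \<or> 0 \<le> v x}\<rparr>"

definition valuation_ideal :: "('a, 'm) ring_scheme \<Rightarrow> ('a \<Rightarrow> int) \<Rightarrow> 'a set" where
  "valuation_ideal K v = {x \<in> carrier K. x = \<zero>\<^bsub>K\<^esub> \<or> 0 < v x}"

definition residue_field :: "('a, 'm) ring_scheme \<Rightarrow> ('a \<Rightarrow> int) \<Rightarrow> 'a set ring" where
  "residue_field K v = valuation_ring K v Quot valuation_ideal K v"

text \<open>
  The order of one in the additive group; by the library's convention it is zero when that order
  is infinite.
\<close>

definition ring_characteristic :: "('a, 'm) ring_scheme \<Rightarrow> nat" where
  "ring_characteristic R = group.ord (add_monoid R) \<one>\<^bsub>R\<^esub>"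

text \<open>\<open>v_close K v n x y\<close> means \<open>v (x - y) \<ge> n\<close>, where the valuation of zero is infinite.\<close>

definition v_close :: "('a, 'm) ring_scheme \<Rightarrow> ('a \<Rightarrow> int) \<Rightarrow> int \<Rightarrow> 'a \<Rightarrow> 'a \<Rightarrow> bool" where
  "v_close K v n x y \<longleftrightarrow> x = y \<or> n \<le> v (x \<ominus>\<^bsub>K\<^esub> y)"

definition v_Cauchy :: "('a, 'm) ring_scheme \<Rightarrow> ('a \<Rightarrow> int) \<Rightarrow> (nat \<Rightarrow> 'a) \<Rightarrow> bool" where
  "v_Cauchy K v s \<longleftrightarrow> (\<forall>n. \<exists>N. \<forall>i\<ge>N. \<forall>j\<ge>N. v_close K v n (s i) (s j))"

definition v_converges_to ::
    "('a, 'm) ring_scheme \<Rightarrow> ('a \<Rightarrow> int) \<Rightarrow> (nat \<Rightarrow> 'a) \<Rightarrow> 'a \<Rightarrow> bool" where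
  "v_converges_to K v s l \<longleftrightarrow> (\<forall>n. \<exists>N. \<forall>i\<ge>N. v_close K v n (s i) l)"

locale local_field = discretely_valued_field +
  assumes complete:
      "\<lbrakk>\<And>i. s i \<in> carrier K; v_Cauchy K v s\<rbrakk> \<Longrightarrow> \<exists>l\<in>carrier K. v_converges_to K v s l"
    and finite_residue_field: "finite (carrier (residue_field K v))"


section \<open>Galois extensions\<close>

text \<open>
  An extension of \<open>K\<close> is a field \<open>L\<close> together with a (necessarily injective) ring homomorphism
  \<open>\<phi>\<close> from \<open>K\<close> to \<open>L\<close>.  The Galois group consists of the field automorphisms of \<open>L\<close> that fix the
  image of \<open>K\<close> pointwise, under composition; as in the library's \<open>BijGroup\<close>, automorphisms are
  normalised to be extensional outside the carrier.

  Quantifying over the extensions of \<open>K\<close> requires fixing the type \<open>'b\<close> in which their carriers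
  live.  Any type into which the carrier of \<open>K\<close> injects will do: a finite extension of an infinite
  field has the cardinality of that field, so it is \<open>K\<close>-isomorphic to one with carrier in \<open>'b\<close>.
\<close>

definition galois_group ::
    "('a, 'm) ring_scheme \<Rightarrow> ('b, 'n) ring_scheme \<Rightarrow> ('a \<Rightarrow> 'b) \<Rightarrow> ('b \<Rightarrow> 'b) monoid" where
  "galois_group K L \<phi> = BijGroup (carrier L)
     \<lparr>carrier := {\<sigma> \<in> ring_hom L L \<inter> Bij (carrier L). \<forall>x\<in>carrier K. \<sigma> (\<phi> x) = \<phi> x}\<rparr>"

definition finite_extension ::
    "('a, 'm) ring_scheme \<Rightarrow> ('b, 'n) ring_scheme \<Rightarrow> ('a \<Rightarrow> 'b) \<Rightarrow> bool" where
  "finite_extension K L \<phi> \<longleftrightarrow>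
     field L \<and> \<phi> \<in> ring_hom K L \<and> ring.finite_dimension L (\<phi> ` carrier K) (carrier L)"

text \<open>A finite extension is Galois if the base field is the fixed field of its automorphism group.\<close>

definition finite_galois_extension ::
    "('a, 'm) ring_scheme \<Rightarrow> ('b, 'n) ring_scheme \<Rightarrow> ('a \<Rightarrow> 'b) \<Rightarrow> bool" where
  "finite_galois_extension K L \<phi> \<longleftrightarrow>
     finite_extension K L \<phi> \<and>
     {x \<in> carrier L. \<forall>\<sigma>\<in>carrier (galois_group K L \<phi>). \<sigma> x = x} = \<phi> ` carrier K"

definition G_extension ::
    "('g, 'k) monoid_scheme \<Rightarrow> ('a, 'm) ring_scheme \<Rightarrow> ('b, 'n) ring_scheme \<Rightarrow> ('a \<Rightarrow> 'b) \<Rightarrow> bool"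
  where
  "G_extension G K L \<phi> \<longleftrightarrow> finite_galois_extension K L \<phi> \<and> galois_group K L \<phi> \<cong> G"

definition K_isomorphic ::
    "('a, 'm) ring_scheme \<Rightarrow> ('b, 'n) ring_scheme \<Rightarrow> ('a \<Rightarrow> 'b) \<Rightarrow>
     ('c, 'k) ring_scheme \<Rightarrow> ('a \<Rightarrow> 'c) \<Rightarrow> bool" where
  "K_isomorphic K L \<phi> L' \<phi>' \<longleftrightarrow> (\<exists>\<psi>\<in>ring_iso L L'. \<forall>x\<in>carrier K. \<psi> (\<phi> x) = \<phi>' x)"


section \<open>The dihedral and the quaternion group of order eight\<close>

text \<open>
  The pair \<open>(a, s)\<close> stands for the symmetry of the square that is the rotation by \<open>a\<close> quarter
  turns, preceded by a fixed reflection if \<open>s\<close> is true.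
\<close>

definition dihedral8 :: "(int \<times> bool) monoid" where
  "dihedral8 =
     \<lparr>carrier = {0..<4} \<times> UNIV,
      monoid.mult = (\<lambda>(a, s) (b, t). ((if s then a - b else a + b) mod 4, s \<noteq> t)),
      one = (0, False)\<rparr>"

text \<open>
  The units \<open>\<plusminus>1, \<plusminus>i, \<plusminus>j, \<plusminus>k\<close> under Hamilton's product, where \<open>(a, b, c, d)\<close> stands for
  \<open>a + b i + c j + d k\<close>.
\<close>

definition quaternion8 :: "(int \<times> int \<times> int \<times> int) monoid" where
  "quaternion8 =
     \<lparr>carrier = {(1, 0, 0, 0), (-1, 0, 0, 0), (0, 1, 0, 0), (0, -1, 0, 0),
                 (0, 0, 1, 0), (0, 0, -1, 0), (0, 0, 0, 1), (0, 0, 0, -1)},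
      monoid.mult = (\<lambda>(a, b, c, d) (a', b', c', d').
        (a * a' - b * b' - c * c' - d * d',
         a * b' + b * a' + c * d' - d * c',
         a * c' - b * d' + c * a' + d * b',
         a * d' + b * c' - c * b' + d * a')),
      one = (1, 0, 0, 0)\<rparr>"

lemma group_dihedral8: "group dihedral8"
proof (rule groupI)
  fix x y z
  assume "x \<in> carrier dihedral8" "y \<in> carrier dihedral8" "z \<in> carrier dihedral8"
  obtain a s b t c u where "x = (a, s)" "y = (b, t)" "z = (c, u)"
    by (metis surj_pair)
  then show "x \<otimes>\<^bsub>dihedral8\<^esub> y \<otimes>\<^bsub>dihedral8\<^esub> z = x \<otimes>\<^bsub>dihedral8\<^esub> (y \<otimes>\<^bsub>dihedral8\<^esub> z)"
    by (cases s; cases t) (simp_all add: dihedral8_def mod_simps add.assoc diff_diff_eq diff_diff_eq2 diff_add_eq add_diff_eq)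
next
  fix x assume "x \<in> carrier dihedral8"
  then obtain a s where x: "x = (a, s)" "0 \<le> a" "a < 4"
    by (auto simp: dihedral8_def)
  have "(if s then a else (- a) mod 4, s) \<otimes>\<^bsub>dihedral8\<^esub> x = \<one>\<^bsub>dihedral8\<^esub>"
    using x by (cases s) (simp_all add: dihedral8_def mod_simps)
  moreover have "(if s then a else (- a) mod 4, s) \<in> carrier dihedral8"
    using x by (cases s) (simp_all add: dihedral8_def)
  ultimately show "\<exists>y\<in>carrier dihedral8. y \<otimes>\<^bsub>dihedral8\<^esub> x = \<one>\<^bsub>dihedral8\<^esub>" by blast
qed (auto simp: dihedral8_def)

lemma group_quaternion8: "group quaternion8"
proof (rule groupI)
  fix x y
  assume "x \<in> carrier quaternion8" "y \<in> carrier quaternion8"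
  then show "x \<otimes>\<^bsub>quaternion8\<^esub> y \<in> carrier quaternion8"
    unfolding quaternion8_def by (simp, elim disjE) simp_all
next
  fix x y z
  show "x \<otimes>\<^bsub>quaternion8\<^esub> y \<otimes>\<^bsub>quaternion8\<^esub> z = x \<otimes>\<^bsub>quaternion8\<^esub> (y \<otimes>\<^bsub>quaternion8\<^esub> z)"
    by (cases x; cases y; cases z) (simp add: quaternion8_def algebra_simps)
next
  fix x assume *: "x \<in> carrier quaternion8"
  obtain a b c d where x: "x = (a, b, c, d)" by (cases x)
  with * have "(a, - b, - c, - d) \<in> carrier quaternion8 \<and>
      (a, - b, - c, - d) \<otimes>\<^bsub>quaternion8\<^esub> x = \<one>\<^bsub>quaternion8\<^esub>"
    unfolding quaternion8_def by (simp, elim disjE) simp_all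
  then show "\<exists>y\<in>carrier quaternion8. y \<otimes>\<^bsub>quaternion8\<^esub> x = \<one>\<^bsub>quaternion8\<^esub>" by blast
qed (simp_all add: quaternion8_def split: prod.split)

lemma order_dihedral8: "order dihedral8 = 8"
  by (simp add: order_def dihedral8_def card_cartesian_product)

lemma order_quaternion8: "order quaternion8 = 8"
  by (simp add: order_def quaternion8_def)

end

theory Submission
  imports Defs
begin

text \<open>
  Let \<open>e\<close> be a nonsquare unit and \<open>p\<close> a uniformizer.  Since principal units are squares,
  \<open>1, e, p, e p\<close> represent the square classes of \<open>K\<close>, and \<open>p\<close> is not a norm from \<open>K(\<surd>e)\<close>.
  A dihedral or quaternion extension \<open>L\<close> contains \<open>M = K(\<surd>e, \<surd>p)\<close> as the fixed field of the centre
  of its group, and \<open>L = M(\<surd>\<beta>)\<close> where the class of \<open>\<beta>\<close> modulo squares is invariant.  Whenever the norm of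
  an element of a quadratic extension is a square, the element is a square times an element of the
  base field; applying this to \<open>M / K(\<surd>e)\<close> and to \<open>K(\<surd>e) / K\<close> shows that \<open>\<beta>\<close> may be chosen
  among \<open>\<zeta>\<close>, \<open>\<surd>p\<close>, \<open>\<zeta>\<surd>p\<close>, where \<open>\<zeta>\<close> in \<open>K(\<surd>e)\<close> has its norm in the class of \<open>e\<close>.

  If \<open>q \<equiv> 1 (mod 4)\<close>, then \<open>\<zeta> = \<surd>e\<close> and \<open>L\<close> is generated by fourth roots over a field containing a
  square root of \<open>-1\<close>, so its group is abelian.  If \<open>q \<equiv> 3 (mod 4)\<close>, then \<open>e = -1\<close> and \<open>\<zeta> = a + b\<surd>-1\<close>
  with \<open>a\<^sup>2 + b\<^sup>2 = -1\<close>; here \<open>\<beta> = \<zeta>\<close> gives an abelian extension, \<open>\<beta> = \<surd>p\<close> the dihedral one and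
  \<open>\<beta> = \<zeta>\<surd>p\<close> the quaternion one.
\<close>

section \<open>Squares in finite fields\<close>

text \<open>Intermediate fields and groups are replaced by elements and endomorphisms. A subfield of
  \<open>L\<close> is given by the maps fixing it, and the lemmas that split or factor an element
  also assert that every endomorphism fixing the data fixes the pieces; this is how fixedness is
  passed down the tower. An extension is analysed for both groups at once, using only a central
  involution \<open>z\<close> and two maps \<open>g\<close>, \<open>h\<close> with commutator
  \<open>z\<close>. Contradictions with noncommutativity are found on one element negated by
  \<open>z\<close>, where \<open>g\<close> and \<open>h\<close> must not commute. Conversely, both
  extensions are instances of one tower of formal square roots \<open>i\<close>, \<open>r\<close>,
  \<open>y\<close> of \<open>-1\<close>, \<open>p\<close>, \<open>\<theta> r\<close>. The tower maps
  to every field over \<open>K\<close> containing such roots; this one fact yields its automorphisms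
  and also uniqueness. The groups are told apart by an element \<open>c\<close> of
  \<open>K(i)\<close> for which \<open>c^2 \<theta>\<close> is the conjugate of
  \<open>\<theta>\<close>: the automorphism with \<open>i\<close> to \<open>-i\<close>,
  \<open>r\<close> to \<open>r\<close>, \<open>y\<close> to \<open>c y\<close> has a square that
  multiplies \<open>y\<close> by the norm of \<open>c\<close>, which is 1 for
  \<open>\<theta> = 1\<close> and can be made -1 for \<open>\<theta> = \<zeta>\<close>.\<close>

lemma (in field) finite_field_generator:
  assumes "finite (carrier R)"
  obtains g where "g \<in> carrier R" "g \<noteq> \<zero>"
    "\<And>x. \<lbrakk>x \<in> carrier R; x \<noteq> \<zero>\<rbrakk> \<Longrightarrow> \<exists>i::nat. x = g [^] i"
    "\<And>n::nat. g [^] n = \<one> \<longleftrightarrow> order R - 1 dvd n"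
proof -
  note mult_of_simps[simp]
  have fin: "finite (carrier (Multiplicative_Group.mult_of R))" using assms by (rule finite_mult_of)
  interpret G: group "Multiplicative_Group.mult_of R" rewrites
      "([^]\<^bsub>Multiplicative_Group.mult_of R\<^esub>) = (([^]) :: _ \<Rightarrow> nat \<Rightarrow> _)" and "\<one>\<^bsub>Multiplicative_Group.mult_of R\<^esub> = \<one>"
    by (rule field_mult_group) (simp_all add: fun_eq_iff nat_pow_def)
  from finite_field_mult_group_has_gen[OF assms] obtain g where
    g: "g \<in> carrier (Multiplicative_Group.mult_of R)" "carrier (Multiplicative_Group.mult_of R) = {g [^] i | i::nat. i \<in> UNIV}" by blast
  have gen: "\<exists>i::nat. x = g [^] i" if "x \<in> carrier R" "x \<noteq> \<zero>" for x
    using g(2) that by fastforce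
  have "G.ord g = card (carrier (Multiplicative_Group.mult_of R))"
    using G.generate_pow_card[OF g(1)] G.generate_pow_on_finite_carrier[OF fin g(1)] g(2)
    by (simp add: full_SetCompr_eq)
  also have "\<dots> = order R - 1"
    using assms by (simp add: order_def)
  finally have ord: "G.ord g = order R - 1" .
  have "g [^] n = \<one> \<longleftrightarrow> order R - 1 dvd n" for n :: nat
    using G.pow_eq_id[OF g(1), of n] ord by simp
  with gen g(1) show thesis by (intro that[of g]) auto
qed

lemma (in field) square_eq_one_iff:
  assumes "x \<in> carrier R"
  shows "x \<otimes> x = \<one> \<longleftrightarrow> x = \<one> \<or> x = \<ominus> \<one>"
proof
  assume *: "x \<otimes> x = \<one>"
  have "(x \<ominus> \<one>) \<otimes> (x \<oplus> \<one>) = x \<otimes> x \<ominus> \<one>" using assms by algebra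
  also have "\<dots> = \<zero>" using * by (simp add: r_neg minus_eq)
  finally have "x \<ominus> \<one> = \<zero> \<or> x \<oplus> \<one> = \<zero>" using assms by (simp add: integral_iff)
  then show "x = \<one> \<or> x = \<ominus> \<one>"
    using assms by (metis r_right_minus_eq one_closed minus_equality)
next
  show "x = \<one> \<or> x = \<ominus> \<one> \<Longrightarrow> x \<otimes> x = \<one>" by (auto simp: l_minus r_minus)
qed

lemma (in field) neg_one_ne_one:
  assumes "\<one> \<oplus> \<one> \<noteq> \<zero>" shows "\<ominus> \<one> \<noteq> \<one>"
  using assms by (metis l_neg one_closed)

text \<open>The element -1 is a power \<open>g [^] i\<close> with square 1. If
  \<open>order R\<close> were even, the odd number \<open>order R - 1\<close> would divide
  \<open>2 * i\<close>, hence \<open>i\<close>, and -1 would be 1.\<close>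

lemma (in field) odd_order_if_two_nonzero:
  assumes fin: "finite (carrier R)" and two: "\<one> \<oplus> \<one> \<noteq> \<zero>"
  shows "odd (order R)"
proof
  assume ev: "even (order R)"
  from fin obtain g where g: "g \<in> carrier R" "g \<noteq> \<zero>"
    "\<And>x. \<lbrakk>x \<in> carrier R; x \<noteq> \<zero>\<rbrakk> \<Longrightarrow> \<exists>i::nat. x = g [^] i"
    "\<And>n::nat. g [^] n = \<one> \<longleftrightarrow> order R - 1 dvd n" by (rule finite_field_generator) blast
  have "\<ominus> \<one> \<noteq> \<zero>" by (metis add.inv_eq_1_iff one_closed one_not_zero)
  with g(3)[of "\<ominus> \<one>"] obtain i :: nat where i: "\<ominus> \<one> = g [^] i" by auto
  have "g [^] (i + i) = \<one>"
    using g(1) i[symmetric] by (simp add: nat_pow_mult[symmetric] l_minus r_minus)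
  then have "order R - 1 dvd 2 * i" using g(4)[of "i + i"] by (simp add: mult_2)
  moreover have "odd (order R - 1)"
    using ev fin by (metis even_Suc Suc_diff_1 order_gt_0_iff_finite)
  ultimately have "order R - 1 dvd i"
    using coprime_dvd_mult_right_iff[of "order R - 1" 2 i] by simp
  then show False using i g(4) neg_one_ne_one[OF two] by simp
qed

text \<open>A generator of the multiplicative group serves as \<open>e\<close>: its even powers are
  the squares, its odd powers \<open>e\<close> times squares.\<close>

lemma (in field) finite_field_nonsquare:
  assumes fin: "finite (carrier R)" and odd: "odd (order R)"
  obtains e where "e \<in> carrier R" "e \<noteq> \<zero>" "\<And>x. x \<in> carrier R \<Longrightarrow> x \<otimes> x \<noteq> e"
    "\<And>x. x \<in> carrier R \<Longrightarrow> \<exists>s\<in>carrier R. x = s \<otimes> s \<or> x = e \<otimes> (s \<otimes> s)"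
proof -
  from fin obtain g where g: "g \<in> carrier R" "g \<noteq> \<zero>"
    "\<And>x. \<lbrakk>x \<in> carrier R; x \<noteq> \<zero>\<rbrakk> \<Longrightarrow> \<exists>i::nat. x = g [^] i"
    "\<And>n::nat. g [^] n = \<one> \<longleftrightarrow> order R - 1 dvd n" by (rule finite_field_generator) blast
  have "order R \<noteq> 1" using fin
    by (metis one_not_zero order_def card_1_singletonE one_closed singletonD zero_closed)
  then have q: "even (order R - 1)" "order R \<ge> 2" using odd by (auto intro!: le_neq_implies_less elim: oddE)
  have "x \<otimes> x \<noteq> g" if x: "x \<in> carrier R" for x
  proof
    assume *: "x \<otimes> x = g"
    then have "x \<noteq> \<zero>" using g(2) by auto
    then obtain i :: nat where "x = g [^] i" using g(3) x by blast
    then have "g [^] (i + i) = g" using * g(1) by (simp add: nat_pow_mult[symmetric])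
    \<comment> \<open>Multiplying by \<open>g [^] (order R - 2)\<close>, the inverse of
      \<open>g\<close>, produces an exponent that is odd although the even number
      \<open>order R - 1\<close> divides it.\<close>
    then have "g [^] (i + i + (order R - 2)) = g [^] (Suc (order R - 2))"
      using g(1) by (simp add: nat_pow_mult[symmetric] m_comm)
    also have "\<dots> = \<one>" using q(2) g(4)[of "Suc (order R - 2)"] by (simp add: Suc_diff_le[symmetric])
    finally have "order R - 1 dvd i + i + (order R - 2)" using g(4) by blast
    with q(1) have "even (i + i + (order R - 2))" by (rule dvd_trans)
    then show False using odd q(2) by simp
  qed
  moreover have "\<exists>s\<in>carrier R. x = s \<otimes> s \<or> x = g \<otimes> (s \<otimes> s)" if x: "x \<in> carrier R" for x
  proof (cases "x = \<zero>")
    case False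
    then obtain i :: nat where i: "x = g [^] i" using g(3) x by blast
    have "x = g [^] (i div 2) \<otimes> g [^] (i div 2) \<or> x = g \<otimes> (g [^] (i div 2) \<otimes> g [^] (i div 2))"
    proof (cases "even i")
      case True
      then have "i = i div 2 + i div 2" by auto
      then show ?thesis using i g(1) nat_pow_mult[OF g(1), of "i div 2" "i div 2"] by simp
    next
      case False
      then have "i = Suc (i div 2 + i div 2)" by presburger
      then show ?thesis using i g(1) nat_pow_mult[OF g(1), of "i div 2" "i div 2"]
        by (metis m_comm nat_pow_Suc nat_pow_closed)
    qed
    then show ?thesis using g(1) by blast
  qed (auto intro!: bexI[of _ \<zero>])
  ultimately show thesis using that g by blast
qed

text \<open>A generator raised to a quarter of the group order has order four, so its square is the
  element -1 of order two.\<close>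

lemma (in field) finite_field_sqrt_neg_one:
  assumes fin: "finite (carrier R)" and two: "\<one> \<oplus> \<one> \<noteq> \<zero>" and q: "4 dvd order R - 1"
  shows "\<exists>j\<in>carrier R. j \<otimes> j = \<ominus> \<one>"
proof -
  from fin obtain g where g: "g \<in> carrier R" "g \<noteq> \<zero>"
    "\<And>x. \<lbrakk>x \<in> carrier R; x \<noteq> \<zero>\<rbrakk> \<Longrightarrow> \<exists>i::nat. x = g [^] i"
    "\<And>n::nat. g [^] n = \<one> \<longleftrightarrow> order R - 1 dvd n" by (rule finite_field_generator) blast
  from q obtain m where m: "order R - 1 = 4 * m" by blast
  have "order R - 1 \<noteq> 0"
    using odd_order_if_two_nonzero[OF fin two] fin
    by (metis One_nat_def Suc_diff_1 order_gt_0_iff_finite card_1_singletonE one_closed one_not_zero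
        order_def singletonD zero_closed)
  then have "m > 0" using m by simp
  then have ndvd: "\<not> 4 * m dvd m + m" by (auto dest: dvd_imp_le)
  let ?j = "g [^] m"
  have j: "?j \<in> carrier R" using g(1) by simp
  have "(?j \<otimes> ?j) \<otimes> (?j \<otimes> ?j) = g [^] ((m + m) + (m + m))"
    using g(1) by (simp only: nat_pow_mult)
  also have "(m + m) + (m + m) = 4 * m" by simp
  also have "g [^] (4 * m) = \<one>" using g(4)[of "4 * m"] m by simp
  finally have "?j \<otimes> ?j = \<one> \<or> ?j \<otimes> ?j = \<ominus> \<one>" using square_eq_one_iff[of "?j \<otimes> ?j"] j by simp
  moreover have "?j \<otimes> ?j \<noteq> \<one>"
    using g(4)[of "m + m"] ndvd m g(1) by (simp add: nat_pow_mult)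
  ultimately show ?thesis using j by blast
qed

text \<open>A square root of -1 would have order four, whereas \<open>order R - 1\<close> is twice
  an odd number.\<close>

lemma (in field) finite_field_neg_one_nonsquare:
  assumes fin: "finite (carrier R)" and two: "\<one> \<oplus> \<one> \<noteq> \<zero>" and q: "order R mod 4 = 3"
    and x: "x \<in> carrier R"
  shows "x \<otimes> x \<noteq> \<ominus> \<one>"
proof
  assume *: "x \<otimes> x = \<ominus> \<one>"
  from fin obtain g where g: "g \<in> carrier R" "g \<noteq> \<zero>"
    "\<And>x. \<lbrakk>x \<in> carrier R; x \<noteq> \<zero>\<rbrakk> \<Longrightarrow> \<exists>i::nat. x = g [^] i"
    "\<And>n::nat. g [^] n = \<one> \<longleftrightarrow> order R - 1 dvd n" by (rule finite_field_generator) blast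
  have "x \<noteq> \<zero>" using * by (metis add.inv_eq_1_iff l_null one_closed one_not_zero zero_closed)
  then obtain i :: nat where i: "x = g [^] i" using g(3) x by blast
  have "g [^] ((i + i) + (i + i)) = \<one>"
    using g(1) * i by (simp only: nat_pow_mult[symmetric] nat_pow_closed) (simp add: l_minus r_minus)
  moreover have "(i + i) + (i + i) = 4 * i" by simp
  ultimately have "g [^] (4 * i) = \<one>" by (simp only:)
  then have 1: "order R - 1 dvd 4 * i" using g(4)[of "4 * i"] by simp
  have "order R - 1 = 2 * ((order R - 1) div 2)" "odd ((order R - 1) div 2)"
    using q by presburger+
  then obtain n where n: "order R - 1 = 2 * n" "odd n" by blast
  with 1 have "n dvd 2 * i" using nat_mult_dvd_cancel1[of 2 n "2 * i"] n(1) by simp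
  then have "n dvd i" using n(2) coprime_dvd_mult_right_iff[of n 2 i] by simp
  then have "order R - 1 dvd i + i" using n(1) by (metis dvd_refl mult_2 mult_dvd_mono)
  then have "x \<otimes> x = \<one>" using g(4)[of "i + i"] i g(1) by (simp add: nat_pow_mult)
  then show False using * neg_one_ne_one[OF two] by simp
qed

text \<open>Here -1 is itself a nonsquare, so it can replace the representative \<open>e\<close> of
  the nonsquares.\<close>

lemma (in field) finite_field_squares_up_to_sign:
  assumes fin: "finite (carrier R)" and two: "\<one> \<oplus> \<one> \<noteq> \<zero>" and q: "order R mod 4 = 3"
    and x: "x \<in> carrier R"
  shows "\<exists>s\<in>carrier R. x = s \<otimes> s \<or> x = \<ominus> (s \<otimes> s)"
proof -
  from q have "odd (order R)" by presburger
  from fin this obtain e where e: "e \<in> carrier R" "e \<noteq> \<zero>" "\<And>x. x \<in> carrier R \<Longrightarrow> x \<otimes> x \<noteq> e"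
    "\<And>x. x \<in> carrier R \<Longrightarrow> \<exists>s\<in>carrier R. x = s \<otimes> s \<or> x = e \<otimes> (s \<otimes> s)"
    by (rule finite_field_nonsquare) blast
  from e(4)[of "\<ominus> \<one>"] finite_field_neg_one_nonsquare[OF fin two q]
  obtain t where t: "t \<in> carrier R" "\<ominus> \<one> = e \<otimes> (t \<otimes> t)" by fastforce
  then have "t \<noteq> \<zero>" using e(1) by (metis add.inv_eq_1_iff r_null one_closed one_not_zero zero_closed)
  from e(4)[OF x] obtain s where s: "s \<in> carrier R" "x = s \<otimes> s \<or> x = e \<otimes> (s \<otimes> s)" by blast
  have "x = \<ominus> ((s \<otimes> inv t) \<otimes> (s \<otimes> inv t))" if "x = e \<otimes> (s \<otimes> s)"
  proof -
    have it: "inv t \<in> carrier R" "t \<otimes> inv t = \<one>" using t \<open>t \<noteq> \<zero>\<close> by (auto simp: field_Units)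
    have "\<ominus> ((s \<otimes> inv t) \<otimes> (s \<otimes> inv t)) = \<ominus> \<one> \<otimes> ((s \<otimes> inv t) \<otimes> (s \<otimes> inv t))"
      using s it by algebra
    also have "\<dots> = e \<otimes> (s \<otimes> s) \<otimes> ((t \<otimes> inv t) \<otimes> (t \<otimes> inv t))"
      unfolding t(2) using s t(1) it(1) e(1) by algebra
    finally show ?thesis using that s e(1) it(2) by simp
  qed
  with s show ?thesis using t \<open>t \<noteq> \<zero>\<close> by (metis m_closed field_Units Units_inv_closed DiffI singletonD)
qed

text \<open>Suppose not. Then \<open>s^2 + 1\<close> is never minus a nonzero square
  \<open>t^2\<close>, since dividing by \<open>t^2\<close> would give the excluded sum; so
  \<open>s^2 + 1\<close> is again a square. By induction all multiples of 1 are squares, among them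
  -1, a contradiction.\<close>

lemma (in field) finite_field_neg_one_sum_of_squares:
  assumes fin: "finite (carrier R)" and two: "\<one> \<oplus> \<one> \<noteq> \<zero>" and q: "order R mod 4 = 3"
  shows "\<exists>a\<in>carrier R. \<exists>b\<in>carrier R. a \<otimes> a \<oplus> b \<otimes> b = \<ominus> \<one>"
proof (rule ccontr)
  assume no: "\<not> ?thesis"
  have "\<exists>s\<in>carrier R. add_pow R (n) \<one> = s \<otimes> s" for n :: nat
  proof (induction n)
    case 0
    show ?case by (auto intro!: bexI[of _ \<zero>])
  next
    case (Suc n)
    then obtain s where s: "s \<in> carrier R" "add_pow R (n) \<one> = s \<otimes> s" by blast
    have eq: "add_pow R (Suc n) \<one> = s \<otimes> s \<oplus> \<one>" using s by simp
    obtain t where t: "t \<in> carrier R" "s \<otimes> s \<oplus> \<one> = t \<otimes> t \<or> s \<otimes> s \<oplus> \<one> = \<ominus> (t \<otimes> t)"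
      using finite_field_squares_up_to_sign[OF fin two q, of "s \<otimes> s \<oplus> \<one>"] s by auto
    have "s \<otimes> s \<oplus> \<one> = t \<otimes> t"
    proof (rule ccontr)
      assume neq: "s \<otimes> s \<oplus> \<one> \<noteq> t \<otimes> t"
      with t have m: "s \<otimes> s \<oplus> \<one> = \<ominus> (t \<otimes> t)" by blast
      have "t \<noteq> \<zero>" using neq m by auto
      then have it: "inv t \<in> carrier R" "t \<otimes> inv t = \<one>" using t by (auto simp: field_Units)
      have "(s \<otimes> inv t) \<otimes> (s \<otimes> inv t) \<oplus> inv t \<otimes> inv t = (s \<otimes> s \<oplus> \<one>) \<otimes> (inv t \<otimes> inv t)"
        using s it(1) by algebra
      also have "\<dots> = \<ominus> ((t \<otimes> inv t) \<otimes> (t \<otimes> inv t))"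
        unfolding m using t(1) it(1) by algebra
      finally have "(s \<otimes> inv t) \<otimes> (s \<otimes> inv t) \<oplus> inv t \<otimes> inv t = \<ominus> \<one>" using it by simp
      then show False using no s it by blast
    qed
    then show ?case using eq t(1) by auto
  qed
  then obtain s where s: "s \<in> carrier R" "add_pow R (order R - 1) \<one> = s \<otimes> s" by blast
  \<comment> \<open>By Lagrange in the additive group, the multiple of 1 by
    \<open>order R - 1\<close> is -1.\<close>
  have "add_pow R (order R) \<one> = \<zero>"
    using group.pow_order_eq_1[OF a_group, of \<one>] by (simp add: order_def add_pow_def)
  moreover have "order R = Suc (order R - 1)"
    using fin by (metis Suc_diff_1 order_gt_0_iff_finite)
  ultimately have "add_pow R (order R - 1) \<one> \<oplus> \<one> = \<zero>"
    by (metis add.nat_pow_Suc)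
  then have "s \<otimes> s = \<ominus> \<one>" using s by (metis m_closed minus_equality one_closed)
  with finite_field_neg_one_nonsquare[OF fin two q s(1)] show False by blast
qed

section \<open>Valuations and principal units\<close>

context discretely_valued_field
begin

definition near :: "int \<Rightarrow> 'a \<Rightarrow> bool" where
  "near n x \<longleftrightarrow> x \<in> carrier K \<and> (x = \<zero> \<or> n \<le> v x)"

lemma near_closed: "near n x \<Longrightarrow> x \<in> carrier K"
  by (simp add: near_def)

lemma near_zero: "near n \<zero>"
  by (simp add: near_def)

lemma near_mono: "near n x \<Longrightarrow> m \<le> n \<Longrightarrow> near m x"
  by (auto simp: near_def)

lemma near_add: "near n x \<Longrightarrow> near n y \<Longrightarrow> near n (x \<oplus> y)"
  using v_add[of x y] by (fastforce simp: near_def)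

lemma near_mult: "near n x \<Longrightarrow> near m y \<Longrightarrow> near (n + m) (x \<otimes> y)"
  using v_mult[of x y] by (auto simp: near_def integral_iff)

lemma v_one: "v \<one> = 0"
  using v_mult[of \<one> \<one>] by simp

lemma neg_one_nonzero: "\<ominus> \<one> \<noteq> \<zero>"
  by (metis add.inv_eq_1_iff one_closed one_not_zero)

lemma v_neg_one: "v (\<ominus> \<one>) = 0"
  using v_mult[of "\<ominus> \<one>" "\<ominus> \<one>"] neg_one_nonzero by (simp add: l_minus r_minus v_one)

lemma v_minus: "x \<in> carrier K \<Longrightarrow> x \<noteq> \<zero> \<Longrightarrow> v (\<ominus> x) = v x"
  using v_mult[of "\<ominus> \<one>" x] neg_one_nonzero by (simp add: l_minus v_neg_one)

lemma near_minus: "near n x \<Longrightarrow> near n (\<ominus> x)"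
  by (auto simp: near_def v_minus)

lemma near_diff: "near n x \<Longrightarrow> near n y \<Longrightarrow> near n (x \<ominus> y)"
  by (simp add: minus_eq near_add near_minus)

lemma inv_nonzero: "x \<in> carrier K \<Longrightarrow> x \<noteq> \<zero> \<Longrightarrow> inv x \<in> carrier K \<and> inv x \<noteq> \<zero> \<and> x \<otimes> inv x = \<one>"
proof -
  assume "x \<in> carrier K" "x \<noteq> \<zero>"
  then have "x \<in> Units K" by (simp add: field_Units)
  then have "inv x \<in> carrier K" "x \<otimes> inv x = \<one>" by simp_all
  moreover from this have "inv x \<noteq> \<zero>" using \<open>x \<in> carrier K\<close> by (metis one_not_zero r_null)
  ultimately show ?thesis by simp
qed

lemma v_inv: "x \<in> carrier K \<Longrightarrow> x \<noteq> \<zero> \<Longrightarrow> v (inv x) = - v x"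
  using v_mult[of x "inv x"] inv_nonzero[of x] by (auto simp: v_one)

lemma near_one: "near 0 \<one>"
  by (simp add: near_def v_one)

lemma near_inv: "x \<in> carrier K \<Longrightarrow> x \<noteq> \<zero> \<Longrightarrow> n \<le> - v x \<Longrightarrow> near n (inv x)"
  by (simp add: near_def v_inv inv_nonzero)

text \<open>The ultrametric inequality is an equality when one summand dominates: a perturbation of
  larger valuation changes neither nonvanishing nor valuation.\<close>

lemma v_eqI:
  assumes x: "x \<in> carrier K" "x \<noteq> \<zero>" and y: "near (v x + 1) (y \<ominus> x)" "y \<in> carrier K"
  shows "y \<noteq> \<zero>" "v y = v x"
proof -
  have x1: "\<not> near (v x + 1) x" using x by (simp add: near_def)
  have nx: "\<not> near (v x + 1) y"
  proof
    assume "near (v x + 1) y"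
    then have "near (v x + 1) (y \<ominus> (y \<ominus> x))" using y(1) by (rule near_diff)
    moreover have "y \<ominus> (y \<ominus> x) = x" using x y by algebra
    ultimately show False using x1 by simp
  qed
  then show "y \<noteq> \<zero>" by (auto simp: near_zero)
  have "near (v x) (x \<oplus> (y \<ominus> x))"
    using x near_mono[OF y(1)] by (intro near_add) (auto simp: near_def)
  moreover have "x \<oplus> (y \<ominus> x) = y" using x y by algebra
  ultimately have "near (v x) y" by simp
  with nx \<open>y \<noteq> \<zero>\<close> show "v y = v x" by (auto simp: near_def)
qed

lemma near_all_imp_zero: "(\<And>n. near n x) \<Longrightarrow> x = \<zero>"
  by (metis near_def less_le_not_le zless_add1_eq)

lemma v_close_iff: "x \<in> carrier K \<Longrightarrow> y \<in> carrier K \<Longrightarrow> v_close K v n x y \<longleftrightarrow> near n (x \<ominus> y)"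
  by (auto simp: v_close_def near_def r_right_minus_eq)

end

text \<open>Newton's iteration with the fixed denominator two, which contracts on the principal units.\<close>

lemma (in local_field) principal_unit_square:
  assumes two: "\<one> \<oplus> \<one> \<noteq> \<zero>" "v (\<one> \<oplus> \<one>) = 0" and u: "near 1 (u \<ominus> \<one>)" "u \<in> carrier K"
  shows "\<exists>s\<in>carrier K. s \<otimes> s = u"
proof -
  define h where "h = inv (\<one> \<oplus> \<one>)"
  have h: "h \<in> carrier K" "(\<one> \<oplus> \<one>) \<otimes> h = \<one>" "near 0 h"
    using inv_nonzero[of "\<one> \<oplus> \<one>"] near_inv[of "\<one> \<oplus> \<one>" 0] two by (auto simp: h_def)
  have hh: "h \<oplus> h = \<one>" using h(2) h(1) by algebra
  define f where "f x = x \<ominus> h \<otimes> (x \<otimes> x \<ominus> u)" for x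
  define s where "s n = (f ^^ n) \<one>" for n
  have s_Suc: "s (Suc n) = f (s n)" for n by (simp add: s_def)
  have f_closed: "x \<in> carrier K \<Longrightarrow> f x \<in> carrier K" for x using h u by (simp add: f_def)
  have s: "s n \<in> carrier K" for n by (induction n) (simp_all add: s_def f_closed)
  \<comment> \<open>For principal units \<open>x\<close>, \<open>y\<close> the second factor is
    congruent to \<open>1 - 2h = 0\<close>, so each application of \<open>f\<close> raises the
    valuation of a difference by at least one.\<close>
  have f_diff: "f x \<ominus> f y = (x \<ominus> y) \<otimes> (\<one> \<ominus> h \<otimes> (x \<oplus> y))" if "x \<in> carrier K" "y \<in> carrier K" for x y
    unfolding f_def using that h(1) u(2) by algebra
  have unit: "near 1 (s n \<ominus> \<one>)" for n
  proof (induction n)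
    case 0
    show ?case by (simp add: s_def minus_eq r_neg near_zero)
  next
    case (Suc n)
    let ?d = "s n \<ominus> \<one>"
    have "f (s n) \<ominus> \<one> = ?d \<ominus> h \<otimes> (?d \<otimes> ?d \<oplus> ?d \<oplus> ?d \<ominus> (u \<ominus> \<one>))"
      unfolding f_def using h(1) u(2) s[of n] by algebra
    moreover have "near 1 (?d \<otimes> ?d)"
      using near_mult[OF Suc Suc] by (rule near_mono) simp
    then have "near (0 + 1) (h \<otimes> (?d \<otimes> ?d \<oplus> ?d \<oplus> ?d \<ominus> (u \<ominus> \<one>)))"
      by (rule near_mult[OF h(3) near_diff[OF near_add[OF near_add[OF _ Suc] Suc] u(1)]])
    ultimately show ?case using near_diff[OF Suc] by (simp add: s_Suc)
  qed
  have contr: "near 1 (\<one> \<ominus> h \<otimes> (s n \<oplus> s m))" for n m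
  proof -
    have "\<one> \<ominus> h \<otimes> (s n \<oplus> s m) = (\<one> \<ominus> (h \<oplus> h)) \<ominus> h \<otimes> ((s n \<ominus> \<one>) \<oplus> (s m \<ominus> \<one>))"
      using h(1) s[of n] s[of m] by algebra
    also have "\<dots> = \<ominus> (h \<otimes> ((s n \<ominus> \<one>) \<oplus> (s m \<ominus> \<one>)))"
      using h(1) s[of n] s[of m] hh by (simp add: minus_eq r_neg)
    also have "near 1 \<dots>"
      using near_mult[OF h(3) near_add[OF unit unit], of n m] by (simp add: near_minus)
    finally show ?thesis .
  qed
  have step: "near (int n + 1) (s (Suc n) \<ominus> s n)" for n
  proof (induction n)
    case 0
    have "s (Suc 0) \<ominus> s 0 = (s (Suc 0) \<ominus> \<one>)" by (simp add: s_def)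
    then show ?case using unit[of "Suc 0"] by simp
  next
    case (Suc n)
    have "s (Suc (Suc n)) \<ominus> s (Suc n) = (s (Suc n) \<ominus> s n) \<otimes> (\<one> \<ominus> h \<otimes> (s (Suc n) \<oplus> s n))"
      unfolding s_Suc[of "Suc n"] by (subst s_Suc[of n]) (rule f_diff, auto simp: s f_closed s_Suc)
    then show ?case using near_mult[OF Suc contr[of "Suc n" n]] by (simp add: algebra_simps)
  qed
  have tail: "near (int n + 1) (s (n + k) \<ominus> s n)" for n k
  proof (induction k)
    case 0
    then show ?case using s by (simp add: minus_eq r_neg near_zero)
  next
    case (Suc k)
    have "s (n + Suc k) \<ominus> s n = (s (Suc (n + k)) \<ominus> s (n + k)) \<oplus> (s (n + k) \<ominus> s n)"
      using s[of n] s[of "n + k"] s[of "Suc (n + k)"] by (simp only: add_Suc_right) algebra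
    moreover have "near (int n + 1) (s (Suc (n + k)) \<ominus> s (n + k))"
      using step[of "n + k"] by (rule near_mono) simp
    ultimately show ?case using Suc near_add by metis
  qed
  have "v_Cauchy K v s"
    unfolding v_Cauchy_def
  proof
    fix n :: int
    have "near n (s i \<ominus> s j)" if "i \<ge> nat n" "j \<ge> nat n" for i j
    proof -
      have i: "near n (s i \<ominus> s (nat n))"
        using near_mono[OF tail[of "nat n" "i - nat n"], of n] that by simp
      have j: "near n (s j \<ominus> s (nat n))"
        using near_mono[OF tail[of "nat n" "j - nat n"], of n] that by simp
      have "s i \<ominus> s j = (s i \<ominus> s (nat n)) \<ominus> (s j \<ominus> s (nat n))"
        using s[of i] s[of j] s[of "nat n"] by algebra
      then show ?thesis using near_diff[OF i j] by simp
    qed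
    then show "\<exists>N. \<forall>i\<ge>N. \<forall>j\<ge>N. v_close K v n (s i) (s j)"
      using v_close_iff s by blast
  qed
  with complete s obtain l where l: "l \<in> carrier K" "v_converges_to K v s l" by blast
  have "near n (l \<otimes> l \<ominus> u)" for n
  proof -
    obtain N where N: "\<And>i. i \<ge> N \<Longrightarrow> near (max n 0) (s i \<ominus> l)"
      using l(2) v_close_iff[OF s l(1)] unfolding v_converges_to_def by blast
    define i where "i = max N (nat n)"
    have i1: "near (max n 0) (s i \<ominus> l)" using N by (simp add: i_def)
    have i2: "near (max n 0) (s (Suc i) \<ominus> s i)" by (rule near_mono[OF step]) (simp add: i_def)
    have si: "near 0 (s i)"
    proof -
      have "s i = (s i \<ominus> \<one>) \<oplus> \<one>" using s[of i] by algebra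
      then show ?thesis using near_add[OF near_mono[OF unit[of i]] near_one] by (metis zero_le_one)
    qed
    have "l \<oplus> s i = (s i \<oplus> s i) \<ominus> (s i \<ominus> l)" using s[of i] l(1) by algebra
    moreover have "near 0 (s i \<ominus> l)" using i1 by (rule near_mono) simp
    ultimately have ls: "near 0 (l \<oplus> s i)" using si by (simp add: near_add near_diff)
    \<comment> \<open>The defect of \<open>s i\<close> is minus twice the increment from
      \<open>s i\<close> to \<open>s (Suc i)\<close>, by the definition of \<open>f\<close>; both it
      and the correction term tend to zero.\<close>
    have "l \<otimes> l \<ominus> u = (s i \<otimes> s i \<ominus> u) \<ominus> (s i \<ominus> l) \<otimes> (l \<oplus> s i)"
      using s[of i] l(1) u(2) by algebra
    also have "s i \<otimes> s i \<ominus> u = (h \<oplus> h) \<otimes> (s i \<otimes> s i \<ominus> u)"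
      using s[of i] u(2) hh by simp
    also have "\<dots> = \<ominus> ((s (Suc i) \<ominus> s i) \<oplus> (s (Suc i) \<ominus> s i))"
      unfolding s_Suc f_def using s[of i] u(2) h(1) by algebra
    finally have "l \<otimes> l \<ominus> u = \<ominus> ((s (Suc i) \<ominus> s i) \<oplus> (s (Suc i) \<ominus> s i)) \<ominus> (s i \<ominus> l) \<otimes> (l \<oplus> s i)" .
    moreover have "near (max n 0) ((s i \<ominus> l) \<otimes> (l \<oplus> s i))"
      using near_mult[OF i1 ls] by simp
    ultimately have "near (max n 0) (l \<otimes> l \<ominus> u)"
      using i2 by (simp add: near_diff near_minus near_add)
    then show ?thesis by (rule near_mono) simp
  qed
  then have "l \<otimes> l \<ominus> u = \<zero>" by (rule near_all_imp_zero)
  then have "l \<otimes> l = u" using l(1) u(2) by (simp add: r_right_minus_eq)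
  then show ?thesis using l(1) by blast
qed

section \<open>Square classes of a local field\<close>

text \<open>The arithmetic of \<open>K\<close> is formulated for a subfield \<open>k\<close> of an
  ambient field, so that it can be moved to the image of \<open>K\<close> inside an extension. The
  data \<open>a\<close>, \<open>b\<close>, \<open>m\<close> encode an element of
  \<open>k(\<surd>e)\<close> whose norm is \<open>e\<close> times a square, and
  \<open>neg_one\<close> guarantees a square root of -1 in \<open>k(\<surd>e)\<close>.\<close>

locale square_classes = field R for R (structure) +
  fixes k :: "'a set" and e p a b m :: 'a
  assumes subfield_k: "subfield k R"
    and params: "e \<in> k" "p \<in> k" "a \<in> k" "b \<in> k" "m \<in> k" "e \<noteq> \<zero>" "p \<noteq> \<zero>" "m \<noteq> \<zero>"
    and two_nonzero: "\<one> \<oplus> \<one> \<noteq> \<zero>"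
    and classes: "\<lbrakk>x \<in> k; x \<noteq> \<zero>\<rbrakk> \<Longrightarrow> \<exists>d\<in>{\<one>, e, p, e \<otimes> p}. \<exists>s\<in>k. x = d \<otimes> (s \<otimes> s)"
    and e_nonsquare: "x \<in> k \<Longrightarrow> x \<otimes> x \<noteq> e"
    and p_not_norm: "\<lbrakk>x \<in> k; y \<in> k\<rbrakk> \<Longrightarrow> x \<otimes> x \<ominus> e \<otimes> (y \<otimes> y) \<noteq> p"
    and norm_class: "a \<otimes> a \<ominus> e \<otimes> (b \<otimes> b) = e \<otimes> (m \<otimes> m)"
    and neg_one: "(\<exists>j\<in>k. j \<otimes> j = \<ominus> \<one>) \<or> e = \<ominus> \<one>"

context discretely_valued_field
begin

lemma ex_valuation: "\<exists>x. x \<in> carrier K \<and> x \<noteq> \<zero> \<and> v x = n"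
proof -
  have "n \<in> v ` (carrier K - {\<zero>})" by (simp add: v_surj)
  then show ?thesis by blast
qed

text \<open>The quotient of two congruent units is a principal unit, hence a square by
  \<open>princ\<close>. This lifts identities from the residue field at the price of a square
  factor.\<close>

lemma unit_class:
  assumes princ: "\<forall>u\<in>carrier K. near 1 (u \<ominus> \<one>) \<longrightarrow> (\<exists>s\<in>carrier K. s \<otimes> s = u)"
    and u: "u \<in> carrier K" "u \<noteq> \<zero>" "v u = 0" and c: "c \<in> carrier K" "near 1 (c \<ominus> u)"
  shows "\<exists>t\<in>carrier K. u = c \<otimes> (t \<otimes> t)"
proof -
  have c': "c \<noteq> \<zero>" "v c = 0" using v_eqI[of u c] u c by auto
  then have ic: "inv c \<in> carrier K" "c \<otimes> inv c = \<one>" "near 0 (inv c)"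
    using c(1) by (auto simp: inv_nonzero near_inv)
  have "u \<otimes> inv c \<ominus> c \<otimes> inv c = \<ominus> ((c \<ominus> u) \<otimes> inv c)" using u(1) c(1) ic(1) by algebra
  moreover have "near 1 ((c \<ominus> u) \<otimes> inv c)" using near_mult[OF c(2) ic(3)] by simp
  ultimately have "near 1 (u \<otimes> inv c \<ominus> \<one>)" using ic(2) by (simp add: near_minus)
  with princ u(1) ic(1) obtain t where t: "t \<in> carrier K" "t \<otimes> t = u \<otimes> inv c" by blast
  have "c \<otimes> (u \<otimes> inv c) = u \<otimes> (c \<otimes> inv c)" using u(1) c(1) ic(1) by algebra
  then have "c \<otimes> (t \<otimes> t) = u" using t(2) ic(2) u(1) by simp
  with t(1) show ?thesis by metis
qed

text \<open>The extension by \<open>\<surd>e\<close> is unramified. If \<open>x\<close> and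
  \<open>y\<close> have different valuations, one of the two terms dominates, and its valuation is
  even. Otherwise \<open>t = x / y\<close> is a unit, and \<open>t^2 - e\<close> is a unit because
  \<open>e\<close> is not a square modulo the maximal ideal.\<close>

lemma even_valuation_of_norm:
  assumes e: "e \<in> carrier K" "e \<noteq> \<zero>" "v e = 0" "\<forall>y. near 0 y \<longrightarrow> \<not> near 1 (y \<otimes> y \<ominus> e)"
    and xy: "x \<in> carrier K" "y \<in> carrier K" "x \<otimes> x \<ominus> e \<otimes> (y \<otimes> y) \<noteq> \<zero>"
  shows "even (v (x \<otimes> x \<ominus> e \<otimes> (y \<otimes> y)))"
proof -
  let ?z = "x \<otimes> x \<ominus> e \<otimes> (y \<otimes> y)"
  have vx: "v (x \<otimes> x) = 2 * v x" "x \<otimes> x \<noteq> \<zero>" if "x \<noteq> \<zero>"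
    using that xy(1) v_mult[of x x] by (auto simp: integral_iff)
  have vy: "v (\<ominus> (e \<otimes> (y \<otimes> y))) = 2 * v y" "e \<otimes> (y \<otimes> y) \<noteq> \<zero>" if "y \<noteq> \<zero>"
    using that xy(2) e(1-3) v_mult[of y y] v_mult[of e "y \<otimes> y"] v_minus[of "e \<otimes> (y \<otimes> y)"] by (auto simp: integral_iff)
  have vy': "\<ominus> (e \<otimes> (y \<otimes> y)) \<noteq> \<zero>" if "y \<noteq> \<zero>"
    using vy(2)[OF that] e(1) xy(2) by simp
  consider "x = \<zero>" | "y = \<zero>" | "x \<noteq> \<zero>" "y \<noteq> \<zero>" "v x < v y" | "x \<noteq> \<zero>" "y \<noteq> \<zero>" "v y < v x"
    | "x \<noteq> \<zero>" "y \<noteq> \<zero>" "v x = v y" by linarith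
  then show ?thesis
  proof cases
    case 1
    then show ?thesis using xy vy e(1) by (cases "y = \<zero>") (auto simp: minus_eq)
  next
    case 2
    then show ?thesis using xy vx e(1) by (cases "x = \<zero>") (auto simp: minus_eq)
  next
    case 3
    have "?z \<ominus> x \<otimes> x = \<ominus> (e \<otimes> (y \<otimes> y))" using xy(1,2) e(1) by algebra
    then have "near (v (x \<otimes> x) + 1) (?z \<ominus> x \<otimes> x)"
      using 3 vx(1)[OF 3(1)] vy(1)[OF 3(2)] e(1) xy(1,2) by (simp add: near_def)
    then show ?thesis using v_eqI(2)[of "x \<otimes> x" ?z] vx[OF 3(1)] xy(1,2) e(1) by simp
  next
    case 4
    have "?z \<ominus> \<ominus> (e \<otimes> (y \<otimes> y)) = x \<otimes> x" using xy(1,2) e(1) by algebra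
    then have "near (v (\<ominus> (e \<otimes> (y \<otimes> y))) + 1) (?z \<ominus> \<ominus> (e \<otimes> (y \<otimes> y)))"
      using 4 vx(1)[OF 4(1)] vy(1)[OF 4(2)] e(1) xy(1,2) by (simp add: near_def)
    then show ?thesis
      using v_eqI(2)[of "\<ominus> (e \<otimes> (y \<otimes> y))" ?z] vy[OF 4(2)] vy'[OF 4(2)] xy(1,2) e(1) by simp
  next
    case 5
    define t where "t = x \<otimes> inv y"
    have iy: "inv y \<in> carrier K" "y \<otimes> inv y = \<one>" "inv y \<noteq> \<zero>" using 5 xy by (auto simp: inv_nonzero)
    have t: "t \<in> carrier K" "v t = 0" "t \<noteq> \<zero>"
      using 5 xy iy v_mult[of x "inv y"] v_inv[of y] by (auto simp: t_def integral_iff)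
    then have "near 0 t" by (simp add: near_def)
    then have n0: "near 0 (t \<otimes> t \<ominus> e)"
      using near_mult[of 0 t 0 t] e(1,3) by (intro near_diff) (auto simp: near_def)
    moreover have "\<not> near 1 (t \<otimes> t \<ominus> e)" using e(4) \<open>near 0 t\<close> by blast
    ultimately have w: "t \<otimes> t \<ominus> e \<noteq> \<zero>" "v (t \<otimes> t \<ominus> e) = 0"
      by (auto simp: near_def)
    have "y \<otimes> y \<otimes> (t \<otimes> t \<ominus> e) = (x \<otimes> x) \<otimes> ((y \<otimes> inv y) \<otimes> (y \<otimes> inv y)) \<ominus> e \<otimes> (y \<otimes> y)"
      unfolding t_def using xy(1,2) iy(1) e(1) by algebra
    then have "?z = y \<otimes> y \<otimes> (t \<otimes> t \<ominus> e)" using iy(2) xy(1,2) by simp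
    moreover have "v (y \<otimes> y \<otimes> (t \<otimes> t \<ominus> e)) = 2 * v y"
      using v_mult[of "y \<otimes> y" "t \<otimes> t \<ominus> e"] v_mult[of y y] w 5(2) xy(2) t(1) e(1) by (simp add: integral_iff)
    ultimately show ?thesis by simp
  qed
qed

text \<open>For \<open>p\<close> a uniformizer is taken: its valuation 1 is odd, so it is not a
  norm. The four classes come from the parity of the valuation and the class of the remaining
  unit.\<close>

lemma square_classes_carrier:
  assumes princ: "\<forall>u\<in>carrier K. near 1 (u \<ominus> \<one>) \<longrightarrow> (\<exists>s\<in>carrier K. s \<otimes> s = u)"
    and two: "\<one> \<oplus> \<one> \<noteq> \<zero>"
    and e: "e \<in> carrier K" "e \<noteq> \<zero>" "v e = 0" "\<forall>y. near 0 y \<longrightarrow> \<not> near 1 (y \<otimes> y \<ominus> e)"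
    and reps: "\<forall>u. u \<in> carrier K \<and> u \<noteq> \<zero> \<and> v u = 0 \<longrightarrow>
       (\<exists>s\<in>carrier K. near 1 (s \<otimes> s \<ominus> u) \<or> near 1 (e \<otimes> (s \<otimes> s) \<ominus> u))"
    and abm: "a \<in> carrier K" "b \<in> carrier K" "m \<in> carrier K" "m \<noteq> \<zero>" "a \<otimes> a \<ominus> e \<otimes> (b \<otimes> b) = e \<otimes> (m \<otimes> m)"
    and neg: "(\<exists>j\<in>carrier K. j \<otimes> j = \<ominus> \<one>) \<or> e = \<ominus> \<one>"
  shows "\<exists>p. square_classes K (carrier K) e p a b m"
proof -
  obtain p where p: "p \<in> carrier K" "p \<noteq> \<zero>" "v p = 1" using ex_valuation by blast
  have unit: "\<exists>d\<in>{\<one>, e}. \<exists>s\<in>carrier K. u = d \<otimes> (s \<otimes> s)" if u: "u \<in> carrier K" "u \<noteq> \<zero>" "v u = 0" for u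
  proof -
    from reps u obtain s where s: "s \<in> carrier K" "near 1 (s \<otimes> s \<ominus> u) \<or> near 1 (e \<otimes> (s \<otimes> s) \<ominus> u)" by blast
    then have "\<exists>d\<in>{\<one>, e}. near 1 (d \<otimes> (s \<otimes> s) \<ominus> u)" by auto
    then obtain d where d: "d \<in> {\<one>, e}" "d \<in> carrier K" "near 1 (d \<otimes> (s \<otimes> s) \<ominus> u)"
      using e(1) one_closed by blast
    then obtain t where t: "t \<in> carrier K" "u = d \<otimes> (s \<otimes> s) \<otimes> (t \<otimes> t)"
      using unit_class[OF princ u _ d(3)] s(1) by blast
    have "u = d \<otimes> ((s \<otimes> t) \<otimes> (s \<otimes> t))" unfolding t(2) using d(2) s(1) t(1) by algebra
    then show ?thesis using d(1) s(1) t(1) by blast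
  qed
  have "\<exists>d\<in>{\<one>, e, p, e \<otimes> p}. \<exists>s\<in>carrier K. x = d \<otimes> (s \<otimes> s)" if x: "x \<in> carrier K" "x \<noteq> \<zero>" for x
  proof -
    \<comment> \<open>Dividing \<open>x\<close> by \<open>c w^2\<close> with \<open>c\<close> equal
      to 1 or \<open>p\<close>, according to the parity of \<open>v x\<close>, leaves a
      unit.\<close>
    obtain w where w: "w \<in> carrier K" "w \<noteq> \<zero>" "v w = v x div 2"
      using ex_valuation by blast
    obtain c where c: "c \<in> {\<one>, p}" "c \<in> carrier K" "c \<noteq> \<zero>" "v c = v x mod 2"
      using p v_one one_closed one_not_zero by (metis insertCI mod2_eq_if)
    define y where "y = c \<otimes> (w \<otimes> w)"
    have y: "y \<in> carrier K" "y \<noteq> \<zero>" "v y = v x"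
      using c w v_mult[of w w] v_mult[of c "w \<otimes> w"] by (auto simp: y_def integral_iff)
    have iy: "inv y \<in> carrier K" "inv y \<noteq> \<zero>" "y \<otimes> inv y = \<one>" using inv_nonzero y by auto
    have xy: "v (x \<otimes> inv y) = 0" "x \<otimes> inv y \<noteq> \<zero>"
      using v_mult[of x "inv y"] iy x v_inv[of y] y by (auto simp: integral_iff)
    then obtain d s where d: "d \<in> {\<one>, e}" "s \<in> carrier K" "x \<otimes> inv y = d \<otimes> (s \<otimes> s)"
      using unit[OF _ xy(2,1)] x iy by blast
    have d': "d \<in> carrier K" using d(1) e(1) by auto
    have "x = (x \<otimes> inv y) \<otimes> y" using x y(1) iy by (metis m_assoc m_comm r_one)
    also have "\<dots> = d \<otimes> (s \<otimes> s) \<otimes> y" by (simp only: d(3))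
    also have "\<dots> = d \<otimes> c \<otimes> ((s \<otimes> w) \<otimes> (s \<otimes> w))"
      unfolding y_def using d(2) d' c(2) w(1) by algebra
    finally have "x = d \<otimes> c \<otimes> ((s \<otimes> w) \<otimes> (s \<otimes> w))" .
    moreover have "d \<otimes> c \<in> {\<one>, e, p, e \<otimes> p}" using d(1) c(1) e(1) p(1) by auto
    ultimately show ?thesis using d(2) w(1) by blast
  qed
  moreover have "x \<otimes> x \<noteq> e" if "x \<in> carrier K" for x
  proof
    assume *: "x \<otimes> x = e"
    then have "x \<noteq> \<zero>" using e by auto
    then have "near 0 x" using v_mult[of x x] * e(3) that by (simp add: near_def)
    then show False using e(4)[rule_format, of x] * e(1) by (simp add: minus_eq r_neg near_zero)
  qed
  moreover have "x \<otimes> x \<ominus> e \<otimes> (y \<otimes> y) \<noteq> p" if "x \<in> carrier K" "y \<in> carrier K" for x y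
    using even_valuation_of_norm[OF e that] p by auto
  ultimately have "square_classes K (carrier K) e p a b m"
    by (intro square_classes.intro square_classes_axioms.intro)
      (use field_axioms carrier_is_subfield e(1,2) p(1,2) abm two neg in blast)+
  then show ?thesis ..
qed

section \<open>Reduction to the residue field\<close>

definition res :: "'a \<Rightarrow> 'a set" where
  "res x = valuation_ideal K v +>\<^bsub>valuation_ring K v\<^esub> x"

lemma carrier_valuation_ring: "carrier (valuation_ring K v) = {x. near 0 x}"
  by (auto simp: valuation_ring_def near_def)

lemma valuation_ideal_eq: "valuation_ideal K v = {x. near 1 x}"
  by (auto simp: valuation_ideal_def near_def)

lemma subring_near: "subring {x. near 0 x} K"
  using near_mult[of 0 _ 0] by (intro subringI) (auto simp: near_closed near_one near_add near_minus)

lemma valuation_ring_cring: "cring (valuation_ring K v)"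
proof -
  have "valuation_ring K v = K\<lparr>carrier := {x. near 0 x}\<rparr>"
    by (simp add: valuation_ring_def near_def)
  then show ?thesis using subring_near subcringI' subcring_iff[of "{x. near 0 x}"]
    by (metis (no_types, lifting) near_closed mem_Collect_eq subsetI)
qed

lemma valuation_ring_ops:
  "x \<oplus>\<^bsub>valuation_ring K v\<^esub> y = x \<oplus> y" "x \<otimes>\<^bsub>valuation_ring K v\<^esub> y = x \<otimes> y"
  "\<zero>\<^bsub>valuation_ring K v\<^esub> = \<zero>" "\<one>\<^bsub>valuation_ring K v\<^esub> = \<one>"
  by (simp_all add: valuation_ring_def)

lemma valuation_ring_minus:
  assumes "near 0 x" shows "\<ominus>\<^bsub>valuation_ring K v\<^esub> x = \<ominus> x"
proof -
  interpret O: cring "valuation_ring K v" by (rule valuation_ring_cring)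
  show ?thesis
    using O.minus_equality[of "\<ominus> x" x] assms
    by (simp add: carrier_valuation_ring valuation_ring_ops near_minus l_neg near_closed)
qed

lemma valuation_ideal_ideal: "ideal (valuation_ideal K v) (valuation_ring K v)"
proof -
  interpret O: cring "valuation_ring K v" by (rule valuation_ring_cring)
  show ?thesis
  proof (rule idealI[OF O.ring_axioms])
    show "subgroup (valuation_ideal K v) (add_monoid (valuation_ring K v))"
    proof (rule group.subgroupI[OF O.a_group])
      fix x assume "x \<in> valuation_ideal K v"
      then show "inv\<^bsub>add_monoid (valuation_ring K v)\<^esub> x \<in> valuation_ideal K v"
        using valuation_ring_minus[of x] near_minus[of 1 x] near_mono[of 1 x 0]
        by (simp add: valuation_ideal_eq a_inv_def)
    qed (auto simp: valuation_ideal_eq carrier_valuation_ring valuation_ring_ops near_add near_zero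
        intro: near_mono exI[of _ \<zero>])
  qed (use near_mult[of 1 _ 0] near_mult[of 0 _ 1] in \<open>auto simp: valuation_ideal_eq carrier_valuation_ring valuation_ring_ops\<close>)
qed

abbreviation k :: "'a set ring" where
  "k \<equiv> residue_field K v"

lemma res_hom: "res \<in> ring_hom (valuation_ring K v) k"
  using ideal.rcos_ring_hom[OF valuation_ideal_ideal] by (simp add: res_def[abs_def] residue_field_def)

lemma res_eq_iff: "near 0 x \<Longrightarrow> near 0 y \<Longrightarrow> res x = res y \<longleftrightarrow> near 1 (x \<ominus> y)"
proof -
  assume xy: "near 0 x" "near 0 y"
  interpret O: cring "valuation_ring K v" by (rule valuation_ring_cring)
  have "x \<ominus>\<^bsub>valuation_ring K v\<^esub> y = x \<ominus> y"
    using xy by (simp add: a_minus_def valuation_ring_minus valuation_ring_ops)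
  then show ?thesis
    using O.quotient_eq_iff_same_a_r_cos[OF valuation_ideal_ideal, of x y] xy
    by (simp add: carrier_valuation_ring valuation_ideal_eq res_def)
qed

lemma res_surj: "c \<in> carrier k \<Longrightarrow> \<exists>x. near 0 x \<and> c = res x"
  by (auto simp: residue_field_def FactRing_def A_RCOSETS_def' res_def carrier_valuation_ring)

lemma res_closed: "near 0 x \<Longrightarrow> res x \<in> carrier k"
  using ring_hom_closed[OF res_hom, of x] by (simp add: carrier_valuation_ring)

lemma res_add: "near 0 x \<Longrightarrow> near 0 y \<Longrightarrow> res (x \<oplus> y) = res x \<oplus>\<^bsub>k\<^esub> res y"
  using ring_hom_add[OF res_hom, of x y] by (simp add: carrier_valuation_ring valuation_ring_ops)

lemma res_mult: "near 0 x \<Longrightarrow> near 0 y \<Longrightarrow> res (x \<otimes> y) = res x \<otimes>\<^bsub>k\<^esub> res y"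
  using ring_hom_mult[OF res_hom, of x y] by (simp add: carrier_valuation_ring valuation_ring_ops)

lemma res_one: "res \<one> = \<one>\<^bsub>k\<^esub>"
  using ring_hom_one[OF res_hom] by (simp add: valuation_ring_ops)

lemma res_zero: "res \<zero> = \<zero>\<^bsub>k\<^esub>"
  using ring_hom_zero[OF res_hom cring.axioms(1)[OF valuation_ring_cring]]
    ideal.quotient_is_ring[OF valuation_ideal_ideal] by (simp add: residue_field_def valuation_ring_ops)

lemma res_eq_zero_iff: "near 0 x \<Longrightarrow> res x = \<zero>\<^bsub>k\<^esub> \<longleftrightarrow> near 1 x"
  using res_eq_iff[of x \<zero>] near_zero[of 0] by (simp add: res_zero minus_eq near_closed)

lemma near_nonzero_iff_unit: "near 0 x \<and> \<not> near 1 x \<longleftrightarrow> x \<in> carrier K \<and> x \<noteq> \<zero> \<and> v x = 0"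
  by (auto simp: near_def)

lemma near_mult_0: "near 0 x \<Longrightarrow> near 0 y \<Longrightarrow> near 0 (x \<otimes> y)"
  using near_mult[of 0 x 0 y] by simp

lemma residue_field_field: "field k"
proof -
  have "cring k"
    using ideal.quotient_is_cring[OF valuation_ideal_ideal valuation_ring_cring] by (simp add: residue_field_def)
  then interpret F: cring k .
  show ?thesis
  proof (rule F.cring_fieldI2)
    show "\<zero>\<^bsub>k\<^esub> \<noteq> \<one>\<^bsub>k\<^esub>"
      using res_eq_zero_iff[OF near_one] by (auto simp: res_one near_def v_one)
  next
    fix c assume c: "c \<in> carrier k" "c \<noteq> \<zero>\<^bsub>k\<^esub>"
    then obtain x where x: "near 0 x" "c = res x" using res_surj by blast
    then have x': "x \<in> carrier K" "x \<noteq> \<zero>" "v x = 0"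
      using c(2) res_eq_zero_iff near_nonzero_iff_unit by blast+
    then have i: "near 0 (inv x)" "x \<otimes> inv x = \<one>" using near_inv[of x 0] inv_nonzero[of x] by auto
    then have "c \<otimes>\<^bsub>k\<^esub> res (inv x) = \<one>\<^bsub>k\<^esub>"
      using res_mult[OF x(1) i(1)] x(2) by (simp add: res_one)
    then show "\<exists>d\<in>carrier k. c \<otimes>\<^bsub>k\<^esub> d = \<one>\<^bsub>k\<^esub>"
      using i(1) res_closed by blast
  qed
qed

text \<open>If \<open>1 + 1\<close> vanished, the additive order of 1 would divide 2 without being
  1, making the characteristic equal to 2.\<close>

lemma two_nonzero_residue_field:
  assumes "ring_characteristic k \<noteq> 2"
  shows "\<one>\<^bsub>k\<^esub> \<oplus>\<^bsub>k\<^esub> \<one>\<^bsub>k\<^esub> \<noteq> \<zero>\<^bsub>k\<^esub>"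
proof
  interpret F: field k by (rule residue_field_field)
  let ?o = "group.ord (add_monoid k) \<one>\<^bsub>k\<^esub>"
  assume *: "\<one>\<^bsub>k\<^esub> \<oplus>\<^bsub>k\<^esub> \<one>\<^bsub>k\<^esub> = \<zero>\<^bsub>k\<^esub>"
  have "\<one>\<^bsub>k\<^esub> [^]\<^bsub>add_monoid k\<^esub> (2::nat) = \<zero>\<^bsub>k\<^esub>"
    using * by (simp add: numeral_2_eq_2)
  then have "?o dvd 2" using group.pow_eq_id[OF F.a_group, of "\<one>\<^bsub>k\<^esub>" 2] by simp
  moreover have "?o \<noteq> 1" using group.ord_eq_1[OF F.a_group, of "\<one>\<^bsub>k\<^esub>"] by simp
  ultimately have "?o = 2" using two_is_prime_nat prime_nat_iff by blast
  then show False using assms by (simp add: ring_characteristic_def)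
qed

lemma two_unit:
  assumes "ring_characteristic k \<noteq> 2"
  shows "\<one> \<oplus> \<one> \<noteq> \<zero>" "v (\<one> \<oplus> \<one>) = 0"
proof -
  have n: "near 0 (\<one> \<oplus> \<one>)" by (simp add: near_add near_one)
  moreover have "\<not> near 1 (\<one> \<oplus> \<one>)"
    using two_nonzero_residue_field[OF assms] res_eq_zero_iff[OF n] by (simp add: res_add near_one res_one)
  ultimately show "\<one> \<oplus> \<one> \<noteq> \<zero>" "v (\<one> \<oplus> \<one>) = 0" using near_nonzero_iff_unit by blast+
qed

lemma res_neg_one: "res (\<ominus> \<one>) = \<ominus>\<^bsub>k\<^esub> \<one>\<^bsub>k\<^esub>"
proof -
  interpret F: field k by (rule residue_field_field)
  have "res (\<ominus> \<one> \<oplus> \<one>) = res (\<ominus> \<one>) \<oplus>\<^bsub>k\<^esub> res \<one>"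
    by (intro res_add near_minus near_one)
  then show ?thesis
    using F.minus_equality[of "res (\<ominus> \<one>)" "\<one>\<^bsub>k\<^esub>"] res_closed near_minus[OF near_one]
    by (simp add: l_neg res_one res_zero)
qed

end

context local_field
begin

text \<open>With \<open>j^2 = -1\<close> in \<open>K\<close>, the norm \<open>-e\<close> of
  \<open>\<surd>e\<close> is \<open>e j^2\<close>; hence \<open>a = 0\<close>, \<open>b = 1\<close>,
  \<open>m = j\<close> are admissible.\<close>

lemma square_classes_1_mod_4:
  assumes char: "ring_characteristic k \<noteq> 2"
    and q: "order k mod 4 = 1"
  shows "\<exists>e p m. square_classes K (carrier K) e p \<zero> \<one> m \<and> (\<exists>j\<in>carrier K. j \<otimes> j = \<ominus> \<one>)"
proof -
  interpret F: field k by (rule residue_field_field)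
  note two = two_unit[OF char] and two' = two_nonzero_residue_field[OF char]
  have princ: "\<forall>u\<in>carrier K. near 1 (u \<ominus> \<one>) \<longrightarrow> (\<exists>s\<in>carrier K. s \<otimes> s = u)"
    using principal_unit_square[OF two] by blast
  have "odd n" if "n mod 4 = 1" for n :: nat using that by presburger
  then have "odd (order k)" using q by blast
  have "4 dvd order k - 1"
    using dvd_minus_mod[of 4 "order k"] q by simp
  obtain e' where e': "e' \<in> carrier k" "e' \<noteq> \<zero>\<^bsub>k\<^esub>"
    "\<And>x. x \<in> carrier k \<Longrightarrow> x \<otimes>\<^bsub>k\<^esub> x \<noteq> e'"
    "\<And>x. x \<in> carrier k \<Longrightarrow> \<exists>s\<in>carrier k.
       x = s \<otimes>\<^bsub>k\<^esub> s \<or> x = e' \<otimes>\<^bsub>k\<^esub> (s \<otimes>\<^bsub>k\<^esub> s)"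
    using F.finite_field_nonsquare[OF finite_residue_field \<open>odd _\<close>] by blast
  obtain e where e: "near 0 e" "e' = res e" using res_surj[OF e'(1)] by blast
  then have eu: "e \<in> carrier K" "e \<noteq> \<zero>" "v e = 0"
    using e'(2) res_eq_zero_iff near_nonzero_iff_unit by blast+
  have ns: "\<not> near 1 (y \<otimes> y \<ominus> e)" if "near 0 y" for y
    using res_eq_iff[OF near_mult_0[OF that that] e(1)] e'(3)[OF res_closed[OF that]] that e(2)
    by (simp add: res_mult)
  have reps: "\<exists>s\<in>carrier K. near 1 (s \<otimes> s \<ominus> u) \<or> near 1 (e \<otimes> (s \<otimes> s) \<ominus> u)"
    if u: "u \<in> carrier K" "u \<noteq> \<zero>" "v u = 0" for u
  proof -
    have nu: "near 0 u" using u by (simp add: near_def)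
    obtain s' where s': "s' \<in> carrier k"
      "res u = s' \<otimes>\<^bsub>k\<^esub> s' \<or> res u = e' \<otimes>\<^bsub>k\<^esub> (s' \<otimes>\<^bsub>k\<^esub> s')"
      using e'(4)[OF res_closed[OF nu]] by blast
    obtain s where s: "near 0 s" "s' = res s" using res_surj[OF s'(1)] by blast
    have "near 1 (s \<otimes> s \<ominus> u) \<or> near 1 (e \<otimes> (s \<otimes> s) \<ominus> u)"
      using s'(2) res_eq_iff[OF _ nu, of "s \<otimes> s"] res_eq_iff[OF _ nu, of "e \<otimes> (s \<otimes> s)"] s e
      by (auto simp: res_mult near_mult_0)
    then show ?thesis using near_closed[OF s(1)] by blast
  qed
  obtain j' where j': "j' \<in> carrier k"
    "j' \<otimes>\<^bsub>k\<^esub> j' = \<ominus>\<^bsub>k\<^esub> \<one>\<^bsub>k\<^esub>"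
    using F.finite_field_sqrt_neg_one[OF finite_residue_field two' \<open>4 dvd _\<close>] by blast
  obtain i where i: "near 0 i" "j' = res i" using res_surj[OF j'(1)] by blast
  \<comment> \<open>The lift \<open>i\<close> is a square root of -1 only modulo the maximal ideal;
    the factor \<open>t\<close> from \<open>unit_class\<close> corrects it.\<close>
  have "near 1 (i \<otimes> i \<ominus> \<ominus> \<one>)"
    using res_eq_iff[OF near_mult_0[OF i(1) i(1)] near_minus[OF near_one]] j'(2) i
    by (simp add: res_mult res_neg_one)
  then obtain t where t: "t \<in> carrier K" "\<ominus> \<one> = i \<otimes> i \<otimes> (t \<otimes> t)"
    using unit_class[OF princ, of "\<ominus> \<one>" "i \<otimes> i"] near_closed[OF i(1)] neg_one_nonzero v_neg_one
    by auto
  define j where "j = i \<otimes> t"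
  have j: "j \<in> carrier K" "j \<otimes> j = \<ominus> \<one>"
    unfolding t(2) j_def using t(1) near_closed[OF i(1)] by (simp, algebra)
  have "j \<noteq> \<zero>" using j(2) neg_one_nonzero by (metis l_null zero_closed)
  have "\<zero> \<otimes> \<zero> \<ominus> e \<otimes> (\<one> \<otimes> \<one>) = e \<otimes> (\<ominus> \<one>)"
    using eu(1) by algebra
  then have "\<zero> \<otimes> \<zero> \<ominus> e \<otimes> (\<one> \<otimes> \<one>) = e \<otimes> (j \<otimes> j)" using j(2) by simp
  then have "\<exists>p. square_classes K (carrier K) e p \<zero> \<one> j"
    using square_classes_carrier[OF princ two(1) eu, of \<zero> \<one> j] ns reps j \<open>j \<noteq> \<zero>\<close> by blast
  with j show ?thesis by blast
qed

text \<open>The element -1 now represents the nonsquare units, and a solution of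
  \<open>a^2 + b^2 = -1\<close> in the residue field lifts to one in \<open>K\<close>, which is the
  norm condition with \<open>m = 1\<close>.\<close>

lemma square_classes_3_mod_4:
  assumes char: "ring_characteristic k \<noteq> 2"
    and q: "order k mod 4 = 3"
  shows "\<exists>p a b. square_classes K (carrier K) (\<ominus> \<one>) p a b \<one>"
proof -
  interpret F: field k by (rule residue_field_field)
  note two = two_unit[OF char] and two' = two_nonzero_residue_field[OF char]
  have princ: "\<forall>u\<in>carrier K. near 1 (u \<ominus> \<one>) \<longrightarrow> (\<exists>s\<in>carrier K. s \<otimes> s = u)"
    using principal_unit_square[OF two] by blast
  note fin = finite_residue_field
  have n1: "near 0 (\<ominus> \<one>)" by (intro near_minus near_one)
  have ns: "\<not> near 1 (y \<otimes> y \<ominus> \<ominus> \<one>)" if "near 0 y" for y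
    using res_eq_iff[OF near_mult_0[OF that that] n1] that
      F.finite_field_neg_one_nonsquare[OF fin two' q res_closed[OF that]]
    by (simp add: res_mult res_neg_one)
  have reps: "\<exists>s\<in>carrier K. near 1 (s \<otimes> s \<ominus> u) \<or> near 1 (\<ominus> \<one> \<otimes> (s \<otimes> s) \<ominus> u)"
    if u: "u \<in> carrier K" "u \<noteq> \<zero>" "v u = 0" for u
  proof -
    have nu: "near 0 u" using u by (simp add: near_def)
    obtain s' where s': "s' \<in> carrier k"
      "res u = s' \<otimes>\<^bsub>k\<^esub> s' \<or> res u = \<ominus>\<^bsub>k\<^esub> (s' \<otimes>\<^bsub>k\<^esub> s')"
      using F.finite_field_squares_up_to_sign[OF fin two' q res_closed[OF nu]] by blast
    obtain s where s: "near 0 s" "s' = res s" using res_surj[OF s'(1)] by blast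
    have "res (\<ominus> \<one> \<otimes> (s \<otimes> s)) = \<ominus>\<^bsub>k\<^esub> (s' \<otimes>\<^bsub>k\<^esub> s')"
      using s s'(1) by (simp only: res_mult near_mult_0 n1 res_neg_one) (simp add: F.l_minus)
    then have "near 1 (s \<otimes> s \<ominus> u) \<or> near 1 (\<ominus> \<one> \<otimes> (s \<otimes> s) \<ominus> u)"
      using s'(2) res_eq_iff[OF near_mult_0[OF s(1) s(1)] nu] s
        res_eq_iff[OF near_mult_0[OF n1 near_mult_0[OF s(1) s(1)]] nu]
      by (auto simp: res_mult)
    then show ?thesis using near_closed[OF s(1)] by blast
  qed
  obtain a' b' where ab': "a' \<in> carrier k" "b' \<in> carrier k"
    "a' \<otimes>\<^bsub>k\<^esub> a' \<oplus>\<^bsub>k\<^esub> b' \<otimes>\<^bsub>k\<^esub> b'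
      = \<ominus>\<^bsub>k\<^esub> \<one>\<^bsub>k\<^esub>"
    using F.finite_field_neg_one_sum_of_squares[OF fin two' q] by blast
  obtain x y where x: "near 0 x" "a' = res x" and y: "near 0 y" "b' = res y"
    using res_surj[OF ab'(1)] res_surj[OF ab'(2)] by blast
  have xy: "x \<in> carrier K" "y \<in> carrier K" using near_closed x y by blast+
  have n: "near 0 (x \<otimes> x \<oplus> y \<otimes> y)" using x y by (intro near_add near_mult_0)
  have "near 1 (x \<otimes> x \<oplus> y \<otimes> y \<ominus> \<ominus> \<one>)"
    using res_eq_iff[OF n n1] ab'(3) x y by (simp add: res_mult res_add res_neg_one near_mult_0)
  \<comment> \<open>The lifted sum agrees with -1 up to a square, which is absorbed by scaling both
    \<open>x\<close> and \<open>y\<close> with \<open>t\<close>.\<close>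
  then obtain t where t: "t \<in> carrier K" "\<ominus> \<one> = (x \<otimes> x \<oplus> y \<otimes> y) \<otimes> (t \<otimes> t)"
    using unit_class[OF princ, of "\<ominus> \<one>" "x \<otimes> x \<oplus> y \<otimes> y"] xy neg_one_nonzero v_neg_one by auto
  have "(x \<otimes> t) \<otimes> (x \<otimes> t) \<ominus> \<ominus> \<one> \<otimes> ((y \<otimes> t) \<otimes> (y \<otimes> t)) = (x \<otimes> x \<oplus> y \<otimes> y) \<otimes> (t \<otimes> t)"
    using xy t(1) by algebra
  also have "\<dots> = \<ominus> \<one> \<otimes> (\<one> \<otimes> \<one>)" by (simp add: t(2)[symmetric])
  finally have "\<exists>p. square_classes K (carrier K) (\<ominus> \<one>) p (x \<otimes> t) (y \<otimes> t) \<one>"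
    using xy t(1) neg_one_nonzero v_neg_one ns reps
    by (intro square_classes_carrier[OF princ two(1)]) auto
  then show ?thesis by blast
qed

lemma odd_residue_field_order:
  assumes "ring_characteristic k \<noteq> 2"
  shows "odd (order k)"
  using field.odd_order_if_two_nonzero[OF residue_field_field finite_residue_field
      two_nonzero_residue_field[OF assms]] .

end

section \<open>Galois actions of groups of order eight\<close>

context field
begin

lemma nonzero_inv:
  assumes "x \<in> carrier R" "x \<noteq> \<zero>"
  shows "inv x \<in> carrier R" "x \<otimes> inv x = \<one>" "inv x \<noteq> \<zero>"
proof -
  show i: "inv x \<in> carrier R" "x \<otimes> inv x = \<one>" using assms by (simp_all add: field_Units)
  show "inv x \<noteq> \<zero>" using i(2) assms(1) by (metis one_not_zero r_null)
qed

lemma endo_closed: "g \<in> ring_hom R R \<Longrightarrow> x \<in> carrier R \<Longrightarrow> g x \<in> carrier R"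
  by (rule ring_hom_closed)

lemma endo_zero: "g \<in> ring_hom R R \<Longrightarrow> g \<zero> = \<zero>"
  by (rule ring_hom_zero[OF _ ring_axioms ring_axioms])

lemma endo_minus: "g \<in> ring_hom R R \<Longrightarrow> x \<in> carrier R \<Longrightarrow> g (\<ominus> x) = \<ominus> g x"
  using ring_hom_add[of g R R "\<ominus> x" x] minus_equality[of "g (\<ominus> x)" "g x"]
  by (simp add: l_neg endo_zero endo_closed)

lemma endo_diff: "g \<in> ring_hom R R \<Longrightarrow> x \<in> carrier R \<Longrightarrow> y \<in> carrier R \<Longrightarrow> g (x \<ominus> y) = g x \<ominus> g y"
  by (simp add: minus_eq ring_hom_add endo_minus)

lemma endo_eq_zero: "g \<in> ring_hom R R \<Longrightarrow> x \<in> carrier R \<Longrightarrow> g x = \<zero> \<longleftrightarrow> x = \<zero>"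
  using ring_hom_mult[of g R R x "inv x"] nonzero_inv[of x]
  by (metis endo_closed endo_zero l_null one_not_zero ring_hom_one)

lemma endo_inv:
  assumes "g \<in> ring_hom R R" "x \<in> carrier R" "x \<noteq> \<zero>"
  shows "g (inv x) = inv (g x)"
proof -
  have "g x \<otimes> g (inv x) = \<one>"
    using ring_hom_mult[OF assms(1,2), of "inv x"] nonzero_inv[OF assms(2,3)] ring_hom_one[OF assms(1)] by simp
  then show ?thesis
    using comm_inv_char[of "g x" "g (inv x)"] nonzero_inv[OF assms(2,3)] assms by (simp add: endo_closed)
qed

lemmas endo = endo_closed endo_minus endo_diff ring_hom_add[where R = R and S = R]
  ring_hom_mult[where R = R and S = R] ring_hom_one[where R = R and S = R] endo_zero

lemma square_eq_iff:
  assumes "x \<in> carrier R" "y \<in> carrier R"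
  shows "x \<otimes> x = y \<otimes> y \<longleftrightarrow> x = y \<or> x = \<ominus> y"
proof
  assume *: "x \<otimes> x = y \<otimes> y"
  have "(x \<ominus> y) \<otimes> (x \<oplus> y) = x \<otimes> x \<ominus> y \<otimes> y" using assms by algebra
  also have "\<dots> = \<zero>" using assms * by simp
  finally have "x \<ominus> y = \<zero> \<or> x \<oplus> y = \<zero>" using assms by (simp add: integral_iff)
  then show "x = y \<or> x = \<ominus> y" using assms by (metis r_right_minus_eq minus_equality)
next
  show "x = y \<or> x = \<ominus> y \<Longrightarrow> x \<otimes> x = y \<otimes> y" using assms by (auto simp: l_minus r_minus)
qed

lemma neg_eq_self:
  assumes "\<one> \<oplus> \<one> \<noteq> \<zero>" "x \<in> carrier R" "\<ominus> x = x"
  shows "x = \<zero>"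
proof -
  have "(\<one> \<oplus> \<one>) \<otimes> x = x \<oplus> x" using assms(2) by algebra
  also have "\<dots> = \<zero>" using assms(2,3) by (metis l_neg)
  finally show ?thesis using assms(1,2) by (simp add: integral_iff)
qed

text \<open>If \<open>S\<close> is a subfield containing the square of \<open>u\<close>, this is
  \<open>S(u)\<close>. As an operation on sets it can be nested to describe a tower of quadratic
  extensions without turning the intermediate stages into fields.\<close>

definition pair_span :: "'a set \<Rightarrow> 'a \<Rightarrow> 'a set" where
  "pair_span S u = {s \<oplus> t \<otimes> u | s t. s \<in> S \<and> t \<in> S}"

lemma pair_span_closed: "S \<subseteq> carrier R \<Longrightarrow> u \<in> carrier R \<Longrightarrow> pair_span S u \<subseteq> carrier R"
  by (auto simp: pair_span_def)

lemma hom_eq_on_pair_span: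
  assumes f: "f \<in> ring_hom R T" and g: "g \<in> ring_hom R T" and S: "S \<subseteq> carrier R" "u \<in> carrier R"
    and eq: "\<And>x. x \<in> S \<Longrightarrow> f x = g x" "f u = g u" and x: "x \<in> pair_span S u"
  shows "f x = g x"
proof -
  obtain s t where st: "x = s \<oplus> t \<otimes> u" "s \<in> S" "t \<in> S" using x by (auto simp: pair_span_def)
  then have c: "s \<in> carrier R" "t \<in> carrier R" using S by auto
  show ?thesis
    unfolding st(1) using c S(2) eq(1)[OF st(2)] eq(1)[OF st(3)] eq(2)
    by (simp add: ring_hom_add[OF f] ring_hom_add[OF g] ring_hom_mult[OF f] ring_hom_mult[OF g])
qed

text \<open>If the norm of \<open>\<beta>\<close> is a square \<open>n\<^sup>2\<close>, then \<open>(\<beta> + n)\<^sup>2\<close> is \<open>\<beta>\<close> times the trace of \<open>\<beta> + n\<close>.\<close>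

lemma square_norm:
  assumes w: "w \<in> ring_hom R R" and \<beta>: "\<beta> \<in> carrier R" "\<beta> \<noteq> \<zero>" "w (w \<beta>) = \<beta>"
    and n: "n \<in> carrier R" "w n = n" "\<beta> \<otimes> w \<beta> = n \<otimes> n"
  shows "\<exists>f\<in>carrier R. \<exists>m\<in>carrier R. f \<noteq> \<zero> \<and> m \<noteq> \<zero> \<and> \<beta> = f \<otimes> (m \<otimes> m) \<and> w f = f \<and>
    (\<forall>f'\<in>ring_hom R R. f' n = n \<and> f' \<beta> = \<beta> \<and> f' (w \<beta>) = w \<beta> \<longrightarrow> f' f = f \<and> f' m = m)"
proof -
  define t where "t = \<beta> \<oplus> w \<beta> \<oplus> n \<oplus> n"
  define s where "s = \<beta> \<oplus> n"
  have w\<beta>: "w \<beta> \<in> carrier R" using endo_closed[OF w \<beta>(1)] .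
  have t: "t \<in> carrier R" and s: "s \<in> carrier R" using \<beta> n w\<beta> by (simp_all add: t_def s_def)
  have "s \<otimes> s = \<beta> \<otimes> \<beta> \<oplus> \<beta> \<otimes> n \<oplus> \<beta> \<otimes> n \<oplus> n \<otimes> n" unfolding s_def using \<beta>(1) n(1) by algebra
  also have "\<dots> = \<beta> \<otimes> t" unfolding n(3)[symmetric] t_def using \<beta>(1) w\<beta> n(1) by algebra
  finally have ss: "s \<otimes> s = \<beta> \<otimes> t" .
  show ?thesis
  proof (cases "t = \<zero>")
    case False
    note it = nonzero_inv[OF t False]
    have "s \<noteq> \<zero>" using ss False \<beta>(1,2) t by (metis integral l_null s)
    moreover have "\<beta> = inv t \<otimes> (s \<otimes> s)"
    proof -
      have "inv t \<otimes> (s \<otimes> s) = (t \<otimes> inv t) \<otimes> \<beta>" unfolding ss using t it(1) \<beta>(1) by algebra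
      then show ?thesis using it(2) \<beta>(1) by simp
    qed
    moreover have "w t = t"
      unfolding t_def using w \<beta> n w\<beta> by (simp add: endo a_ac)
    then have "w (inv t) = inv t" using endo_inv[OF w t False] by simp
    \<comment> \<open>Both factors are rational expressions in \<open>n\<close>,
      \<open>\<beta>\<close> and \<open>w \<beta>\<close>, so any endomorphism fixing these three
      fixes the factors. This clause later places the factors in the right subfields.\<close>
    moreover have "f' (inv t) = inv t \<and> f' s = s"
      if "f' \<in> ring_hom R R" "f' n = n" "f' \<beta> = \<beta>" "f' (w \<beta>) = w \<beta>" for f'
    proof -
      have "f' t = t" "f' s = s" unfolding t_def s_def using that \<beta> n w\<beta> by (simp_all add: endo)
      then show ?thesis using endo_inv[OF that(1) t False] by simp
    qed
    ultimately show ?thesis using it s by blast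
  next
    case True
    then have "s = \<zero>" using ss s \<beta>(1) by (auto simp: integral_iff)
    \<comment> \<open>If the trace vanishes, \<open>\<beta>\<close> is itself fixed by
      \<open>w\<close>, and the trivial factorisation \<open>\<beta> = \<beta> 1^2\<close> will
      do.\<close>
    then have "\<beta> = \<ominus> n" unfolding s_def using \<beta>(1) n(1) by (metis minus_equality)
    then have "w \<beta> = \<beta>" using n w by (simp add: endo)
    moreover have "\<beta> = \<beta> \<otimes> (\<one> \<otimes> \<one>)" using \<beta>(1) by simp
    ultimately show ?thesis using \<beta>(1,2) one_closed one_not_zero ring_hom_one by metis
  qed
qed

text \<open>The parts of \<open>x\<close> in the two eigenspaces of the involution are
  \<open>(x + w x) / 2\<close> and \<open>(x - w x) / 2\<close>; dividing the second by the
  eigenvector \<open>y\<close> makes the coefficient fixed. The coefficients are rational in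
  \<open>x\<close>, \<open>w x\<close>, \<open>y\<close>, whence the final clause.\<close>

lemma eigen_decomposition:
  assumes two: "\<one> \<oplus> \<one> \<noteq> \<zero>" and w: "w \<in> ring_hom R R" and x: "x \<in> carrier R" "w (w x) = x"
    and y: "y \<in> carrier R" "y \<noteq> \<zero>" "w y = \<ominus> y"
  shows "\<exists>s\<in>carrier R. \<exists>t\<in>carrier R. x = s \<oplus> t \<otimes> y \<and> w s = s \<and> w t = t \<and>
    (\<forall>f\<in>ring_hom R R. f x = x \<and> f (w x) = w x \<and> f y = y \<longrightarrow> f s = s \<and> f t = t)"
proof -
  define hf where "hf = inv (\<one> \<oplus> \<one>)"
  have hf: "hf \<in> carrier R" "(\<one> \<oplus> \<one>) \<otimes> hf = \<one>"
    using nonzero_inv[OF _ two] by (auto simp: hf_def)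
  have f_hf: "f hf = hf" if "f \<in> ring_hom R R" for f
    unfolding hf_def using endo_inv[OF that _ two] that by (simp add: endo)
  note iy = nonzero_inv[OF y(1,2)]
  have wx: "w x \<in> carrier R" using w x by (simp add: endo)
  define s t where "s = hf \<otimes> (x \<oplus> w x)" and "t = hf \<otimes> (x \<ominus> w x) \<otimes> inv y"
  have st: "s \<in> carrier R" "t \<in> carrier R" using hf x wx iy by (simp_all add: s_def t_def)
  have "t \<otimes> y = hf \<otimes> (x \<ominus> w x) \<otimes> (y \<otimes> inv y)" unfolding t_def using hf(1) x(1) wx y(1) iy(1) by algebra
  then have ty: "t \<otimes> y = hf \<otimes> (x \<ominus> w x)" using iy(2) hf(1) x wx by simp
  have "s \<oplus> t \<otimes> y = ((\<one> \<oplus> \<one>) \<otimes> hf) \<otimes> x" unfolding ty s_def using hf(1) x(1) wx by algebra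
  then have "x = s \<oplus> t \<otimes> y" using hf(2) x(1) by simp
  moreover have "w s = s" unfolding s_def using w x wx hf f_hf[OF w] by (simp add: endo a_comm)
  moreover have "w t = t"
  proof -
    have "w (inv y) = inv (\<ominus> y)" using endo_inv[OF w y(1,2)] y(3) by simp
    also have "\<dots> = \<ominus> (inv y)"
      using comm_inv_char[of "\<ominus> y" "\<ominus> (inv y)"] y(1) iy by (simp add: l_minus r_minus)
    finally have "w t = hf \<otimes> (w x \<ominus> x) \<otimes> (\<ominus> (inv y))"
      unfolding t_def using w x wx hf(1) f_hf[OF w] iy by (simp add: endo)
    also have "\<dots> = t" unfolding t_def using hf(1) x(1) wx iy(1) by algebra
    finally show ?thesis .
  qed
  moreover have "f s = s \<and> f t = t" if "f \<in> ring_hom R R" "f x = x" "f (w x) = w x" "f y = y" for f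
    unfolding s_def t_def using that f_hf[OF that(1)] endo_inv[OF that(1) y(1,2)] x wx hf(1) iy
    by (simp add: endo)
  ultimately show ?thesis using st by blast
qed

end

text \<open>The relations shared by the dihedral and the quaternion group: \<open>z\<close> is a
  central involution, and modulo \<open>z\<close> the maps \<open>g\<close> and \<open>h\<close> are
  commuting involutions, while their commutator is \<open>z\<close>. The values of
  \<open>g^2\<close> and \<open>h^2\<close> are prescribed only on elements fixed by
  \<open>z\<close>, since they may be 1 or \<open>z\<close>.\<close>

locale klein_action = square_classes +
  fixes z g h :: "'a \<Rightarrow> 'a"
  assumes z_hom: "z \<in> ring_hom R R" and g_hom: "g \<in> ring_hom R R" and h_hom: "h \<in> ring_hom R R"
    and fix_k: "x \<in> k \<Longrightarrow> z x = x" "x \<in> k \<Longrightarrow> g x = x" "x \<in> k \<Longrightarrow> h x = x"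
    and zz: "x \<in> carrier R \<Longrightarrow> z (z x) = x"
    and gz: "x \<in> carrier R \<Longrightarrow> z (g x) = g (z x)"
    and hz: "x \<in> carrier R \<Longrightarrow> z (h x) = h (z x)"
    and gg: "x \<in> carrier R \<Longrightarrow> z x = x \<Longrightarrow> g (g x) = x"
    and hh: "x \<in> carrier R \<Longrightarrow> z x = x \<Longrightarrow> h (h x) = x"
    and gh: "x \<in> carrier R \<Longrightarrow> g (h x) = h (g (z x))"
    and fixed: "x \<in> carrier R \<Longrightarrow> z x = x \<Longrightarrow> g x = x \<Longrightarrow> h x = x \<Longrightarrow> x \<in> k"
    and z_nontrivial: "\<exists>x\<in>carrier R. z x \<noteq> x"
begin

lemma k_closed: "x \<in> k \<Longrightarrow> x \<in> carrier R"
  using subfieldE(3)[OF subfield_k] by blast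

lemma k_mult: "x \<in> k \<Longrightarrow> y \<in> k \<Longrightarrow> x \<otimes> y \<in> k"
  using subringE(6)[OF subfieldE(1)[OF subfield_k]] .

lemma k_minus: "x \<in> k \<Longrightarrow> \<ominus> x \<in> k"
  using subringE(5)[OF subfieldE(1)[OF subfield_k]] .

lemma k_one: "\<one> \<in> k"
  using subringE(3)[OF subfieldE(1)[OF subfield_k]] .

lemma k_inv: "x \<in> k \<Longrightarrow> x \<noteq> \<zero> \<Longrightarrow> inv x \<in> k"
  using subfield_m_inv(1)[OF subfield_k] by blast

lemmas homs = z_hom g_hom h_hom

lemma neg_self: "x \<in> carrier R \<Longrightarrow> \<ominus> x = x \<Longrightarrow> x = \<zero>"
  using neg_eq_self[OF two_nonzero] .

lemma swap: "klein_action R k e p a b m z h g"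
proof (unfold_locales)
  show "h (g x) = g (h (z x))" if "x \<in> carrier R" for x
    using gh[of "z x"] zz[OF that] that z_hom by (simp add: endo)
qed (use homs fix_k zz gz hz gg hh fixed z_nontrivial in \<open>blast+\<close>)

text \<open>Together with \<open>swap\<close> this realises every permutation of the three
  involutions \<open>g\<close>, \<open>h\<close>, \<open>gh\<close> of the quotient by
  \<open>z\<close>, so the generators can be matched to prescribed square roots.\<close>

lemma twist: "klein_action R k e p a b m z g (\<lambda>x. g (h x))"
proof (unfold_locales)
  show "(\<lambda>x. g (h x)) \<in> ring_hom R R"
    using homs by (auto intro!: ring_hom_memI simp: endo)
  show "g (h x) = x" if "x \<in> k" for x using fix_k that by simp
  show "z (g (h x)) = g (h (z x))" if "x \<in> carrier R" for x
    using that gz[of "h x"] hz[of x] homs by (simp add: endo)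
  show "g (h (g (h x))) = x" if "x \<in> carrier R" "z x = x" for x
  proof -
    have "g (h (g (h x))) = g (h (h (g x)))" using gh[of x] that by simp
    also have "\<dots> = g (g x)" using hh[of "g x"] gz[of x] that homs by (simp add: endo)
    finally show ?thesis using gg that by simp
  qed
  show "g (g (h x)) = g (h (g (z x)))" if "x \<in> carrier R" for x
    using gh[of x] that by simp
  show "x \<in> k" if "x \<in> carrier R" "z x = x" "g x = x" "g (h x) = x" for x
  proof -
    have "h x = g (g (h x))" using gg[of "h x"] hz[of x] that homs by (simp add: endo)
    then show ?thesis using fixed that by simp
  qed
qed (use homs fix_k zz gz gg z_nontrivial in \<open>blast+\<close>)

lemma z_eigenvector: "\<exists>c\<in>carrier R. c \<noteq> \<zero> \<and> z c = \<ominus> c"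
proof -
  obtain x where x: "x \<in> carrier R" "z x \<noteq> x" using z_nontrivial by blast
  have zx: "z x \<in> carrier R" using x z_hom by (simp add: endo)
  have "z (x \<ominus> z x) = \<ominus> (x \<ominus> z x)"
    using x zx zz[OF x(1)] z_hom by (simp add: endo minus_add minus_eq a_comm)
  moreover have "x \<ominus> z x \<noteq> \<zero>" using x zx by (metis r_right_minus_eq)
  ultimately show ?thesis using x zx by blast
qed

lemma z_eigenvector_sign:
  assumes f: "f \<in> ring_hom R R" and c: "c \<in> carrier R" and fcc: "f (c \<otimes> c) = c \<otimes> c"
  shows "f c = c \<or> f c = \<ominus> c"
proof -
  have "f c \<otimes> f c = c \<otimes> c" using fcc f c by (simp add: endo)
  then show ?thesis using f c by (simp add: square_eq_iff endo)
qed

text \<open>On an element negated by \<open>z\<close> the two compositions differ by the sign -1.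
  All later contradictions with noncommutativity end here.\<close>

lemma not_commuting:
  assumes c: "c \<in> carrier R" "c \<noteq> \<zero>" "z c = \<ominus> c"
  shows "g (h c) \<noteq> h (g c)"
proof
  assume *: "g (h c) = h (g c)"
  have "g (h c) = \<ominus> (h (g c))" using gh[OF c(1)] c homs by (simp add: endo)
  then have "\<ominus> (h (g c)) = h (g c)" using * by simp
  then have "h (g c) = \<zero>" using c homs by (intro neg_self) (simp_all add: endo)
  then show False using c homs by (simp add: endo endo_eq_zero)
qed

text \<open>Take \<open>c\<close> negated by \<open>z\<close>. Then \<open>c^2\<close> and
  \<open>h c * c\<close> are fixed by \<open>z\<close>; if \<open>g\<close> fixed them too, it would
  multiply \<open>c\<close> and \<open>h c\<close> by the same sign and so commute with
  \<open>h\<close> on \<open>c\<close>.\<close>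

lemma g_nontrivial: "\<exists>x\<in>carrier R. z x = x \<and> g x \<noteq> x"
proof (rule ccontr)
  assume "\<not> ?thesis"
  then have triv: "g x = x" if "x \<in> carrier R" "z x = x" for x using that by blast
  obtain c where c: "c \<in> carrier R" "c \<noteq> \<zero>" "z c = \<ominus> c" using z_eigenvector by blast
  have d: "h c \<in> carrier R" "z (h c) = \<ominus> h c" using c homs hz[OF c(1)] by (simp_all add: endo)
  have gc: "g c = c \<or> g c = \<ominus> c"
    using c homs by (intro z_eigenvector_sign triv) (simp_all add: endo l_minus r_minus)
  have "g (h c \<otimes> c) = h c \<otimes> c" using c d homs by (intro triv) (simp_all add: endo l_minus r_minus)
  then have eq: "g (h c) \<otimes> g c = h c \<otimes> c" using c d homs by (simp add: endo)
  have gd: "g (h c) \<in> carrier R" using d homs by (simp add: endo)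
  from gc have "g (h c) = h (g c)"
  proof
    assume "g c = c"
    then show ?thesis using eq gd d(1) c(1,2) m_rcancel[of c "g (h c)" "h c"] by simp
  next
    assume gc: "g c = \<ominus> c"
    then have "(\<ominus> g (h c)) \<otimes> c = h c \<otimes> c" using eq gd d(1) c(1) by (simp add: l_minus r_minus)
    then have "\<ominus> g (h c) = h c" using gd d(1) c(1,2) m_rcancel[of c "\<ominus> g (h c)" "h c"] by simp
    then have "\<ominus> h c = g (h c)" using gd by (metis minus_minus)
    then show ?thesis using gc c(1) homs by (simp add: endo)
  qed
  then show False using not_commuting[OF c] by simp
qed

text \<open>On elements fixed by \<open>z\<close> the maps \<open>g\<close> and \<open>h\<close>
  commute. An antisymmetrised element \<open>y = x - g x\<close> is negated by \<open>g\<close>, and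
  either \<open>y + h y\<close> is a nonzero joint eigenvector or \<open>h y = - y\<close>
  already.\<close>

lemma g_eigenvector:
  "\<exists>y\<in>carrier R. y \<noteq> \<zero> \<and> z y = y \<and> g y = \<ominus> y \<and> (h y = y \<or> h y = \<ominus> y)"
proof -
  obtain x where x: "x \<in> carrier R" "z x = x" "g x \<noteq> x" using g_nontrivial by blast
  have gx: "g x \<in> carrier R" "z (g x) = g x" using x homs gz[OF x(1)] by (simp_all add: endo)
  define y where "y = x \<ominus> g x"
  have y: "y \<in> carrier R" "z y = y" "g y = \<ominus> y" "y \<noteq> \<zero>"
    using x gx gg[OF x(1,2)] homs
    by (simp_all add: y_def endo minus_add minus_eq a_comm r_right_minus_eq[unfolded minus_eq])
  have hy: "h y \<in> carrier R" "z (h y) = h y" using y homs hz[OF y(1)] by (simp_all add: endo)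
  have ghy: "g (h y) = \<ominus> h y" using gh[OF y(1)] y homs by (simp add: endo)
  show ?thesis
  proof (cases "y \<oplus> h y = \<zero>")
    case True
    then have "h y = \<ominus> y" using y(1) hy(1) by (metis a_comm minus_equality)
    then show ?thesis using y by blast
  next
    case False
    have "h (y \<oplus> h y) = y \<oplus> h y" using hh[OF y(1,2)] y hy homs by (simp add: endo a_comm)
    moreover have "g (y \<oplus> h y) = \<ominus> (y \<oplus> h y)" using y hy ghy homs by (simp add: endo minus_add)
    moreover have "z (y \<oplus> h y) = y \<oplus> h y" using y hy homs by (simp add: endo)
    ultimately show ?thesis using False y hy by blast
  qed
qed

text \<open>A joint eigenvector carries a sign character of the Klein group, and products multiply
  characters. \<open>A\<close>, \<open>B\<close>, \<open>C\<close> are nontrivial on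
  \<open>g\<close>, \<open>h\<close>, \<open>gh\<close> respectively; should \<open>A\<close> and
  \<open>B\<close> both have signs (-,-), then \<open>C\<close> has a different character and
  separates \<open>g\<close> from \<open>h\<close>.\<close>

lemma eigenbasis:
  "\<exists>x\<in>carrier R. \<exists>y\<in>carrier R. x \<noteq> \<zero> \<and> y \<noteq> \<zero> \<and> z x = x \<and> z y = y \<and>
     g x = \<ominus> x \<and> h x = x \<and> g y = y \<and> h y = \<ominus> y"
proof -
  obtain A where A: "A \<in> carrier R" "A \<noteq> \<zero>" "z A = A" "g A = \<ominus> A" "h A = A \<or> h A = \<ominus> A"
    using g_eigenvector by blast
  obtain B where B: "B \<in> carrier R" "B \<noteq> \<zero>" "z B = B" "h B = \<ominus> B" "g B = B \<or> g B = \<ominus> B"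
    using klein_action.g_eigenvector[OF swap] by blast
  obtain C where C: "C \<in> carrier R" "C \<noteq> \<zero>" "z C = C" "g (h C) = \<ominus> C" "g C = C \<or> g C = \<ominus> C"
    using klein_action.g_eigenvector[OF klein_action.swap[OF twist]] by blast
  have hC: "h C \<in> carrier R" "g (g (h C)) = h C"
    using C homs gg[of "h C"] hz[of C] by (auto simp: endo)
  then have "h C = g (\<ominus> C)" using C(4) by simp
  then have C': "g C = C \<and> h C = \<ominus> C \<or> g C = \<ominus> C \<and> h C = C" using C homs by (auto simp: endo)
  have prod: "u \<otimes> u' \<in> carrier R \<and> u \<otimes> u' \<noteq> \<zero> \<and> z (u \<otimes> u') = u \<otimes> u'"
    if "u \<in> carrier R" "u' \<in> carrier R" "u \<noteq> \<zero>" "u' \<noteq> \<zero>" "z u = u" "z u' = u'" for u u'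
    using that homs by (simp add: endo integral_iff)
  have gp: "g (u \<otimes> u') = g u \<otimes> g u'" "h (u \<otimes> u') = h u \<otimes> h u'"
    if "u \<in> carrier R" "u' \<in> carrier R" for u u' using that homs by (simp_all add: endo)
  have m: "(\<ominus> u) \<otimes> (\<ominus> u') = u \<otimes> u'" "(\<ominus> u) \<otimes> u' = \<ominus> (u \<otimes> u')" "u \<otimes> (\<ominus> u') = \<ominus> (u \<otimes> u')"
    if "u \<in> carrier R" "u' \<in> carrier R" for u u' using that by (simp_all add: l_minus r_minus)
  consider "h A = A" "g B = B" | "h A = A" "g B = \<ominus> B" | "h A = \<ominus> A" "g B = B"
    | "h A = \<ominus> A" "g B = \<ominus> B" "g C = C" "h C = \<ominus> C" | "h A = \<ominus> A" "g B = \<ominus> B" "g C = \<ominus> C" "h C = C"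
    using A(5) B(5) C' by blast
  then show ?thesis
  proof cases
    case 1
    then show ?thesis using A B by blast
  next
    case 2
    then show ?thesis using A B prod[of A B] gp[of A B] m[of A B] by (intro bexI[of _ A] bexI[of _ "A \<otimes> B"]) auto
  next
    case 3
    then show ?thesis using A B prod[of A B] gp[of A B] m[of A B] by (intro bexI[of _ "A \<otimes> B"] bexI[of _ B]) auto
  next
    case 4
    then show ?thesis using A C prod[of A C] gp[of A C] m[of A C] by (intro bexI[of _ "A \<otimes> C"] bexI[of _ C]) auto
  next
    case 5
    then show ?thesis using A C prod[of A C] gp[of A C] m[of A C] by (intro bexI[of _ C] bexI[of _ "A \<otimes> C"]) auto
  qed
qed

text \<open>The square of a joint eigenvector is fixed by the whole group, so it lies in
  \<open>k\<close> and has a representative in its square class.\<close>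

lemma normalise:
  assumes x: "x \<in> carrier R" "x \<noteq> \<zero>" "z x = x" "g x = x \<or> g x = \<ominus> x" "h x = x \<or> h x = \<ominus> x"
  shows "\<exists>s\<in>k. s \<noteq> \<zero> \<and> (s \<otimes> x) \<otimes> (s \<otimes> x) \<in> {\<one>, e, p, e \<otimes> p}"
proof -
  have "x \<otimes> x \<in> k" using x homs by (intro fixed) (auto simp: endo l_minus r_minus)
  moreover have "x \<otimes> x \<noteq> \<zero>" using x by (simp add: integral_iff)
  ultimately obtain d s where d: "d \<in> {\<one>, e, p, e \<otimes> p}" "s \<in> k" "x \<otimes> x = d \<otimes> (s \<otimes> s)"
    using classes by blast
  have dc: "d \<in> carrier R" using d(1) params k_closed by auto
  have s: "s \<in> carrier R" "s \<noteq> \<zero>" using d x(1,2) dc k_closed by (auto simp: integral_iff)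
  note si = nonzero_inv[OF s]
  have "(inv s \<otimes> x) \<otimes> (inv s \<otimes> x) = inv s \<otimes> inv s \<otimes> (x \<otimes> x)" using x(1) si(1) by algebra
  also have "\<dots> = d \<otimes> ((s \<otimes> inv s) \<otimes> (s \<otimes> inv s))" unfolding d(3) using s(1) si(1) dc by algebra
  finally have "(inv s \<otimes> x) \<otimes> (inv s \<otimes> x) = d" using si dc by simp
  then show ?thesis using d(1) k_inv[OF d(2) s(2)] si(3) by blast
qed

text \<open>The normalised squares are two different elements among \<open>e\<close>,
  \<open>p\<close>, \<open>e p\<close>. In each of the six cases a missing root of \<open>e\<close>
  or \<open>p\<close> is the product of the two known roots divided by \<open>e\<close> or
  \<open>p\<close>, and \<open>swap\<close> and \<open>twist\<close> provide generators that negate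
  exactly one root each.\<close>

lemma square_roots:
  "\<exists>g' h' i r. klein_action R k e p a b m z g' h' \<and> i \<in> carrier R \<and> r \<in> carrier R \<and>
     i \<otimes> i = e \<and> r \<otimes> r = p \<and> z i = i \<and> z r = r \<and> g' i = \<ominus> i \<and> g' r = r \<and> h' i = i \<and> h' r = \<ominus> r"
proof -
  obtain x0 y0 where x0: "x0 \<in> carrier R" "x0 \<noteq> \<zero>" "z x0 = x0" "g x0 = \<ominus> x0" "h x0 = x0"
    and y0: "y0 \<in> carrier R" "y0 \<noteq> \<zero>" "z y0 = y0" "g y0 = y0" "h y0 = \<ominus> y0"
    using eigenbasis by blast
  obtain s where s: "s \<in> k" "s \<noteq> \<zero>" "(s \<otimes> x0) \<otimes> (s \<otimes> x0) \<in> {\<one>, e, p, e \<otimes> p}"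
    using normalise[of x0] x0 by blast
  obtain t where t: "t \<in> k" "t \<noteq> \<zero>" "(t \<otimes> y0) \<otimes> (t \<otimes> y0) \<in> {\<one>, e, p, e \<otimes> p}"
    using normalise[of y0] y0 by blast
  define x y where "x = s \<otimes> x0" and "y = t \<otimes> y0"
  have x: "x \<in> carrier R" "x \<noteq> \<zero>" "z x = x" "g x = \<ominus> x" "h x = x"
    using s x0 k_closed[OF s(1)] fix_k homs by (simp_all add: x_def endo integral_iff r_minus)
  have y: "y \<in> carrier R" "y \<noteq> \<zero>" "z y = y" "g y = y" "h y = \<ominus> y"
    using t y0 k_closed[OF t(1)] fix_k homs by (simp_all add: y_def endo integral_iff r_minus)
  have ep: "e \<in> carrier R" "p \<in> carrier R" "e \<noteq> \<zero>" "p \<noteq> \<zero>" using params k_closed by auto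
  have no: "\<not> (u \<in> k \<and> (g u = \<ominus> u \<or> h u = \<ominus> u) \<and> u \<noteq> \<zero>)" for u
    using fix_k[of u] neg_self[of u] k_closed[of u] by metis
  \<comment> \<open>The trivial class cannot occur: its square roots 1 and -1 lie in
    \<open>k\<close> and are not negated by \<open>g\<close> or \<open>h\<close>.\<close>
  have ne: "u \<otimes> u \<noteq> \<one>" if "u \<in> carrier R" "u \<noteq> \<zero>" "g u = \<ominus> u \<or> h u = \<ominus> u" for u
    using that square_eq_one_iff[of u] no[of u] k_one k_minus[OF k_one] by auto
  have xx: "x \<otimes> x \<in> {e, p, e \<otimes> p}" using s(3) ne[of x] x by (auto simp: x_def)
  have yy: "y \<otimes> y \<in> {e, p, e \<otimes> p}" using t(3) ne[of y] y by (auto simp: y_def)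
  have xy: "x \<otimes> x \<noteq> y \<otimes> y"
  proof
    assume "x \<otimes> x = y \<otimes> y"
    then have "x = y \<or> x = \<ominus> y" using x y by (simp add: square_eq_iff)
    then have "g x = x" using y homs by (auto simp: endo)
    then show False using x neg_self by auto
  qed
  define w where "w = x \<otimes> y"
  have w: "w \<in> carrier R" "w \<noteq> \<zero>" "z w = w" "g w = \<ominus> w" "h w = \<ominus> w"
    using x y homs by (simp_all add: w_def endo integral_iff l_minus r_minus)
  have ww: "w \<otimes> w = (x \<otimes> x) \<otimes> (y \<otimes> y)" unfolding w_def using x(1) y(1) by algebra
  note ie = nonzero_inv[OF ep(1,3)] and ip = nonzero_inv[OF ep(2,4)]
  have ie_fix: "z (inv e) = inv e" "g (inv e) = inv e" "h (inv e) = inv e"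
    using fix_k k_inv[OF params(1) ep(3)] by auto
  have ip_fix: "z (inv p) = inv p" "g (inv p) = inv p" "h (inv p) = inv p"
    using fix_k k_inv[OF params(2) ep(4)] by auto
  have we: "(inv e \<otimes> w) \<otimes> (inv e \<otimes> w) = p" if "w \<otimes> w = e \<otimes> (e \<otimes> p)"
  proof -
    have "(inv e \<otimes> w) \<otimes> (inv e \<otimes> w) = inv e \<otimes> inv e \<otimes> (w \<otimes> w)" using ie(1) w(1) by algebra
    also have "\<dots> = (e \<otimes> inv e) \<otimes> (e \<otimes> inv e) \<otimes> p" unfolding that using ie(1) ep(1,2) by algebra
    finally show ?thesis using ie ep by simp
  qed
  have wp: "(inv p \<otimes> w) \<otimes> (inv p \<otimes> w) = e" if "w \<otimes> w = p \<otimes> (e \<otimes> p)"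
  proof -
    have "(inv p \<otimes> w) \<otimes> (inv p \<otimes> w) = inv p \<otimes> inv p \<otimes> (w \<otimes> w)" using ip(1) w(1) by algebra
    also have "\<dots> = (p \<otimes> inv p) \<otimes> (p \<otimes> inv p) \<otimes> e" unfolding that using ip(1) ep(1,2) by algebra
    finally show ?thesis using ip ep by simp
  qed
  have iw: "inv e \<otimes> w \<in> carrier R" "z (inv e \<otimes> w) = inv e \<otimes> w"
    "g (inv e \<otimes> w) = \<ominus> (inv e \<otimes> w)" "h (inv e \<otimes> w) = \<ominus> (inv e \<otimes> w)"
    "inv p \<otimes> w \<in> carrier R" "z (inv p \<otimes> w) = inv p \<otimes> w"
    "g (inv p \<otimes> w) = \<ominus> (inv p \<otimes> w)" "h (inv p \<otimes> w) = \<ominus> (inv p \<otimes> w)"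
    using w ie ip ie_fix ip_fix homs by (simp_all add: endo r_minus)
  have gm: "g (\<ominus> u) = \<ominus> g u" "h (\<ominus> u) = \<ominus> h u" if "u \<in> carrier R" for u
    using that homs by (simp_all add: endo)
  note t1 = klein_action_axioms and t2 = swap and t3 = twist
    and t4 = klein_action.swap[OF twist] and t5 = klein_action.twist[OF swap]
    and t6 = klein_action.swap[OF klein_action.twist[OF swap]]
  have conclude: ?thesis
    if "klein_action R k e p a b m z g' h'" "i \<in> carrier R" "r \<in> carrier R" "i \<otimes> i = e" "r \<otimes> r = p"
      "z i = i" "z r = r" "g' i = \<ominus> i" "g' r = r" "h' i = i" "h' r = \<ominus> r" for g' h' i r
    using that by blast
  consider "x \<otimes> x = e" "y \<otimes> y = p" | "x \<otimes> x = p" "y \<otimes> y = e"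
    | "x \<otimes> x = e" "y \<otimes> y = e \<otimes> p" | "x \<otimes> x = e \<otimes> p" "y \<otimes> y = e"
    | "x \<otimes> x = p" "y \<otimes> y = e \<otimes> p" | "x \<otimes> x = e \<otimes> p" "y \<otimes> y = p"
    using xx yy xy by auto
  then show ?thesis
  proof cases
    case 1
    then show ?thesis using t1 x y by blast
  next
    case 2
    then show ?thesis using t2 x y by blast
  next
    case 3
    then have "(inv e \<otimes> w) \<otimes> (inv e \<otimes> w) = p" using ww ep by (intro we) simp
    then show ?thesis
      by (intro conclude[of "\<lambda>x. h (g x)" h x "inv e \<otimes> w"]) (use t6 x iw 3 gm w in simp_all)
  next
    case 4
    then have "(inv e \<otimes> w) \<otimes> (inv e \<otimes> w) = p" using ww ep by (intro we) (simp add: m_comm)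
    then show ?thesis
      by (intro conclude[of "\<lambda>x. g (h x)" g y "inv e \<otimes> w"]) (use t4 y iw 4 gm w in simp_all)
  next
    case 5
    then have "(inv p \<otimes> w) \<otimes> (inv p \<otimes> w) = e" using ww ep by (intro wp) simp
    then show ?thesis
      by (intro conclude[of h "\<lambda>x. h (g x)" "inv p \<otimes> w" x]) (use t5 x iw 5 gm w in simp_all)
  next
    case 6
    then have "(inv p \<otimes> w) \<otimes> (inv p \<otimes> w) = e" using ww ep by (intro wp) (simp add: m_comm)
    then show ?thesis
      by (intro conclude[of g "\<lambda>x. g (h x)" "inv p \<otimes> w" y]) (use t3 y iw 6 gm w in simp_all)
  qed
qed

end

section \<open>The quadratic step above the biquadratic field\<close>

locale biquadratic_action = klein_action +
  fixes i r :: 'a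
  assumes i_closed: "i \<in> carrier R" and r_closed: "r \<in> carrier R"
    and ii: "i \<otimes> i = e" and rr: "r \<otimes> r = p"
    and i_action: "z i = i" "g i = \<ominus> i" "h i = i"
    and r_action: "z r = r" "g r = r" "h r = \<ominus> r"
begin

definition \<zeta> :: 'a where "\<zeta> = a \<oplus> b \<otimes> i"

lemma i_nonzero: "i \<noteq> \<zero>" and r_nonzero: "r \<noteq> \<zero>"
  using ii rr params i_closed r_closed by auto

text \<open>Being fixed by \<open>z\<close> means lying in \<open>M\<close>, and being fixed by
  \<open>z\<close> and \<open>h\<close> means lying in \<open>K(\<surd>e)\<close>. This is the
  decomposition of \<open>M\<close> over \<open>K(\<surd>e)\<close> with basis \<open>1\<close>,
  \<open>r\<close>.\<close>

lemma z_fixed_decomposition: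
  assumes x: "x \<in> carrier R" "z x = x"
  shows "\<exists>s\<in>carrier R. \<exists>t\<in>carrier R. x = s \<oplus> t \<otimes> r \<and> z s = s \<and> h s = s \<and> z t = t \<and> h t = t"
  using eigen_decomposition[OF two_nonzero h_hom x(1) hh[OF x] r_closed r_nonzero r_action(3)]
    z_hom hz[OF x(1)] x(2) r_action(1) by metis

lemma zh_fixed_decomposition:
  assumes x: "x \<in> carrier R" "z x = x" "h x = x"
  shows "\<exists>s\<in>k. \<exists>t\<in>k. x = s \<oplus> t \<otimes> i"
proof -
  have "h (g x) = g x" using gh[OF x(1)] x by simp
  then obtain s t where st: "s \<in> carrier R" "t \<in> carrier R" "x = s \<oplus> t \<otimes> i" "g s = s" "g t = t"
    "z s = s" "z t = t" "h s = s" "h t = t"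
    using eigen_decomposition[OF two_nonzero g_hom x(1) gg[OF x(1,2)] i_closed i_nonzero i_action(2)]
      z_hom h_hom gz[OF x(1)] x(2,3) i_action(1,3) by metis
  then show ?thesis using fixed by blast
qed

lemma decomposition:
  assumes x: "x \<in> carrier R" and y: "y \<in> carrier R" "y \<noteq> \<zero>" "z y = \<ominus> y"
  shows "x \<in> pair_span (pair_span (pair_span k i) r) y"
proof -
  have F: "u \<in> pair_span k i" if "u \<in> carrier R" "z u = u" "h u = u" for u
    using zh_fixed_decomposition[OF that] by (auto simp: pair_span_def)
  have M: "u \<in> pair_span (pair_span k i) r" if "u \<in> carrier R" "z u = u" for u
    using z_fixed_decomposition[OF that] F unfolding pair_span_def[of "pair_span k i"] by blast
  obtain s t where st: "s \<in> carrier R" "t \<in> carrier R" "x = s \<oplus> t \<otimes> y" "z s = s" "z t = t"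
    using eigen_decomposition[OF two_nonzero z_hom x zz[OF x] y] by metis
  then show ?thesis using M[of s] M[of t] unfolding pair_span_def[of "pair_span (pair_span k i) r"] by blast
qed

lemma norm_form:
  assumes "x \<in> carrier R" "z x = x" "h x = x"
  shows "\<exists>s\<in>k. \<exists>t\<in>k. x \<otimes> g x = s \<otimes> s \<ominus> e \<otimes> (t \<otimes> t)"
proof -
  obtain s t where st: "s \<in> k" "t \<in> k" "x = s \<oplus> t \<otimes> i" using zh_fixed_decomposition[OF assms] by blast
  have c: "s \<in> carrier R" "t \<in> carrier R" using st k_closed by blast+
  have "g x = s \<ominus> t \<otimes> i"
    unfolding st(3) using c st fix_k(2) g_hom i_closed i_action by (simp add: endo minus_eq r_minus)
  then have "x \<otimes> g x = s \<otimes> s \<ominus> (i \<otimes> i) \<otimes> (t \<otimes> t)" using st(3) c i_closed by algebra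
  then show ?thesis using st ii by auto
qed

text \<open>Norms are closed under division by squares of \<open>k\<close>, so the class of
  \<open>p\<close> contains no norm once \<open>p\<close> itself is none.\<close>

lemma norm_not_p:
  assumes x: "x \<in> carrier R" "z x = x" "h x = x" and s: "s \<in> k" "s \<noteq> \<zero>"
  shows "x \<otimes> g x \<noteq> p \<otimes> (s \<otimes> s)"
proof
  assume *: "x \<otimes> g x = p \<otimes> (s \<otimes> s)"
  obtain u t where ut: "u \<in> k" "t \<in> k" "x \<otimes> g x = u \<otimes> u \<ominus> e \<otimes> (t \<otimes> t)" using norm_form[OF x] by blast
  have c: "u \<in> carrier R" "t \<in> carrier R" "s \<in> carrier R" "e \<in> carrier R" "p \<in> carrier R"
    using ut s params k_closed by blast+
  note si = nonzero_inv[OF c(3) s(2)]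
  have "(u \<otimes> inv s) \<otimes> (u \<otimes> inv s) \<ominus> e \<otimes> ((t \<otimes> inv s) \<otimes> (t \<otimes> inv s))
      = (u \<otimes> u \<ominus> e \<otimes> (t \<otimes> t)) \<otimes> (inv s \<otimes> inv s)"
    using c si(1) by algebra
  also have "\<dots> = p \<otimes> (s \<otimes> s) \<otimes> (inv s \<otimes> inv s)" using ut(3) * by simp
  also have "\<dots> = p \<otimes> ((s \<otimes> inv s) \<otimes> (s \<otimes> inv s))" using c si(1) by algebra
  also have "\<dots> = p" using si(2) c by simp
  finally show False using p_not_norm k_mult k_inv[OF s] ut(1,2) by blast
qed

lemma zeta:
  "\<zeta> \<in> carrier R" "z \<zeta> = \<zeta>" "h \<zeta> = \<zeta>" "\<zeta> \<otimes> g \<zeta> = e \<otimes> (m \<otimes> m)" "\<zeta> \<noteq> \<zero>"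
proof -
  have c: "a \<in> carrier R" "b \<in> carrier R" "m \<in> carrier R" "e \<in> carrier R" using params k_closed by blast+
  show z1: "\<zeta> \<in> carrier R" "z \<zeta> = \<zeta>" "h \<zeta> = \<zeta>"
    unfolding \<zeta>_def using c params fix_k homs i_closed i_action by (simp_all add: endo)
  have "g \<zeta> = a \<ominus> b \<otimes> i"
    unfolding \<zeta>_def using c params fix_k(2) g_hom i_closed i_action by (simp add: endo minus_eq r_minus)
  then have "\<zeta> \<otimes> g \<zeta> = a \<otimes> a \<ominus> (i \<otimes> i) \<otimes> (b \<otimes> b)" unfolding \<zeta>_def using c i_closed by algebra
  then show n: "\<zeta> \<otimes> g \<zeta> = e \<otimes> (m \<otimes> m)" using ii norm_class by simp
  have "e \<otimes> (m \<otimes> m) \<noteq> \<zero>" using c params by (simp add: integral_iff)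
  then show "\<zeta> \<noteq> \<zero>" using n z1(1) g_hom by (auto simp: endo)
qed

text \<open>The four class representatives have the square roots \<open>1\<close>, \<open>i\<close>,
  \<open>r\<close>, \<open>i r\<close> in \<open>M\<close>, so every element of \<open>k\<close>
  becomes a square there.\<close>

lemma z_fixed_square_root:
  assumes "x \<in> k" "x \<noteq> \<zero>"
  shows "\<exists>y\<in>carrier R. z y = y \<and> y \<otimes> y = x"
proof -
  obtain d s where d: "d \<in> {\<one>, e, p, e \<otimes> p}" "s \<in> k" "x = d \<otimes> (s \<otimes> s)" using classes[OF assms] by blast
  have s: "s \<in> carrier R" "z s = s" using d k_closed fix_k by blast+
  have "\<exists>u\<in>carrier R. z u = u \<and> u \<otimes> u = d"
  proof -
    have "(i \<otimes> r) \<otimes> (i \<otimes> r) = (i \<otimes> i) \<otimes> (r \<otimes> r)" using i_closed r_closed by algebra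
    then have "\<one> \<otimes> \<one> = \<one> \<and> i \<otimes> i = e \<and> r \<otimes> r = p \<and> (i \<otimes> r) \<otimes> (i \<otimes> r) = e \<otimes> p" using ii rr by simp
    moreover have "z \<one> = \<one> \<and> z i = i \<and> z r = r \<and> z (i \<otimes> r) = i \<otimes> r"
      using i_action r_action i_closed r_closed z_hom by (simp add: endo)
    ultimately show ?thesis using d(1) i_closed r_closed by (metis insertE empty_iff m_closed one_closed)
  qed
  then obtain u where u: "u \<in> carrier R" "z u = u" "u \<otimes> u = d" by blast
  have "(u \<otimes> s) \<otimes> (u \<otimes> s) = (u \<otimes> u) \<otimes> (s \<otimes> s)" using u(1) s(1) by algebra
  then have "(u \<otimes> s) \<otimes> (u \<otimes> s) = x" using u d(3) by simp
  moreover have "z (u \<otimes> s) = u \<otimes> s" using u s z_hom by (simp add: endo)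
  ultimately show ?thesis using u s by blast
qed

text \<open>The class of the norm of \<open>f\<close> decides. A square norm makes \<open>f\<close>
  an element of \<open>k\<close> times a square, hence a square in \<open>M\<close>. If the class is
  \<open>e\<close>, then \<open>f \<zeta>\<close> has square norm. The classes \<open>p\<close> and
  \<open>e p\<close> are impossible, since \<open>f\<close> or \<open>f \<zeta>\<close> would have
  its norm in the class of \<open>p\<close>.\<close>

lemma square_root_up_to_zeta:
  assumes f: "f \<in> carrier R" "f \<noteq> \<zero>" "z f = f" "h f = f"
  shows "\<exists>y\<in>carrier R. z y = y \<and> (y \<otimes> y = f \<or> y \<otimes> y = f \<otimes> \<zeta>)"
proof -
  have norm_square: "\<exists>y\<in>carrier R. z y = y \<and> y \<otimes> y = u"
    if u: "u \<in> carrier R" "u \<noteq> \<zero>" "z u = u" "h u = u" and n: "n \<in> k" "u \<otimes> g u = n \<otimes> n" for u n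
  proof -
    have nc: "n \<in> carrier R" "z n = n" "g n = n" "h n = n" using n k_closed fix_k by blast+
    have gu: "g u \<in> carrier R" "z (g u) = g u" "h (g u) = g u" "g (g u) = u"
      using u g_hom gz[OF u(1)] gh[OF u(1)] gg[OF u(1)] by (simp_all add: endo)
    obtain f' m' where fm: "f' \<in> carrier R" "m' \<in> carrier R" "f' \<noteq> \<zero>" "u = f' \<otimes> (m' \<otimes> m')" "g f' = f'"
      "z f' = f'" "h f' = f'" "z m' = m'"
      using square_norm[OF g_hom u(1,2) gu(4) nc(1,3) n(2)] z_hom h_hom nc u gu by metis
    have "f' \<in> k" using fixed fm by blast
    then obtain y where y: "y \<in> carrier R" "z y = y" "y \<otimes> y = f'" using z_fixed_square_root fm by blast
    have "(y \<otimes> m') \<otimes> (y \<otimes> m') = (y \<otimes> y) \<otimes> (m' \<otimes> m')" using y fm by algebra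
    then have "(y \<otimes> m') \<otimes> (y \<otimes> m') = u" using y fm(4) by simp
    moreover have "z (y \<otimes> m') = y \<otimes> m'" using y fm z_hom by (simp add: endo)
    ultimately show ?thesis using y fm by blast
  qed
  have gf: "g f \<in> carrier R" "z (g f) = g f" "h (g f) = g f" "g (g f) = f"
    using f g_hom gz[OF f(1)] gh[OF f(1)] gg[OF f(1)] by (simp_all add: endo)
  have "f \<otimes> g f \<in> k" using f gf homs by (intro fixed) (simp_all add: endo m_comm)
  moreover have "f \<otimes> g f \<noteq> \<zero>" using f g_hom by (simp add: endo integral_iff endo_eq_zero)
  ultimately obtain d s where d: "d \<in> {\<one>, e, p, e \<otimes> p}" "s \<in> k" "f \<otimes> g f = d \<otimes> (s \<otimes> s)"
    using classes by blast
  have c: "d \<in> carrier R" "s \<in> carrier R" "e \<in> carrier R" "p \<in> carrier R" "m \<in> carrier R"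
    using d params k_closed by auto
  have s0: "s \<noteq> \<zero>" using d(3) \<open>f \<otimes> g f \<noteq> \<zero>\<close> c by auto
  have fz: "f \<otimes> \<zeta> \<in> carrier R" "f \<otimes> \<zeta> \<noteq> \<zero>" "z (f \<otimes> \<zeta>) = f \<otimes> \<zeta>" "h (f \<otimes> \<zeta>) = f \<otimes> \<zeta>"
    using f zeta homs by (simp_all add: endo integral_iff)
  have "(f \<otimes> \<zeta>) \<otimes> g (f \<otimes> \<zeta>) = (f \<otimes> g f) \<otimes> (\<zeta> \<otimes> g \<zeta>)"
  proof -
    have "g \<zeta> \<in> carrier R" "g (f \<otimes> \<zeta>) = g f \<otimes> g \<zeta>" using f zeta(1) g_hom by (simp_all add: endo)
    then show ?thesis using f(1) gf(1) zeta(1) by (simp add: m_ac)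
  qed
  then have fzn: "(f \<otimes> \<zeta>) \<otimes> g (f \<otimes> \<zeta>) = d \<otimes> (s \<otimes> s) \<otimes> (e \<otimes> (m \<otimes> m))" using d(3) zeta(4) by simp
  have km: "e \<otimes> s \<otimes> m \<in> k" "e \<otimes> s \<otimes> m \<noteq> \<zero>"
    using params d(2) k_mult c s0 by (auto simp: integral_iff)
  consider "d = \<one>" | "d = e" | "d = p" | "d = e \<otimes> p" using d(1) by blast
  then show ?thesis
  proof cases
    case 1
    then show ?thesis using norm_square[OF f d(2)] d(3) c by auto
  next
    case 2
    have "(f \<otimes> \<zeta>) \<otimes> g (f \<otimes> \<zeta>) = (e \<otimes> s \<otimes> m) \<otimes> (e \<otimes> s \<otimes> m)"
      unfolding fzn 2 using c by algebra
    then show ?thesis using norm_square[OF fz km(1)] by blast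
  next
    case 3
    then show ?thesis using norm_not_p[OF f(1,3,4) d(2) s0] d(3) by simp
  next
    case 4
    have "(f \<otimes> \<zeta>) \<otimes> g (f \<otimes> \<zeta>) = p \<otimes> ((e \<otimes> s \<otimes> m) \<otimes> (e \<otimes> s \<otimes> m))"
      unfolding fzn 4 using c by algebra
    then show ?thesis using norm_not_p[OF fz(1,3,4) km] by simp
  qed
qed

lemma sqrt_neg_one: "\<exists>j\<in>carrier R. z j = j \<and> h j = j \<and> j \<otimes> j = \<ominus> \<one>"
  using neg_one ii i_closed i_action fix_k k_closed by metis

text \<open>Start from any \<open>c\<close> negated by \<open>z\<close>. First \<open>c\<close> is
  adjusted by a factor in \<open>M\<close> until its square is \<open>f\<close> or
  \<open>f r\<close> with \<open>f\<close> in \<open>K(\<surd>e)\<close>; then a square root of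
  \<open>f\<close> or \<open>f \<zeta>\<close> in \<open>M\<close> is divided out, which leaves only
  the classes \<open>1\<close>, \<open>\<zeta>\<close>, \<open>r\<close>,
  \<open>\<zeta> r\<close>.\<close>

lemma quadratic_generator:
  "\<exists>y\<in>carrier R. y \<noteq> \<zero> \<and> z y = \<ominus> y \<and> (y \<otimes> y = \<zeta> \<or> y \<otimes> y = r \<or> y \<otimes> y = \<zeta> \<otimes> r)"
proof -
  obtain c where c: "c \<in> carrier R" "c \<noteq> \<zero>" "z c = \<ominus> c" using z_eigenvector by blast
  define \<beta> where "\<beta> = c \<otimes> c"
  have \<beta>: "\<beta> \<in> carrier R" "\<beta> \<noteq> \<zero>" "z \<beta> = \<beta>"
    using c z_hom by (simp_all add: \<beta>_def endo integral_iff l_minus r_minus)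
  have h\<beta>: "h \<beta> \<in> carrier R" "z (h \<beta>) = h \<beta>" "h (h \<beta>) = \<beta>"
    using \<beta> h_hom hz[OF \<beta>(1)] hh[OF \<beta>(1)] by (simp_all add: endo)
  define n where "n = c \<otimes> h c"
  have hc: "h c \<in> carrier R" "z (h c) = \<ominus> h c" using c hz[OF c(1)] h_hom by (simp_all add: endo)
  have hhc: "h (h c) = c \<or> h (h c) = \<ominus> c"
  proof -
    have "h (h c) \<otimes> h (h c) = c \<otimes> c" using h\<beta>(3) c hc h_hom by (simp add: \<beta>_def endo)
    then show ?thesis using c hc h_hom by (simp add: square_eq_iff endo)
  qed
  have n: "n \<in> carrier R" "z n = n" "h n = n \<or> h n = \<ominus> n" "\<beta> \<otimes> h \<beta> = n \<otimes> n"
  proof -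
    show "n \<in> carrier R" "z n = n" using c hc z_hom by (simp_all add: n_def endo l_minus r_minus)
    show "h n = n \<or> h n = \<ominus> n"
      using hhc c hc h_hom by (auto simp: n_def endo r_minus m_comm)
    have "\<beta> \<otimes> h \<beta> = (c \<otimes> c) \<otimes> (h c \<otimes> h c)" using c h_hom by (simp add: \<beta>_def endo)
    then show "\<beta> \<otimes> h \<beta> = n \<otimes> n" unfolding n_def using c(1) hc(1) by algebra
  qed
  have step: "\<exists>f\<in>carrier R. \<exists>m\<in>carrier R. f \<noteq> \<zero> \<and> m \<noteq> \<zero> \<and> u = f \<otimes> (m \<otimes> m) \<and> z f = f \<and> h f = f \<and> z m = m"
    if "u \<in> carrier R" "u \<noteq> \<zero>" "z u = u" "h (h u) = u" "n' \<in> carrier R" "h n' = n'" "u \<otimes> h u = n' \<otimes> n'" "z n' = n'"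
    for u n'
    using square_norm[OF h_hom that(1,2,4,5,6,7)] z_hom that hz[OF that(1)] by metis
  have "\<exists>f\<in>carrier R. \<exists>y\<in>carrier R. f \<noteq> \<zero> \<and> y \<noteq> \<zero> \<and> z f = f \<and> h f = f \<and> z y = \<ominus> y \<and> (y \<otimes> y = f \<or> y \<otimes> y = f \<otimes> r)"
    using n(3)
  proof
    assume "h n = n"
    then obtain f m' where fm: "f \<in> carrier R" "m' \<in> carrier R" "f \<noteq> \<zero>" "m' \<noteq> \<zero>" "\<beta> = f \<otimes> (m' \<otimes> m')"
      "z f = f" "h f = f" "z m' = m'"
      using step[OF \<beta> h\<beta>(3) n(1) _ n(4,2)] by blast
    note im = nonzero_inv[OF fm(2,4)]
    have "(c \<otimes> inv m') \<otimes> (c \<otimes> inv m') = \<beta> \<otimes> (inv m' \<otimes> inv m')" unfolding \<beta>_def using c(1) im(1) by algebra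
    also have "\<dots> = f \<otimes> ((m' \<otimes> inv m') \<otimes> (m' \<otimes> inv m'))" unfolding fm(5) using fm im(1) by algebra
    finally have "(c \<otimes> inv m') \<otimes> (c \<otimes> inv m') = f" using im(2) fm(1) by simp
    moreover have "z (c \<otimes> inv m') = \<ominus> (c \<otimes> inv m')"
      using c im endo_inv[OF z_hom fm(2,4)] fm(8) z_hom by (simp add: endo l_minus)
    moreover have "c \<otimes> inv m' \<noteq> \<zero>" using c im by (simp add: integral_iff)
    ultimately show ?thesis using fm c(1) im(1) by blast
  next
    \<comment> \<open>The norm of \<open>\<beta>\<close> to \<open>K(\<surd>e)\<close> is a square,
      but its root \<open>n\<close> lies outside that field. Passing to \<open>\<beta> r\<close>
      repairs this: its norm has the root \<open>j n r\<close>, in which the signs of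
      \<open>n\<close> and \<open>r\<close> under \<open>h\<close> cancel.\<close>
    assume hn: "h n = \<ominus> n"
    obtain j where j: "j \<in> carrier R" "z j = j" "h j = j" "j \<otimes> j = \<ominus> \<one>" using sqrt_neg_one by blast
    let ?u = "\<beta> \<otimes> r" and ?n = "j \<otimes> n \<otimes> r"
    have hu: "h ?u = \<ominus> (h \<beta> \<otimes> r)" using \<beta> r_closed r_action h_hom by (simp add: endo r_minus)
    have u: "?u \<in> carrier R" "?u \<noteq> \<zero>" "z ?u = ?u" "h (h ?u) = ?u"
      using \<beta> h\<beta> r_closed r_nonzero r_action homs hu by (simp_all add: endo integral_iff r_minus)
    have n': "?n \<in> carrier R" "h ?n = ?n" "z ?n = ?n"
      using j n hn r_closed r_action homs by (simp_all add: endo r_minus l_minus)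
    have "?n \<otimes> ?n = (j \<otimes> j) \<otimes> (n \<otimes> n) \<otimes> (r \<otimes> r)" using j(1) n(1) r_closed by algebra
    also have "\<dots> = \<ominus> \<one> \<otimes> (\<beta> \<otimes> h \<beta>) \<otimes> (r \<otimes> r)" using j(4) n(4) by simp
    also have "\<dots> = ?u \<otimes> h ?u" unfolding hu using \<beta>(1) h\<beta>(1) r_closed by algebra
    finally have "?u \<otimes> h ?u = ?n \<otimes> ?n" by simp
    then obtain f m' where fm: "f \<in> carrier R" "m' \<in> carrier R" "f \<noteq> \<zero>" "m' \<noteq> \<zero>" "?u = f \<otimes> (m' \<otimes> m')"
      "z f = f" "h f = f" "z m' = m'"
      using step[OF u n'(1,2) _ n'(3)] by blast
    note im = nonzero_inv[OF fm(2,4)]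
    let ?y = "c \<otimes> r \<otimes> inv m'"
    have "?y \<otimes> ?y = ?u \<otimes> r \<otimes> (inv m' \<otimes> inv m')" unfolding \<beta>_def using c(1) im(1) r_closed by algebra
    also have "\<dots> = f \<otimes> r \<otimes> ((m' \<otimes> inv m') \<otimes> (m' \<otimes> inv m'))"
      unfolding fm(5) using fm im(1) r_closed by algebra
    finally have "?y \<otimes> ?y = f \<otimes> r" using im(2) fm(1) r_closed by simp
    moreover have "z ?y = \<ominus> ?y"
      using c im endo_inv[OF z_hom fm(2,4)] fm(8) z_hom r_closed r_action by (simp add: endo l_minus)
    moreover have "?y \<noteq> \<zero>" using c im r_closed r_nonzero by (simp add: integral_iff)
    ultimately show ?thesis using fm c(1) im(1) r_closed by blast
  qed
  then obtain f y where fy: "f \<in> carrier R" "y \<in> carrier R" "f \<noteq> \<zero>" "y \<noteq> \<zero>" "z f = f" "h f = f" "z y = \<ominus> y"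
    "y \<otimes> y = f \<or> y \<otimes> y = f \<otimes> r" by blast
  obtain w where w: "w \<in> carrier R" "z w = w" "w \<otimes> w = f \<or> w \<otimes> w = f \<otimes> \<zeta>"
    using square_root_up_to_zeta fy by blast
  have w0: "w \<noteq> \<zero>" using w(3) fy(1,3) zeta(1,5) by (metis integral l_null zero_closed)
  note iw = nonzero_inv[OF w(1) w0]
  have ziw: "z (inv w) = inv w" using endo_inv[OF z_hom w(1) w0] w(2) by simp
  define u where "u = y \<otimes> inv w"
  have u: "u \<in> carrier R" "u \<noteq> \<zero>" "z u = \<ominus> u" "y = u \<otimes> w"
  proof -
    show "u \<in> carrier R" "u \<noteq> \<zero>" "z u = \<ominus> u"
      unfolding u_def using fy iw ziw z_hom by (simp_all add: endo integral_iff l_minus)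
    have "u \<otimes> w = y \<otimes> (w \<otimes> inv w)" unfolding u_def using fy(2) iw(1) w(1) by algebra
    then show "y = u \<otimes> w" using iw(2) fy(2) by simp
  qed
  have yy: "y \<otimes> y = (u \<otimes> u) \<otimes> (w \<otimes> w)" unfolding u(4) using u(1) w(1) by algebra
  \<comment> \<open>The class of 1 is excluded: a root of 1 is fixed by \<open>z\<close> and not
    negated.\<close>
  have not_one: "v \<otimes> v \<noteq> \<one>" if "v \<in> carrier R" "v \<noteq> \<zero>" "z v = \<ominus> v" for v
  proof
    assume "v \<otimes> v = \<one>"
    then have "z v = v" using square_eq_one_iff[of v] that z_hom by (auto simp: endo)
    then show False using that neg_self by auto
  qed
  have cancel: "v = v'" if "v \<in> carrier R" "v' \<in> carrier R" "v \<otimes> f = v' \<otimes> f" for v v'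
    using m_rcancel[of f v v'] that fy by blast
  \<comment> \<open>When \<open>w^2 = f \<zeta>\<close>, the square of \<open>u\<close> is
    \<open>1 / \<zeta>\<close> or \<open>r / \<zeta>\<close>; multiplying \<open>u\<close> by
    \<open>\<zeta>\<close> brings it to the listed form.\<close>
  let ?x = "u \<otimes> \<zeta>"
  have x: "?x \<in> carrier R" "?x \<noteq> \<zero>" "z ?x = \<ominus> ?x"
    using u zeta z_hom by (simp_all add: endo integral_iff l_minus)
  have xx: "?x \<otimes> ?x = (u \<otimes> u \<otimes> \<zeta>) \<otimes> \<zeta>" using u(1) zeta(1) by algebra
  consider "y \<otimes> y = f" "w \<otimes> w = f" | "y \<otimes> y = f \<otimes> r" "w \<otimes> w = f"
    | "y \<otimes> y = f" "w \<otimes> w = f \<otimes> \<zeta>" | "y \<otimes> y = f \<otimes> r" "w \<otimes> w = f \<otimes> \<zeta>"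
    using fy(8) w(3) by blast
  then show ?thesis
  proof cases
    case 1
    have "(u \<otimes> u) \<otimes> f = y \<otimes> y" unfolding yy 1(2) ..
    also have "\<dots> = \<one> \<otimes> f" unfolding 1(1) using fy(1) by simp
    finally have "u \<otimes> u = \<one>" by (rule cancel[rotated 2]) (use u(1) in simp_all)
    then show ?thesis using not_one u by blast
  next
    case 2
    have "(u \<otimes> u) \<otimes> f = y \<otimes> y" unfolding yy 2(2) ..
    also have "\<dots> = r \<otimes> f" unfolding 2(1) using fy(1) r_closed by (rule m_comm)
    finally have "u \<otimes> u = r" by (rule cancel[rotated 2]) (use u(1) r_closed in simp_all)
    then show ?thesis using u by blast
  next
    case 3
    have "(u \<otimes> u \<otimes> \<zeta>) \<otimes> f = (u \<otimes> u) \<otimes> (f \<otimes> \<zeta>)" using u(1) fy(1) zeta(1) by algebra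
    also have "\<dots> = y \<otimes> y" unfolding yy 3(2) ..
    also have "\<dots> = \<one> \<otimes> f" unfolding 3(1) using fy(1) by simp
    finally have "u \<otimes> u \<otimes> \<zeta> = \<one>" by (rule cancel[rotated 2]) (use u(1) zeta(1) in simp_all)
    then have "?x \<otimes> ?x = \<zeta>" using xx zeta(1) by simp
    then show ?thesis using x by blast
  next
    case 4
    have "(u \<otimes> u \<otimes> \<zeta>) \<otimes> f = (u \<otimes> u) \<otimes> (f \<otimes> \<zeta>)" using u(1) fy(1) zeta(1) by algebra
    also have "\<dots> = y \<otimes> y" unfolding yy 4(2) ..
    also have "\<dots> = r \<otimes> f" unfolding 4(1) using fy(1) r_closed by (rule m_comm)
    finally have "u \<otimes> u \<otimes> \<zeta> = r" by (rule cancel[rotated 2]) (use u(1) zeta(1) r_closed in simp_all)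
    then have "?x \<otimes> ?x = \<zeta> \<otimes> r" using xx zeta(1) r_closed by (simp add: m_comm)
    then show ?thesis using x by blast
  qed
qed

text \<open>Here \<open>\<zeta> = i\<close>, so \<open>g\<close> and \<open>h\<close> change
  \<open>y^2\<close> at most by a sign. As -1 is the square of \<open>j\<close> in \<open>k\<close>,
  both multiply \<open>y\<close> by one of \<open>1\<close>, \<open>-1\<close>, \<open>j\<close>,
  \<open>-j\<close>; these scalars are fixed by \<open>g\<close> and \<open>h\<close>, so the two
  maps commute on \<open>y\<close>.\<close>

lemma sqrt_neg_one_imp_False:
  assumes j: "j \<in> k" "j \<otimes> j = \<ominus> \<one>" and ab: "a = \<zero>" "b = \<one>"
  shows False
proof -
  have z_i: "\<zeta> = i" unfolding \<zeta>_def unfolding ab using i_closed by simp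
  obtain y where y: "y \<in> carrier R" "y \<noteq> \<zero>" "z y = \<ominus> y" "y \<otimes> y = i \<or> y \<otimes> y = r \<or> y \<otimes> y = i \<otimes> r"
    using quadratic_generator z_i by auto
  have jc: "j \<in> carrier R" using j k_closed by blast
  have mult: "\<exists>c\<in>k. f y = c \<otimes> y" if f: "f \<in> ring_hom R R" "f (y \<otimes> y) = y \<otimes> y \<or> f (y \<otimes> y) = \<ominus> (y \<otimes> y)" for f
  proof -
    have "f y \<otimes> f y = y \<otimes> y \<or> f y \<otimes> f y = \<ominus> (y \<otimes> y)" using f y(1) by (simp add: endo)
    moreover have "(j \<otimes> y) \<otimes> (j \<otimes> y) = (j \<otimes> j) \<otimes> (y \<otimes> y)" using jc y(1) by algebra
    then have "(j \<otimes> y) \<otimes> (j \<otimes> y) = \<ominus> (y \<otimes> y)" using j(2) y(1) by (simp add: l_minus)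
    ultimately have "f y = y \<or> f y = \<ominus> y \<or> f y = j \<otimes> y \<or> f y = \<ominus> (j \<otimes> y)"
      using square_eq_iff[of "f y" y] square_eq_iff[of "f y" "j \<otimes> y"] y(1) jc endo_closed[OF f(1) y(1)]
      by (metis m_closed)
    moreover have "y = \<one> \<otimes> y" "\<ominus> y = \<ominus> \<one> \<otimes> y" "\<ominus> (j \<otimes> y) = \<ominus> j \<otimes> y" using y(1) jc by (simp_all add: l_minus)
    ultimately show ?thesis using j(1) k_one k_minus by metis
  qed
  have "g (y \<otimes> y) = y \<otimes> y \<or> g (y \<otimes> y) = \<ominus> (y \<otimes> y)" "h (y \<otimes> y) = y \<otimes> y \<or> h (y \<otimes> y) = \<ominus> (y \<otimes> y)"
    using y(4) i_action r_action i_closed r_closed homs by (auto simp: endo l_minus r_minus)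
  then obtain c d where cd: "c \<in> k" "g y = c \<otimes> y" "d \<in> k" "h y = d \<otimes> y" using mult homs by metis
  have "g (h y) = d \<otimes> (c \<otimes> y)" "h (g y) = c \<otimes> (d \<otimes> y)"
    using cd k_closed fix_k y(1) homs by (simp_all add: endo)
  then have "g (h y) = h (g y)" using cd(1,3) k_closed y(1) by (simp add: m_lcomm)
  then show False using not_commuting[OF y(1-3)] by blast
qed

text \<open>The case \<open>y^2 = \<zeta>\<close> is abelian: \<open>(g y * y)^2\<close> is the norm
  -1 of \<open>\<zeta>\<close>, so \<open>g y * y\<close> is \<open>i\<close> or \<open>-i\<close>
  and is fixed by \<open>h\<close>. Since \<open>h y\<close> is \<open>y\<close> or
  \<open>-y\<close>, the same sign occurs at \<open>g y\<close>, and \<open>g\<close>,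
  \<open>h\<close> commute on \<open>y\<close>.\<close>

lemma quadratic_generator_neg_one:
  assumes e: "e = \<ominus> \<one>" and m: "m = \<one>"
  shows "\<exists>y\<in>carrier R. y \<noteq> \<zero> \<and> z y = \<ominus> y \<and> (y \<otimes> y = r \<or> y \<otimes> y = \<zeta> \<otimes> r)"
proof -
  obtain y where y: "y \<in> carrier R" "y \<noteq> \<zero>" "z y = \<ominus> y" "y \<otimes> y = \<zeta> \<or> y \<otimes> y = r \<or> y \<otimes> y = \<zeta> \<otimes> r"
    using quadratic_generator by blast
  have "y \<otimes> y \<noteq> \<zeta>"
  proof
    assume yy: "y \<otimes> y = \<zeta>"
    have gy: "g y \<in> carrier R" and hy: "h y \<in> carrier R" using y homs by (simp_all add: endo)
    have "(g y \<otimes> y) \<otimes> (g y \<otimes> y) = (y \<otimes> y) \<otimes> (g y \<otimes> g y)" using gy y(1) by algebra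
    also have "g y \<otimes> g y = g \<zeta>" using yy y(1) g_hom by (simp add: endo flip: yy)
    finally have "(g y \<otimes> y) \<otimes> (g y \<otimes> y) = i \<otimes> i" using yy zeta(4) e m ii by simp
    then have "g y \<otimes> y = i \<or> g y \<otimes> y = \<ominus> i" using square_eq_iff[of "g y \<otimes> y" i] gy y(1) i_closed by simp
    then have "h (g y \<otimes> y) = g y \<otimes> y" using i_action i_closed h_hom by (auto simp: endo)
    then have eq: "h (g y) \<otimes> h y = g y \<otimes> y" using gy y(1) h_hom by (simp add: endo)
    have hgy: "h (g y) \<in> carrier R" using gy h_hom by (simp add: endo)
    have "h (y \<otimes> y) = y \<otimes> y" using yy zeta(3) by simp
    then have "h y = y \<or> h y = \<ominus> y" using z_eigenvector_sign[OF h_hom y(1)] by blast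
    then have "g (h y) = h (g y)"
    proof
      assume "h y = y"
      then show ?thesis using eq m_rcancel[of y "h (g y)" "g y"] y hgy gy by simp
    next
      assume hy': "h y = \<ominus> y"
      then have "(\<ominus> h (g y)) \<otimes> y = g y \<otimes> y" using eq hgy y(1) by (simp add: l_minus r_minus)
      then have "\<ominus> h (g y) = g y" using m_rcancel[of y "\<ominus> h (g y)" "g y"] y hgy gy by simp
      then have "\<ominus> g y = h (g y)" using hgy by (metis minus_minus)
      then show ?thesis using hy' y(1) g_hom by (simp add: endo)
    qed
    then show False using not_commuting[OF y(1-3)] by blast
  qed
  then show ?thesis using y by blast
qed

end

section \<open>Groups of order eight and quadratic extensions\<close>

text \<open>
  The group of words \<open>\<rho>\<^sup>a \<sigma>\<^sup>s\<close> with \<open>\<rho>\<^sup>4 = 1\<close>, \<open>\<sigma> \<rho> = \<rho>\<^sup>-\<^sup>1 \<sigma>\<close>, and \<open>\<sigma>\<^sup>2 = \<rho>\<^sup>2\<close> or \<open>\<sigma>\<^sup>2 = 1\<close> according to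
  whether \<open>tw\<close> holds or not: the quaternion group in the first case, the dihedral group in the second.
\<close>

definition metacyclic8 :: "bool \<Rightarrow> (int \<times> bool) monoid" where
  "metacyclic8 tw =
     \<lparr>carrier = {0..<4} \<times> UNIV,
      monoid.mult = (\<lambda>(a, s) (b, t).
        (((if s then a - b else a + b) + (if tw \<and> s \<and> t then 2 else 0)) mod 4, s \<noteq> t)),
      one = (0, False)\<rparr>"

lemma carrier_metacyclic8: "carrier (metacyclic8 tw) = {0..<4} \<times> UNIV"
  by (simp add: metacyclic8_def)

lemma mult_metacyclic8:
  "(a, s) \<otimes>\<^bsub>metacyclic8 tw\<^esub> (b, t) =
     (((if s then a - b else a + b) + (if tw \<and> s \<and> t then 2 else 0)) mod 4, s \<noteq> t)"
  by (simp add: metacyclic8_def)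

lemma metacyclic8_False: "metacyclic8 False = dihedral8"
  by (simp add: metacyclic8_def dihedral8_def)

text \<open>The value of the word at \<open>\<rho> = i\<close>, \<open>\<sigma> = j\<close>, that is
  \<open>i^a j^s\<close>.\<close>

definition quaternion_word :: "int \<times> bool \<Rightarrow> int \<times> int \<times> int \<times> int" where
  "quaternion_word = (\<lambda>(a, s).
     if s then (if a = 0 then (0, 0, 1, 0) else if a = 1 then (0, 0, 0, 1)
                else if a = 2 then (0, 0, -1, 0) else (0, 0, 0, -1))
     else (if a = 0 then (1, 0, 0, 0) else if a = 1 then (0, 1, 0, 0)
           else if a = 2 then (-1, 0, 0, 0) else (0, -1, 0, 0)))"

lemma atLeastLessThan_0_4: "{0..<4::int} = {0, 1, 2, 3}"
  by auto

lemma quaternion_word_iso: "quaternion_word \<in> iso (metacyclic8 True) quaternion8"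
proof -
  have "quaternion_word \<in> hom (metacyclic8 True) quaternion8"
  proof (rule homI)
    have "\<forall>a\<in>{0, 1, 2, 3}. \<forall>s. \<forall>b\<in>{0, 1, 2, 3}. \<forall>t. quaternion_word ((a, s) \<otimes>\<^bsub>metacyclic8 True\<^esub> (b, t))
        = quaternion_word (a, s) \<otimes>\<^bsub>quaternion8\<^esub> quaternion_word (b, t)"
      by (simp add: mult_metacyclic8 quaternion_word_def quaternion8_def all_bool_eq)
    then show "quaternion_word (x \<otimes>\<^bsub>metacyclic8 True\<^esub> y) = quaternion_word x \<otimes>\<^bsub>quaternion8\<^esub> quaternion_word y"
      if "x \<in> carrier (metacyclic8 True)" "y \<in> carrier (metacyclic8 True)" for x y
      using that unfolding carrier_metacyclic8 atLeastLessThan_0_4 by fast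
    have "\<forall>a\<in>{0, 1, 2, 3}. \<forall>s. quaternion_word (a, s) \<in> carrier quaternion8"
      by (simp add: quaternion_word_def quaternion8_def all_bool_eq)
    then show "quaternion_word x \<in> carrier quaternion8" if "x \<in> carrier (metacyclic8 True)" for x
      using that unfolding carrier_metacyclic8 atLeastLessThan_0_4 by fast
  qed
  moreover have "bij_betw quaternion_word (carrier (metacyclic8 True)) (carrier quaternion8)"
    unfolding bij_betw_def
  proof
    show "inj_on quaternion_word (carrier (metacyclic8 True))"
      by (auto simp: inj_on_def carrier_metacyclic8 atLeastLessThan_0_4 quaternion_word_def)
    show "quaternion_word ` carrier (metacyclic8 True) = carrier quaternion8"
    proof -
      have "carrier (metacyclic8 True) = {(0, False), (2, False), (1, False), (3, False),
          (0, True), (2, True), (1, True), (3, True)}"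
        by (auto simp: carrier_metacyclic8 atLeastLessThan_0_4)
      then show ?thesis by (simp add: quaternion_word_def quaternion8_def)
    qed
  qed
  ultimately show ?thesis by (simp add: iso_def)
qed

text \<open>Inverts isomorphisms out of \<open>galois_group\<close> and \<open>metacyclic8\<close>,
  for which closure of the multiplication is established below.\<close>

lemma iso_inv_into:
  assumes f: "f \<in> iso G H" and closed: "\<And>x y. x \<in> carrier G \<Longrightarrow> y \<in> carrier G \<Longrightarrow> x \<otimes>\<^bsub>G\<^esub> y \<in> carrier G"
  shows "inv_into (carrier G) f \<in> iso H G"
proof -
  let ?g = "inv_into (carrier G) f"
  have bij: "bij_betw f (carrier G) (carrier H)" using f by (simp add: iso_def)
  have g: "?g x \<in> carrier G" "f (?g x) = x" if "x \<in> carrier H" for x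
    using bij that by (auto simp: bij_betw_def inv_into_into f_inv_into_f)
  have "?g (x \<otimes>\<^bsub>H\<^esub> y) = ?g x \<otimes>\<^bsub>G\<^esub> ?g y" if "x \<in> carrier H" "y \<in> carrier H" for x y
  proof (rule inv_into_f_eq)
    show "inj_on f (carrier G)" using bij by (simp add: bij_betw_def)
    show "?g x \<otimes>\<^bsub>G\<^esub> ?g y \<in> carrier G" using closed g that by simp
    show "f (?g x \<otimes>\<^bsub>G\<^esub> ?g y) = x \<otimes>\<^bsub>H\<^esub> y" using f g that by (simp add: iso_def hom_def)
  qed
  then show ?thesis using g bij_betw_inv_into[OF bij] by (simp add: iso_def hom_def)
qed

lemma metacyclic8_mult_closed:
  "x \<in> carrier (metacyclic8 tw) \<Longrightarrow> y \<in> carrier (metacyclic8 tw) \<Longrightarrow> x \<otimes>\<^bsub>metacyclic8 tw\<^esub> y \<in> carrier (metacyclic8 tw)"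
  by (cases x; cases y) (simp add: mult_metacyclic8 carrier_metacyclic8)

lemma iso_quaternion8_iff: "G \<cong> quaternion8 \<longleftrightarrow> G \<cong> metacyclic8 True"
proof -
  have "metacyclic8 True \<cong> quaternion8" "quaternion8 \<cong> metacyclic8 True"
    using quaternion_word_iso iso_inv_into[OF quaternion_word_iso metacyclic8_mult_closed]
    unfolding is_iso_def by blast+
  then show ?thesis
    using iso_trans[of G quaternion8 "metacyclic8 True"] iso_trans[of G "metacyclic8 True" quaternion8] by blast
qed

text \<open>The quaternion group has a single involution, \<open>(2, False)\<close>, whereas in the
  dihedral group both \<open>(2, False)\<close> and \<open>(0, True)\<close> are
  involutions.\<close>

lemma metacyclic8_not_iso: "\<not> metacyclic8 False \<cong> metacyclic8 True"
proof
  assume "metacyclic8 False \<cong> metacyclic8 True"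
  then obtain f where f: "f \<in> hom (metacyclic8 False) (metacyclic8 True)"
    "bij_betw f (carrier (metacyclic8 False)) (carrier (metacyclic8 True))"
    unfolding is_iso_def iso_def by blast
  have inj: "f x = f y \<longleftrightarrow> x = y" if "x \<in> carrier (metacyclic8 False)" "y \<in> carrier (metacyclic8 False)" for x y
    using f(2) that by (auto simp: bij_betw_def inj_on_def)
  have cl: "f x \<in> carrier (metacyclic8 True)" if "x \<in> carrier (metacyclic8 False)" for x
    using f(1) that by (auto simp: hom_def)
  have sq: "w = (0, False) \<or> w = (2, False)" if "w \<in> carrier (metacyclic8 True)"
    "w \<otimes>\<^bsub>metacyclic8 True\<^esub> w = (0, False)" for w
    using that by (cases w) (auto simp: carrier_metacyclic8 mult_metacyclic8 atLeastLessThan_0_4 split: if_splits)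
  have mult: "f (x \<otimes>\<^bsub>metacyclic8 False\<^esub> y) = f x \<otimes>\<^bsub>metacyclic8 True\<^esub> f y"
    if "x \<in> carrier (metacyclic8 False)" "y \<in> carrier (metacyclic8 False)" for x y
    using f(1) that by (auto simp: hom_def)
  have c: "(0, False) \<in> carrier (metacyclic8 False)" "(2, False) \<in> carrier (metacyclic8 False)"
    "(0, True) \<in> carrier (metacyclic8 False)" by (simp_all add: carrier_metacyclic8)
  have f0: "f (0, False) = (0, False)"
  proof -
    have "\<forall>a\<in>{0, 1, 2, 3}. \<forall>s. (a, s) \<otimes>\<^bsub>metacyclic8 True\<^esub> (a, s) = (a, s) \<longrightarrow> (a, s) = (0, False)"
      by (simp add: mult_metacyclic8 all_bool_eq)
    then have "w = (0, False)" if "w \<in> carrier (metacyclic8 True)" "w \<otimes>\<^bsub>metacyclic8 True\<^esub> w = w" for w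
      using that unfolding carrier_metacyclic8 atLeastLessThan_0_4 by fast
    moreover have "(0, False) \<otimes>\<^bsub>metacyclic8 False\<^esub> (0, False) = (0, False)" by (simp add: mult_metacyclic8)
    then have "f (0, False) \<otimes>\<^bsub>metacyclic8 True\<^esub> f (0, False) = f (0, False)"
      using mult[OF c(1,1)] by (simp only:)
    ultimately show ?thesis using cl[OF c(1)] by blast
  qed
  have "f w = (2, False)" if w: "w \<in> carrier (metacyclic8 False)" "w \<otimes>\<^bsub>metacyclic8 False\<^esub> w = (0, False)"
    "w \<noteq> (0, False)" for w
  proof -
    have "f w \<otimes>\<^bsub>metacyclic8 True\<^esub> f w = (0, False)" using mult[OF w(1,1)] w(2) f0 by simp
    moreover have "f w \<noteq> (0, False)" using inj[OF w(1) c(1)] w(3) f0 by simp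
    ultimately show ?thesis using sq[OF cl[OF w(1)]] by blast
  qed
  then have "f (2, False) = (2, False)" "f (0, True) = (2, False)"
    using c by (simp_all add: mult_metacyclic8)
  then show False using inj[OF c(2,3)] by simp
qed

section \<open>Adjoining a formal square root, with \<open>(x, y)\<close> standing for
  \<open>x + y \<surd>d\<close>\<close>

definition quadratic_extension :: "('a, 'm) ring_scheme \<Rightarrow> 'a \<Rightarrow> ('a \<times> 'a) ring" where
  "quadratic_extension A d =
     \<lparr>carrier = carrier A \<times> carrier A,
      monoid.mult = (\<lambda>(x, y) (x', y').
        (x \<otimes>\<^bsub>A\<^esub> x' \<oplus>\<^bsub>A\<^esub> d \<otimes>\<^bsub>A\<^esub> (y \<otimes>\<^bsub>A\<^esub> y'), x \<otimes>\<^bsub>A\<^esub> y' \<oplus>\<^bsub>A\<^esub> y \<otimes>\<^bsub>A\<^esub> x')),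
      one = (\<one>\<^bsub>A\<^esub>, \<zero>\<^bsub>A\<^esub>),
      ring.zero = (\<zero>\<^bsub>A\<^esub>, \<zero>\<^bsub>A\<^esub>),
      ring.add = (\<lambda>(x, y) (x', y'). (x \<oplus>\<^bsub>A\<^esub> x', y \<oplus>\<^bsub>A\<^esub> y'))\<rparr>"

lemma quadratic_extension_simps:
  "carrier (quadratic_extension A d) = carrier A \<times> carrier A"
  "(x, y) \<otimes>\<^bsub>quadratic_extension A d\<^esub> (x', y') =
     (x \<otimes>\<^bsub>A\<^esub> x' \<oplus>\<^bsub>A\<^esub> d \<otimes>\<^bsub>A\<^esub> (y \<otimes>\<^bsub>A\<^esub> y'), x \<otimes>\<^bsub>A\<^esub> y' \<oplus>\<^bsub>A\<^esub> y \<otimes>\<^bsub>A\<^esub> x')"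
  "\<one>\<^bsub>quadratic_extension A d\<^esub> = (\<one>\<^bsub>A\<^esub>, \<zero>\<^bsub>A\<^esub>)"
  "\<zero>\<^bsub>quadratic_extension A d\<^esub> = (\<zero>\<^bsub>A\<^esub>, \<zero>\<^bsub>A\<^esub>)"
  "(x, y) \<oplus>\<^bsub>quadratic_extension A d\<^esub> (x', y') = (x \<oplus>\<^bsub>A\<^esub> x', y \<oplus>\<^bsub>A\<^esub> y')"
  by (simp_all add: quadratic_extension_def)

lemma (in cring) quadratic_extension_cring:
  assumes d: "d \<in> carrier R"
  shows "cring (quadratic_extension R d)"
proof (rule cringI)
  show "abelian_group (quadratic_extension R d)"
  proof (rule abelian_groupI)
    fix u assume "u \<in> carrier (quadratic_extension R d)"
    then obtain x y where u: "u = (x, y)" "x \<in> carrier R" "y \<in> carrier R"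
      by (auto simp: quadratic_extension_simps)
    then show "\<exists>w\<in>carrier (quadratic_extension R d). w \<oplus>\<^bsub>quadratic_extension R d\<^esub> u = \<zero>\<^bsub>quadratic_extension R d\<^esub>"
      by (intro bexI[of _ "(\<ominus> x, \<ominus> y)"]) (auto simp: quadratic_extension_simps l_neg)
  qed (auto simp: quadratic_extension_simps a_ac)
  show "comm_monoid (quadratic_extension R d)"
  proof (rule comm_monoidI)
    fix u w t
    assume "u \<in> carrier (quadratic_extension R d)" "w \<in> carrier (quadratic_extension R d)"
      "t \<in> carrier (quadratic_extension R d)"
    then obtain x y x' y' x'' y'' where *: "u = (x, y)" "w = (x', y')" "t = (x'', y'')"
      and c: "x \<in> carrier R" "y \<in> carrier R" "x' \<in> carrier R" "y' \<in> carrier R" "x'' \<in> carrier R" "y'' \<in> carrier R"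
      by (auto simp: quadratic_extension_simps)
    have "(x \<otimes> x' \<oplus> d \<otimes> (y \<otimes> y')) \<otimes> x'' \<oplus> d \<otimes> ((x \<otimes> y' \<oplus> y \<otimes> x') \<otimes> y'')
        = x \<otimes> (x' \<otimes> x'' \<oplus> d \<otimes> (y' \<otimes> y'')) \<oplus> d \<otimes> (y \<otimes> (x' \<otimes> y'' \<oplus> y' \<otimes> x''))"
      using c d by algebra
    moreover have "(x \<otimes> x' \<oplus> d \<otimes> (y \<otimes> y')) \<otimes> y'' \<oplus> (x \<otimes> y' \<oplus> y \<otimes> x') \<otimes> x''
        = x \<otimes> (x' \<otimes> y'' \<oplus> y' \<otimes> x'') \<oplus> y \<otimes> (x' \<otimes> x'' \<oplus> d \<otimes> (y' \<otimes> y''))"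
      using c d by algebra
    ultimately show "u \<otimes>\<^bsub>quadratic_extension R d\<^esub> w \<otimes>\<^bsub>quadratic_extension R d\<^esub> t
        = u \<otimes>\<^bsub>quadratic_extension R d\<^esub> (w \<otimes>\<^bsub>quadratic_extension R d\<^esub> t)"
      by (simp add: * quadratic_extension_simps)
  qed (use d in \<open>auto simp: quadratic_extension_simps m_comm a_comm\<close>)
  fix u w t
  assume "u \<in> carrier (quadratic_extension R d)" "w \<in> carrier (quadratic_extension R d)"
    "t \<in> carrier (quadratic_extension R d)"
  then obtain x y x' y' x'' y'' where *: "u = (x, y)" "w = (x', y')" "t = (x'', y'')"
    and c: "x \<in> carrier R" "y \<in> carrier R" "x' \<in> carrier R" "y' \<in> carrier R" "x'' \<in> carrier R" "y'' \<in> carrier R"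
    by (auto simp: quadratic_extension_simps)
  have "(x \<oplus> x') \<otimes> x'' \<oplus> d \<otimes> ((y \<oplus> y') \<otimes> y'') = (x \<otimes> x'' \<oplus> d \<otimes> (y \<otimes> y'')) \<oplus> (x' \<otimes> x'' \<oplus> d \<otimes> (y' \<otimes> y''))"
    using c d by algebra
  moreover have "(x \<oplus> x') \<otimes> y'' \<oplus> (y \<oplus> y') \<otimes> x'' = (x \<otimes> y'' \<oplus> y \<otimes> x'') \<oplus> (x' \<otimes> y'' \<oplus> y' \<otimes> x'')"
    using c by algebra
  ultimately show "(u \<oplus>\<^bsub>quadratic_extension R d\<^esub> w) \<otimes>\<^bsub>quadratic_extension R d\<^esub> t
      = u \<otimes>\<^bsub>quadratic_extension R d\<^esub> t \<oplus>\<^bsub>quadratic_extension R d\<^esub> w \<otimes>\<^bsub>quadratic_extension R d\<^esub> t"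
    by (simp add: * quadratic_extension_simps)
qed

text \<open>The inverse is the conjugate divided by the norm \<open>x^2 - d y^2\<close>; a vanishing
  norm with \<open>y\<close> nonzero would exhibit \<open>d\<close> as the square of
  \<open>x / y\<close>.\<close>

lemma (in field) quadratic_extension_field:
  assumes d: "d \<in> carrier R" and nonsquare: "\<And>x. x \<in> carrier R \<Longrightarrow> x \<otimes> x \<noteq> d"
  shows "field (quadratic_extension R d)"
proof (rule cring.cring_fieldI2[OF quadratic_extension_cring[OF d]])
  show "\<zero>\<^bsub>quadratic_extension R d\<^esub> \<noteq> \<one>\<^bsub>quadratic_extension R d\<^esub>"
    by (simp add: quadratic_extension_simps)
  fix u assume "u \<in> carrier (quadratic_extension R d)" "u \<noteq> \<zero>\<^bsub>quadratic_extension R d\<^esub>"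
  then obtain x y where u: "u = (x, y)" "x \<in> carrier R" "y \<in> carrier R" "x \<noteq> \<zero> \<or> y \<noteq> \<zero>"
    by (auto simp: quadratic_extension_simps)
  define n where "n = x \<otimes> x \<ominus> d \<otimes> (y \<otimes> y)"
  have n: "n \<in> carrier R" using u d by (simp add: n_def)
  have "n \<noteq> \<zero>"
  proof
    assume "n = \<zero>"
    then have eq: "x \<otimes> x = d \<otimes> (y \<otimes> y)" using u d by (simp add: n_def)
    show False
    proof (cases "y = \<zero>")
      case True
      then show False using eq u d by (simp add: integral_iff)
    next
      case False
      note iy = nonzero_inv[OF u(3) False]
      have "(x \<otimes> inv y) \<otimes> (x \<otimes> inv y) = (x \<otimes> x) \<otimes> (inv y \<otimes> inv y)" using u(2) iy(1) by algebra
      also have "\<dots> = d \<otimes> ((y \<otimes> inv y) \<otimes> (y \<otimes> inv y))" unfolding eq using u(3) d iy(1) by algebra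
      finally show False using iy nonsquare[of "x \<otimes> inv y"] u(2) d by simp
    qed
  qed
  note i = nonzero_inv[OF n this]
  have "x \<otimes> (x \<otimes> inv n) \<oplus> d \<otimes> (y \<otimes> (\<ominus> y \<otimes> inv n)) = n \<otimes> inv n"
    unfolding n_def using u(2,3) d i(1)[unfolded n_def] by algebra
  moreover have "x \<otimes> (\<ominus> y \<otimes> inv n) \<oplus> y \<otimes> (x \<otimes> inv n) = \<zero>"
    using u(2,3) i(1) by algebra
  ultimately show "\<exists>w\<in>carrier (quadratic_extension R d). u \<otimes>\<^bsub>quadratic_extension R d\<^esub> w = \<one>\<^bsub>quadratic_extension R d\<^esub>"
    using u i(1,2) by (intro bexI[of _ "(x \<otimes> inv n, \<ominus> y \<otimes> inv n)"]) (simp_all add: quadratic_extension_simps)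
qed

definition adjoin_hom :: "('b, 'n) ring_scheme \<Rightarrow> ('a \<Rightarrow> 'b) \<Rightarrow> 'b \<Rightarrow> 'a \<times> 'a \<Rightarrow> 'b" where
  "adjoin_hom B \<psi> y = (\<lambda>(s, t). \<psi> s \<oplus>\<^bsub>B\<^esub> \<psi> t \<otimes>\<^bsub>B\<^esub> y)"

text \<open>The universal property of the formal root: a homomorphism extends as soon as the image
  of \<open>d\<close> is given a square root.\<close>

lemma (in cring) adjoin_hom:
  assumes A: "cring A" and \<psi>: "\<psi> \<in> ring_hom A R" and d: "d \<in> carrier A" and y: "y \<in> carrier R" "y \<otimes> y = \<psi> d"
  shows "adjoin_hom R \<psi> y \<in> ring_hom (quadratic_extension A d) R"
proof (rule ring_hom_memI)
  interpret A: cring A by (rule A)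
  note hom = ring_hom_closed[OF \<psi>] ring_hom_add[OF \<psi>] ring_hom_mult[OF \<psi>] ring_hom_one[OF \<psi>]
    ring_hom_zero[OF \<psi> A.ring_axioms ring_axioms]
  show "adjoin_hom R \<psi> y \<one>\<^bsub>quadratic_extension A d\<^esub> = \<one>"
    using y by (simp add: adjoin_hom_def quadratic_extension_simps hom)
  fix u assume "u \<in> carrier (quadratic_extension A d)"
  then obtain s t where u: "u = (s, t)" "s \<in> carrier A" "t \<in> carrier A" by (auto simp: quadratic_extension_simps)
  then show "adjoin_hom R \<psi> y u \<in> carrier R" using y by (simp add: adjoin_hom_def hom)
  fix w assume "w \<in> carrier (quadratic_extension A d)"
  then obtain s' t' where w: "w = (s', t')" "s' \<in> carrier A" "t' \<in> carrier A" by (auto simp: quadratic_extension_simps)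
  have c: "\<psi> s \<in> carrier R" "\<psi> t \<in> carrier R" "\<psi> s' \<in> carrier R" "\<psi> t' \<in> carrier R" using u w hom by auto
  have "(\<psi> s \<oplus> \<psi> s') \<oplus> (\<psi> t \<oplus> \<psi> t') \<otimes> y = (\<psi> s \<oplus> \<psi> t \<otimes> y) \<oplus> (\<psi> s' \<oplus> \<psi> t' \<otimes> y)"
    using c y(1) by algebra
  then show "adjoin_hom R \<psi> y (u \<oplus>\<^bsub>quadratic_extension A d\<^esub> w) = adjoin_hom R \<psi> y u \<oplus> adjoin_hom R \<psi> y w"
    using u w by (simp add: adjoin_hom_def quadratic_extension_simps hom)
  have "(\<psi> s \<otimes> \<psi> s' \<oplus> (y \<otimes> y) \<otimes> (\<psi> t \<otimes> \<psi> t')) \<oplus> (\<psi> s \<otimes> \<psi> t' \<oplus> \<psi> t \<otimes> \<psi> s') \<otimes> y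
      = (\<psi> s \<oplus> \<psi> t \<otimes> y) \<otimes> (\<psi> s' \<oplus> \<psi> t' \<otimes> y)"
    using c y(1) by algebra
  then show "adjoin_hom R \<psi> y (u \<otimes>\<^bsub>quadratic_extension A d\<^esub> w) = adjoin_hom R \<psi> y u \<otimes> adjoin_hom R \<psi> y w"
    using u w d y by (simp add: adjoin_hom_def quadratic_extension_simps hom)
qed

section \<open>The Galois group of a tower of three quadratic extensions\<close>

text \<open>Write \<open>\<theta> = t0 + t1 i\<close> and \<open>c = c0 + c1 i\<close>. By
  \<open>twist\<close>, \<open>c y\<close> is a square root of the conjugate of
  \<open>\<theta>\<close> times \<open>r\<close>, so \<open>universal\<close> yields an automorphism
  sending \<open>i\<close> to \<open>-i\<close>, \<open>r\<close> to \<open>r\<close>,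
  \<open>y\<close> to \<open>c y\<close>. Its square multiplies \<open>y\<close> by the norm of
  \<open>c\<close>; \<open>twist_norm\<close> thus decides between the two groups.\<close>

locale octic_extension = field R for R (structure) +
  fixes k :: "'a set" and p t0 t1 c0 c1 i r y :: 'a and tw :: bool
  assumes subfield_k: "subfield k R" and two_nonzero: "\<one> \<oplus> \<one> \<noteq> \<zero>"
    and params: "p \<in> k" "t0 \<in> k" "t1 \<in> k" "c0 \<in> k" "c1 \<in> k"
    and gens: "i \<in> carrier R" "r \<in> carrier R" "y \<in> carrier R"
    and ii: "i \<otimes> i = \<ominus> \<one>" and rr: "r \<otimes> r = p" and yy: "y \<otimes> y = (t0 \<oplus> t1 \<otimes> i) \<otimes> r"
    and y_nonzero: "y \<noteq> \<zero>"
    and twist: "(c0 \<oplus> c1 \<otimes> i) \<otimes> (c0 \<oplus> c1 \<otimes> i) \<otimes> (t0 \<oplus> t1 \<otimes> i) = t0 \<ominus> t1 \<otimes> i"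
    and twist_norm: "(c0 \<oplus> c1 \<otimes> i) \<otimes> (c0 \<ominus> c1 \<otimes> i) = (if tw then \<ominus> \<one> else \<one>)"
    and universal: "\<lbrakk>i' \<in> carrier R; r' \<in> carrier R; y' \<in> carrier R; i' \<otimes> i' = \<ominus> \<one>; r' \<otimes> r' = p;
        y' \<otimes> y' = (t0 \<oplus> t1 \<otimes> i') \<otimes> r'\<rbrakk>
      \<Longrightarrow> \<exists>f\<in>ring_hom R R. (\<forall>x\<in>k. f x = x) \<and> f i = i' \<and> f r = r' \<and> f y = y'"
    and generated: "carrier R = pair_span (pair_span (pair_span k i) r) y"
begin

definition c :: 'a where "c = c0 \<oplus> c1 \<otimes> i"

definition ipow :: "int \<Rightarrow> 'a" where
  "ipow n = (if n mod 4 = 0 then \<one> else if n mod 4 = 1 then i else if n mod 4 = 2 then \<ominus> \<one> else \<ominus> i)"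

text \<open>These are the images of the generators under \<open>\<rho>^a \<sigma>^s\<close>. Here
  \<open>\<rho>\<close> fixes \<open>i\<close>, negates \<open>r\<close> and multiplies
  \<open>y\<close> by \<open>i\<close>, while \<open>\<sigma>\<close> negates \<open>i\<close>,
  fixes \<open>r\<close> and multiplies \<open>y\<close> by \<open>c\<close>.\<close>

definition img_i :: "int \<times> bool \<Rightarrow> 'a" where "img_i w = (if snd w then \<ominus> i else i)"
definition img_r :: "int \<times> bool \<Rightarrow> 'a" where "img_r w = (if even (fst w) then r else \<ominus> r)"
definition img_y :: "int \<times> bool \<Rightarrow> 'a" where
  "img_y w = ipow (fst w) \<otimes> ((if snd w then c else \<one>) \<otimes> y)"

lemma k_closed: "x \<in> k \<Longrightarrow> x \<in> carrier R"
  using subfieldE(3)[OF subfield_k] by blast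

lemma spans_closed:
  "k \<subseteq> carrier R" "pair_span k i \<subseteq> carrier R" "pair_span (pair_span k i) r \<subseteq> carrier R"
proof -
  show 1: "k \<subseteq> carrier R" using k_closed by blast
  show 2: "pair_span k i \<subseteq> carrier R" using pair_span_closed[OF 1 gens(1)] .
  show "pair_span (pair_span k i) r \<subseteq> carrier R" using pair_span_closed[OF 2 gens(2)] .
qed

lemma c_closed: "c \<in> carrier R"
  using params gens k_closed by (simp add: c_def)

lemma i_nonzero: "i \<noteq> \<zero>"
proof
  assume "i = \<zero>"
  then have "\<ominus> \<one> = \<zero>" using ii by simp
  then show False by (metis add.inv_eq_1_iff one_closed one_not_zero)
qed

lemma neg_self: "x \<in> carrier R \<Longrightarrow> \<ominus> x = x \<Longrightarrow> x = \<zero>"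
  using neg_eq_self[OF two_nonzero] .

lemma r_nonzero: "r \<noteq> \<zero>"
  using yy y_nonzero gens params k_closed by (auto simp: integral_iff)

lemma c_nonzero: "c \<noteq> \<zero>"
proof
  assume "c = \<zero>"
  then have "(if tw then \<ominus> \<one> else \<one>) = \<zero>"
    using twist_norm params gens k_closed by (simp add: c_def)
  then show False by (auto split: if_splits)
qed

lemma ipow_closed [simp]: "ipow n \<in> carrier R"
  using gens by (simp add: ipow_def)

lemma mod_4_cases: "(n::int) mod 4 = 0 \<or> n mod 4 = 1 \<or> n mod 4 = 2 \<or> n mod 4 = 3"
  by presburger

lemma ipow_mod: "ipow (n mod 4) = ipow n"
  by (simp add: ipow_def)

lemma ipow_add: "ipow (n + n') = ipow n \<otimes> ipow n'"
proof -
  have all: "\<forall>a\<in>{0, 1, 2, 3}. \<forall>b\<in>{0, 1, 2, 3}. ipow (a + b) = ipow a \<otimes> ipow b"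
    using gens ii by (simp add: ipow_def l_minus r_minus)
  have mem: "n mod 4 \<in> {0, 1, 2, 3}" "n' mod 4 \<in> {0, 1, 2, 3}"
    using mod_4_cases[of n] mod_4_cases[of n'] by auto
  have "ipow (n mod 4 + n' mod 4) = ipow (n mod 4) \<otimes> ipow (n' mod 4)"
    using bspec[OF bspec[OF all mem(1)] mem(2)] .
  then show ?thesis
    using ipow_mod[of "n + n'"] ipow_mod[of "n mod 4 + n' mod 4"] by (simp add: ipow_mod mod_simps)
qed

lemma ipow_square: "ipow n \<otimes> ipow n = (if even n then \<one> else \<ominus> \<one>)"
proof -
  have "even n \<longleftrightarrow> even (n mod 4)" by presburger
  then show ?thesis using mod_4_cases[of n] gens ii by (auto simp: ipow_def l_minus r_minus)
qed

lemma ipow_2: "ipow 2 = \<ominus> \<one>" "ipow 0 = \<one>"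
  by (simp_all add: ipow_def)

lemma hom_ipow:
  assumes f: "f \<in> ring_hom R R" shows "f i = i \<Longrightarrow> f (ipow n) = ipow n" "f i = \<ominus> i \<Longrightarrow> f (ipow n) = ipow (- n)"
proof -
  show "f i = i \<Longrightarrow> f (ipow n) = ipow n" using f gens by (simp add: ipow_def endo)
  have "(- n) mod 4 = (if n mod 4 = 0 then 0 else 4 - n mod 4)" by presburger
  then show "f i = \<ominus> i \<Longrightarrow> f (ipow n) = ipow (- n)"
    using mod_4_cases[of n] f gens by (elim disjE) (simp_all add: ipow_def endo)
qed

lemma ipow_inj: "ipow a = ipow b \<longleftrightarrow> a mod 4 = b mod 4"
proof -
  have n1: "\<one> \<noteq> \<ominus> \<one>" "\<ominus> \<one> \<noteq> \<one>" using neg_self[of \<one>] by auto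
  have ni: "i \<noteq> \<ominus> i" "\<ominus> i \<noteq> i" using neg_self[of i] gens i_nonzero by metis+
  have sq: "i \<noteq> \<one>" "i \<noteq> \<ominus> \<one>" "\<ominus> i \<noteq> \<one>" "\<ominus> i \<noteq> \<ominus> \<one>"
    using ii n1 gens by (metis l_minus r_minus minus_minus one_closed r_one a_inv_closed)+
  show ?thesis using mod_4_cases[of a] mod_4_cases[of b] n1 ni sq sq[symmetric] by (auto simp: ipow_def)
qed

lemma img_closed: "img_i w \<in> carrier R" "img_r w \<in> carrier R" "img_y w \<in> carrier R"
  using gens c_closed by (simp_all add: img_i_def img_r_def img_y_def)

lemma img_relations:
  "img_i w \<otimes> img_i w = \<ominus> \<one>" "img_r w \<otimes> img_r w = p"
  "img_y w \<otimes> img_y w = (t0 \<oplus> t1 \<otimes> img_i w) \<otimes> img_r w"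
proof -
  have cl: "t0 \<in> carrier R" "t1 \<in> carrier R" using params k_closed by auto
  show "img_i w \<otimes> img_i w = \<ominus> \<one>" "img_r w \<otimes> img_r w = p"
    using gens ii rr params k_closed by (simp_all add: img_i_def img_r_def l_minus r_minus)
  define u where "u = (if snd w then c else \<one>)"
  have u: "u \<in> carrier R" using c_closed by (simp add: u_def)
  have ut: "u \<otimes> u \<otimes> (t0 \<oplus> t1 \<otimes> i) = t0 \<oplus> t1 \<otimes> img_i w"
    using twist gens cl by (simp add: u_def c_def img_i_def minus_eq r_minus)
  have "img_y w \<otimes> img_y w = (ipow (fst w) \<otimes> ipow (fst w)) \<otimes> ((u \<otimes> u) \<otimes> (y \<otimes> y))"
    unfolding img_y_def u_def[symmetric] using u gens(3) ipow_closed[of "fst w"] by algebra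
  also have "\<dots> = (ipow (fst w) \<otimes> ipow (fst w)) \<otimes> ((u \<otimes> u \<otimes> (t0 \<oplus> t1 \<otimes> i)) \<otimes> r)"
    unfolding yy using u gens cl by (simp add: m_assoc)
  also have "\<dots> = (t0 \<oplus> t1 \<otimes> img_i w) \<otimes> img_r w"
    unfolding ut using cl gens img_closed(1)[of w] by (simp add: ipow_square img_r_def l_minus r_minus)
  finally show "img_y w \<otimes> img_y w = (t0 \<oplus> t1 \<otimes> img_i w) \<otimes> img_r w" .
qed

text \<open>\<open>universal\<close> provides an endomorphism with these values; the restriction
  makes it extensional, as elements of \<open>BijGroup\<close> are, so that maps agreeing on the
  carrier are equal.\<close>

definition act :: "int \<times> bool \<Rightarrow> 'a \<Rightarrow> 'a" where
  "act w = restrict (SOME f. f \<in> ring_hom R R \<and> (\<forall>x\<in>k. f x = x) \<and> f i = img_i w \<and> f r = img_r w \<and> f y = img_y w)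
     (carrier R)"

lemma act: "act w \<in> ring_hom R R" "x \<in> k \<Longrightarrow> act w x = x" "act w i = img_i w" "act w r = img_r w" "act w y = img_y w"
  "act w \<in> extensional (carrier R)"
proof -
  let ?P = "\<lambda>f. f \<in> ring_hom R R \<and> (\<forall>x\<in>k. f x = x) \<and> f i = img_i w \<and> f r = img_r w \<and> f y = img_y w"
  have "\<exists>f. ?P f" using universal[OF img_closed img_relations] by blast
  then have P: "?P (SOME f. ?P f)" by (rule someI_ex)
  have eq: "act w u = (SOME f. ?P f) u" if "u \<in> carrier R" for u using that by (simp add: act_def)
  show "act w \<in> ring_hom R R"
    using P by (intro ring_hom_memI) (simp_all add: eq endo_closed ring_hom_add ring_hom_mult ring_hom_one)
  show "x \<in> k \<Longrightarrow> act w x = x" "act w i = img_i w" "act w r = img_r w" "act w y = img_y w"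
    using P eq gens k_closed by auto
  show "act w \<in> extensional (carrier R)" by (simp add: act_def)
qed

lemma hom_eqI:
  assumes f: "f \<in> ring_hom R R" "\<And>x. x \<in> k \<Longrightarrow> f x = x" and g: "g \<in> ring_hom R R" "\<And>x. x \<in> k \<Longrightarrow> g x = x"
    and eq: "f i = g i" "f r = g r" "f y = g y" and x: "x \<in> carrier R"
  shows "f x = g x"
proof -
  note cl = spans_closed
  have 1: "f x = g x" if "x \<in> pair_span k i" for x
    using hom_eq_on_pair_span[OF f(1) g(1) cl(1) gens(1) _ eq(1) that] f(2) g(2) by simp
  have 2: "f x = g x" if "x \<in> pair_span (pair_span k i) r" for x
    using hom_eq_on_pair_span[OF f(1) g(1) cl(2) gens(2) 1 eq(2) that] .
  show ?thesis
    using hom_eq_on_pair_span[OF f(1) g(1) cl(3) gens(3) 2 eq(3)] x generated by blast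
qed

text \<open>By \<open>hom_eqI\<close> it suffices to compare both sides on \<open>i\<close>,
  \<open>r\<close>, \<open>y\<close>; only the value at \<open>y\<close> sees the twist.\<close>

lemma act_comp:
  assumes x: "x \<in> carrier R"
  shows "act w (act w' x) = act (w \<otimes>\<^bsub>metacyclic8 tw\<^esub> w') x"
proof -
  obtain n s n' s' where w: "w = (n, s)" "w' = (n', s')" by (metis surj_pair)
  define m where "m = (if s then n - n' else n + n') + (if tw \<and> s \<and> s' then 2 else 0)"
  have mult: "w \<otimes>\<^bsub>metacyclic8 tw\<^esub> w' = (m mod 4, s \<noteq> s')" by (simp add: w m_def mult_metacyclic8)
  have ev: "even (m mod 4) \<longleftrightarrow> (even n \<longleftrightarrow> even n')"
  proof -
    have "even (m mod 4) \<longleftrightarrow> even m" by presburger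
    then show ?thesis by (simp add: m_def)
  qed
  have comp: "(\<lambda>x. act w (act w' x)) \<in> ring_hom R R"
    using act(1) by (intro ring_hom_memI) (simp_all add: endo)
  have i_eq: "act w i = (if s then \<ominus> i else i)" by (simp add: act img_i_def w)
  have ac: "act w c = (if s then c0 \<ominus> c1 \<otimes> i else c)"
    unfolding c_def using act(1)[of w] act(2)[of _ w] i_eq params k_closed gens
    by (simp add: endo minus_eq r_minus)
  \<comment> \<open>When \<open>\<sigma>\<close> occurs on both sides, \<open>c\<close> meets its
    conjugate. Their product -1 or 1 is the exponent 2 or 0 added in the multiplication of
    \<open>metacyclic8\<close>.\<close>
  have cc: "(c0 \<ominus> c1 \<otimes> i) \<otimes> c = (if tw then ipow 2 else ipow 0)"
    using twist_norm c_closed params k_closed gens by (simp add: c_def ipow_2 m_comm)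
  have "img_y w' = ipow n' \<otimes> ((if s' then c else \<one>) \<otimes> y)" by (simp add: img_y_def w)
  then have "act w (act w' y) = act w (ipow n' \<otimes> ((if s' then c else \<one>) \<otimes> y))" by (simp add: act(5))
  also have "\<dots> = act w (ipow n') \<otimes> (act w (if s' then c else \<one>) \<otimes> img_y w)"
    using act(1)[of w] gens c_closed by (simp add: act(5)[of w] endo)
  also have "act w (ipow n') = ipow (if s then - n' else n')"
    using hom_ipow[OF act(1)] i_eq by simp
  also have "ipow (if s then - n' else n') \<otimes> (act w (if s' then c else \<one>) \<otimes> img_y w)
      = ipow (if s then - n' else n') \<otimes> ipow n \<otimes> ((act w (if s' then c else \<one>) \<otimes> (if s then c else \<one>)) \<otimes> y)"
  proof -
    have *: "(if s then c else \<one>) \<in> carrier R" "act w (if s' then c else \<one>) \<in> carrier R"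
      using c_closed act(1)[of w] by (simp_all add: endo)
    show ?thesis unfolding img_y_def w fst_conv snd_conv
      using *[unfolded w] gens(3) ipow_closed[of n] ipow_closed[of "if s then - n' else n'"] by (simp add: m_ac)
  qed
  also have "act w (if s' then c else \<one>) \<otimes> (if s then c else \<one>)
      = ipow (if tw \<and> s \<and> s' then 2 else 0) \<otimes> (if s \<noteq> s' then c else \<one>)"
    using c_closed act(1)[of w] ac cc by (simp add: endo ipow_2)
  also have "ipow (if s then - n' else n') \<otimes> ipow n \<otimes> ((ipow (if tw \<and> s \<and> s' then 2 else 0) \<otimes> (if s \<noteq> s' then c else \<one>)) \<otimes> y)
      = ipow m \<otimes> ((if s \<noteq> s' then c else \<one>) \<otimes> y)"
  proof -
    have "(if s \<noteq> s' then c else \<one>) \<in> carrier R" using c_closed by simp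
    moreover have "ipow m = ipow (if s then - n' else n') \<otimes> ipow n \<otimes> ipow (if tw \<and> s \<and> s' then 2 else 0)"
      unfolding ipow_add[symmetric] by (rule arg_cong[of _ _ ipow]) (simp add: m_def)
    ultimately show ?thesis using gens(3)
      by (simp only: m_assoc m_closed ipow_closed)
  qed
  finally have y_eq: "act w (act w' y) = act (w \<otimes>\<^bsub>metacyclic8 tw\<^esub> w') y"
    by (simp add: act(5) img_y_def mult ipow_mod)
  have fs: "fst w = n" "snd w = s" "fst w' = n'" "snd w' = s'"
    "fst (w \<otimes>\<^bsub>metacyclic8 tw\<^esub> w') = m mod 4" "snd (w \<otimes>\<^bsub>metacyclic8 tw\<^esub> w') = (s \<noteq> s')"
    by (simp_all only: mult) (simp_all add: w)
  have "act w (act w' i) = act (w \<otimes>\<^bsub>metacyclic8 tw\<^esub> w') i"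
    using act(1)[of w] gens by (auto simp: act(3) img_i_def fs endo)
  moreover have "act w (act w' r) = act (w \<otimes>\<^bsub>metacyclic8 tw\<^esub> w') r"
    using act(1)[of w] gens by (auto simp: act(4) img_r_def fs ev endo)
  ultimately show ?thesis
    using hom_eqI[OF comp _ act(1) act(2) _ _ y_eq x] act(2) by simp
qed

lemma act_one: "x \<in> carrier R \<Longrightarrow> act (0, False) x = x"
proof -
  have "(\<lambda>x. x) \<in> ring_hom R R" by (intro ring_hom_memI) auto
  moreover have "act (0, False) i = i" "act (0, False) r = r" "act (0, False) y = y"
    using gens by (simp_all add: act img_i_def img_r_def img_y_def ipow_2)
  ultimately show "x \<in> carrier R \<Longrightarrow> act (0, False) x = x"
    using hom_eqI[OF act(1) act(2)] by blast
qed

lemma act_Bij: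
  assumes "w \<in> carrier (metacyclic8 tw)"
  shows "act w \<in> Bij (carrier R)"
proof -
  obtain n s where w: "w = (n, s)" by (metis surj_pair)
  \<comment> \<open>The inverse word: \<open>\<rho>^n \<sigma>\<close> squares to
    \<open>\<sigma>^2\<close>, so in the twisted case its inverse carries the extra factor
    \<open>\<rho>^2\<close>.\<close>
  define w' where "w' = (if s then (n + (if tw then 2 else 0)) mod 4 else (- n) mod 4, s)"
  have "w \<otimes>\<^bsub>metacyclic8 tw\<^esub> w' = (0, False)" "w' \<otimes>\<^bsub>metacyclic8 tw\<^esub> w = (0, False)"
    by (auto simp: w w'_def mult_metacyclic8 mod_simps) presburger+
  then have "act w (act w' x) = x" "act w' (act w x) = x" if "x \<in> carrier R" for x
    using act_comp[OF that] act_one[OF that] by auto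
  then have "bij_betw (act w) (carrier R) (carrier R)"
    by (intro bij_betw_byWitness[where f' = "act w'"]) (auto intro: endo_closed[OF act(1)])
  then show ?thesis using act(6) by (simp add: Bij_def)
qed

text \<open>This is \<open>galois_group K L \<phi>\<close> when \<open>k\<close> is the image of
  \<open>\<phi>\<close>, phrased with a subfield so that the locale need not refer to
  \<open>K\<close>.\<close>

definition fixing_group :: "('a \<Rightarrow> 'a) monoid" where
  "fixing_group = BijGroup (carrier R)
     \<lparr>carrier := {\<sigma> \<in> ring_hom R R \<inter> Bij (carrier R). \<forall>x\<in>k. \<sigma> x = x}\<rparr>"

text \<open>The relations leave two choices for each of \<open>f i\<close>, \<open>f r\<close>,
  \<open>f y\<close>. The sign at \<open>i\<close> gives \<open>s\<close>, the sign at
  \<open>r\<close> the parity of the exponent, and the sign at \<open>y\<close> separates an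
  exponent \<open>n0\<close> from \<open>n0 + 2\<close>.\<close>

lemma act_surj:
  assumes f: "f \<in> ring_hom R R" "\<And>x. x \<in> k \<Longrightarrow> f x = x" "f \<in> extensional (carrier R)"
  shows "\<exists>w\<in>carrier (metacyclic8 tw). f = act w"
proof -
  have fc: "f i \<in> carrier R" "f r \<in> carrier R" "f y \<in> carrier R" using f gens by (simp_all add: endo)
  have cl: "t0 \<in> carrier R" "t1 \<in> carrier R" "p \<in> carrier R" using params k_closed by auto
  have "f i \<otimes> f i = i \<otimes> i" using ii f gens by (simp add: endo flip: ring_hom_mult[OF f(1)])
  then obtain s where s: "f i = (if s then \<ominus> i else i)"
    using square_eq_iff[OF fc(1) gens(1)] by metis
  have "f r \<otimes> f r = r \<otimes> r" using rr f params gens by (simp flip: ring_hom_mult[OF f(1)])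
  then obtain n0 :: int where n0: "n0 \<in> {0, 1}" "f r = (if even n0 then r else \<ominus> r)"
    using square_eq_iff[OF fc(2) gens(2)] by (metis even_zero insertI1 insertI2 odd_one)
  have "f y \<otimes> f y = (t0 \<oplus> t1 \<otimes> f i) \<otimes> f r"
  proof -
    have "f y \<otimes> f y = f ((t0 \<oplus> t1 \<otimes> i) \<otimes> r)" using yy f gens by (simp flip: ring_hom_mult[OF f(1)])
    then show ?thesis using f(1) f(2)[OF params(2)] f(2)[OF params(3)] cl gens by (simp add: endo)
  qed
  also have "\<dots> = img_y (n0, s) \<otimes> img_y (n0, s)"
    unfolding img_relations(3) s n0(2) by (simp add: img_i_def img_r_def)
  finally have "f y = img_y (n0, s) \<or> f y = \<ominus> img_y (n0, s)"
    using square_eq_iff[OF fc(3) img_closed(3)] by blast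
  moreover have "\<ominus> img_y (n0, s) = img_y (n0 + 2, s)"
    using gens c_closed by (simp add: img_y_def ipow_add ipow_2 l_minus r_minus)
  ultimately obtain n :: int where n: "n = n0 \<or> n = n0 + 2" "f y = img_y (n, s)" by auto
  then have n4: "n \<in> {0..<4}" "even n \<longleftrightarrow> even n0" using n0(1) by auto
  have "f x = act (n, s) x" if "x \<in> carrier R" for x
    by (rule hom_eqI[OF f(1,2) act(1,2) _ _ _ that])
      (use s n0(2) n(2) n4(2) in \<open>simp_all add: act img_i_def img_r_def\<close>)
  then have "f = act (n, s)" using f(3) act(6) by (intro extensionalityI) auto
  then show ?thesis using n4(1) by (auto simp: carrier_metacyclic8)
qed

lemma act_inj: "inj_on act (carrier (metacyclic8 tw))"
proof (rule inj_onI)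
  fix w w' assume w: "w \<in> carrier (metacyclic8 tw)" "w' \<in> carrier (metacyclic8 tw)" and eq: "act w = act w'"
  have "img_i w = img_i w'" using act(3)[of w] act(3)[of w'] eq by simp
  then have s: "snd w = snd w'"
    using neg_self[of i] gens(1) i_nonzero by (auto simp: img_i_def split: if_splits)
  define u where "u = (if snd w then c else \<one>) \<otimes> y"
  have u: "u \<in> carrier R" "u \<noteq> \<zero>" using gens c_closed c_nonzero y_nonzero by (auto simp: u_def integral_iff)
  have "ipow (fst w) \<otimes> u = ipow (fst w') \<otimes> u"
    using act(5)[of w] act(5)[of w'] eq s by (simp add: img_y_def u_def)
  then have "ipow (fst w) = ipow (fst w')" using m_rcancel[OF u(2,1)] by simp
  then have "fst w mod 4 = fst w' mod 4" by (simp add: ipow_inj)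
  then have "fst w = fst w'" using w by (auto simp: carrier_metacyclic8)
  then show "w = w'" using s by (simp add: prod_eq_iff)
qed

lemma act_iso: "act \<in> iso (metacyclic8 tw) fixing_group"
proof -
  have mem: "act w \<in> carrier fixing_group" if "w \<in> carrier (metacyclic8 tw)" for w
    using act act_Bij[OF that] by (simp add: fixing_group_def)
  have "act (w \<otimes>\<^bsub>metacyclic8 tw\<^esub> w') = act w \<otimes>\<^bsub>fixing_group\<^esub> act w'"
    if "w \<in> carrier (metacyclic8 tw)" "w' \<in> carrier (metacyclic8 tw)" for w w'
  proof -
    have "act w \<otimes>\<^bsub>fixing_group\<^esub> act w' = compose (carrier R) (act w) (act w')"
      using act_Bij that by (simp add: fixing_group_def BijGroup_def)
    also have "\<dots> = act (w \<otimes>\<^bsub>metacyclic8 tw\<^esub> w')"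
      by (rule extensionalityI[OF compose_extensional act(6)]) (simp add: compose_eq act_comp)
    finally show ?thesis by simp
  qed
  moreover have "act ` carrier (metacyclic8 tw) = carrier fixing_group"
  proof
    show "act ` carrier (metacyclic8 tw) \<subseteq> carrier fixing_group" using mem by blast
    show "carrier fixing_group \<subseteq> act ` carrier (metacyclic8 tw)"
    proof
      fix f assume "f \<in> carrier fixing_group"
      then show "f \<in> act ` carrier (metacyclic8 tw)"
        using act_surj[of f] by (auto simp: fixing_group_def Bij_def)
    qed
  qed
  ultimately show ?thesis using mem act_inj by (simp add: iso_def hom_def bij_betw_def)
qed

text \<open>The tower is descended from the top: \<open>\<rho>^2\<close> negates \<open>y\<close>,
  \<open>\<rho>\<close> negates \<open>r\<close>, \<open>\<sigma>\<close> negates \<open>i\<close>,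
  and each fixes the stage below its generator, so the coefficient of that generator must
  vanish.\<close>

lemma fixed_by_act:
  assumes x: "x \<in> carrier R" and fixed: "\<And>w. w \<in> carrier (metacyclic8 tw) \<Longrightarrow> act w x = x"
  shows "x \<in> k"
proof -
  note cl = spans_closed
  have id: "(\<lambda>x. x) \<in> ring_hom R R" by (intro ring_hom_memI) auto
  have step: "w \<in> S" if f: "f \<in> ring_hom R R" and S: "S \<subseteq> carrier R" "\<And>s. s \<in> S \<Longrightarrow> f s = s"
    and u: "u \<in> carrier R" "f u = \<ominus> u" and w: "w \<in> pair_span S u" "f w = w" "\<zero> \<in> S" for f S u w
  proof -
    obtain s t where st: "w = s \<oplus> t \<otimes> u" "s \<in> S" "t \<in> S" using w(1) by (auto simp: pair_span_def)
    then have c: "s \<in> carrier R" "t \<in> carrier R" using S by auto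
    have "s \<oplus> t \<otimes> u = s \<oplus> \<ominus> (t \<otimes> u)"
      using w(2) f c u S(2)[OF st(2)] S(2)[OF st(3)] unfolding st(1) by (simp add: endo r_minus)
    then have "\<ominus> (t \<otimes> u) = t \<otimes> u" using c u(1) by simp
    then have "t \<otimes> u = \<zero>" using neg_self c u(1) by simp
    then show ?thesis using st c by simp
  qed
  have z0: "\<zero> \<in> k" using subringE(2)[OF subfieldE(1)[OF subfield_k]] .
  have z1: "\<zero> \<in> pair_span k i" using z0 gens unfolding pair_span_def by force
  have z2: "\<zero> \<in> pair_span (pair_span k i) r"
    using z1 gens unfolding pair_span_def[of "pair_span k i"] by force
  have a1: "act (1, False) s = s" if "s \<in> pair_span k i" for s
    using hom_eq_on_pair_span[OF act(1) id cl(1) gens(1) act(2) _ that] by (simp add: act img_i_def)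
  have a2: "act (2, False) s = s" if "s \<in> pair_span (pair_span k i) r" for s
  proof -
    have "act (2, False) s = s" if "s \<in> pair_span k i" for s
      using hom_eq_on_pair_span[OF act(1) id cl(1) gens(1) act(2) _ that] by (simp add: act img_i_def)
    then show ?thesis
      using hom_eq_on_pair_span[OF act(1) id cl(2) gens(2) _ _ that] by (simp add: act img_r_def)
  qed
  have y2: "act (2, False) y = \<ominus> y" using gens by (simp add: act img_y_def ipow_2 l_minus)
  have x2: "x \<in> pair_span (pair_span (pair_span k i) r) y" "act (2, False) x = x"
    using x generated fixed[of "(2, False)"] by (simp_all add: carrier_metacyclic8)
  have "x \<in> pair_span (pair_span k i) r"
    by (rule step[OF act(1) cl(3) a2 gens(3) y2 x2 z2])
  then have "x \<in> pair_span k i"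
    using step[OF act(1) cl(2) a1 gens(2) _ _ _ z1] fixed[of "(1, False)"]
    by (simp add: act img_r_def carrier_metacyclic8)
  moreover have "act (0, True) x = x" using fixed[of "(0, True)"] by (simp add: carrier_metacyclic8)
  moreover have "act (0, True) i = \<ominus> i" by (simp add: act img_i_def)
  ultimately show ?thesis
    using step[OF act(1)[of "(0, True)"] cl(1) act(2) gens(1) _ _ _ z0] by blast
qed

lemma finite_dimension: "finite_dimension k (carrier R)"
proof -
  let ?Us = "[\<one>, i, r, i \<otimes> r, y, i \<otimes> y, r \<otimes> y, i \<otimes> r \<otimes> y]"
  have Us: "set ?Us \<subseteq> carrier R" using gens by simp
  have comb: "((x1 \<oplus> x2 \<otimes> i) \<oplus> (x3 \<oplus> x4 \<otimes> i) \<otimes> r) \<oplus> ((x5 \<oplus> x6 \<otimes> i) \<oplus> (x7 \<oplus> x8 \<otimes> i) \<otimes> r) \<otimes> y \<in> Span k ?Us"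
    (is "?x \<in> _")
    if xs: "x1 \<in> k" "x2 \<in> k" "x3 \<in> k" "x4 \<in> k" "x5 \<in> k" "x6 \<in> k" "x7 \<in> k" "x8 \<in> k"
    for x1 x2 x3 x4 x5 x6 x7 x8
  proof -
    have "?x = combine [x1, x2, x3, x4, x5, x6, x7, x8] ?Us"
      unfolding combine.simps using xs[THEN k_closed] gens by algebra
    moreover have "set [x1, x2, x3, x4, x5, x6, x7, x8] \<subseteq> k" using xs by simp
    ultimately show ?thesis unfolding Span_eq_combine_set[OF subfield_k Us] by blast
  qed
  have "carrier R \<subseteq> Span k ?Us"
    unfolding generated by (clarsimp simp: pair_span_def simp del: Span.simps) (rule comb)
  then have "carrier R = Span k ?Us" using Span_in_carrier[OF spans_closed(1) Us] by (rule subset_antisym)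
  then show ?thesis using Span_finite_dimension[OF subfield_k Us] by simp
qed

end

section \<open>The universal tower\<close>

lemma square_classes_hom_image:
  fixes K :: "('a, 'm) ring_scheme" and L :: "('b, 'n) ring_scheme"
  assumes K: "square_classes K (carrier K) e p a b m" and L: "field L" and \<phi>: "\<phi> \<in> ring_hom K L"
  shows "square_classes L (\<phi> ` carrier K) (\<phi> e) (\<phi> p) (\<phi> a) (\<phi> b) (\<phi> m)"
proof -
  interpret K: square_classes K "carrier K" e p a b m by (rule K)
  interpret L: field L by (rule L)
  interpret \<phi>: ring_hom_ring K L \<phi> by (rule ring_hom_ringI2[OF K.ring_axioms L.ring_axioms \<phi>])
  have inj: "inj_on \<phi> (carrier K)" using non_trivial_field_hom_is_inj[OF \<phi> K.field_axioms L] .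
  note hom = ring_hom_closed[OF \<phi>] ring_hom_mult[OF \<phi>] ring_hom_add[OF \<phi>] ring_hom_one[OF \<phi>]
  have minus: "\<phi> (\<ominus>\<^bsub>K\<^esub> x) = \<ominus>\<^bsub>L\<^esub> \<phi> x" if "x \<in> carrier K" for x using that by simp
  have diff: "\<phi> (x \<ominus>\<^bsub>K\<^esub> y) = \<phi> x \<ominus>\<^bsub>L\<^esub> \<phi> y" if "x \<in> carrier K" "y \<in> carrier K" for x y
    using that by (simp add: a_minus_def hom)
  have eq: "\<phi> x = \<phi> y \<longleftrightarrow> x = y" if "x \<in> carrier K" "y \<in> carrier K" for x y
    using inj that by (auto simp: inj_on_def)
  have zero: "\<phi> x = \<zero>\<^bsub>L\<^esub> \<longleftrightarrow> x = \<zero>\<^bsub>K\<^esub>" if "x \<in> carrier K" for x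
    using eq[OF that, of "\<zero>\<^bsub>K\<^esub>"] by simp
  show ?thesis
  proof (intro square_classes.intro square_classes_axioms.intro L)
    show "subfield (\<phi> ` carrier K) L"
      using \<phi>.img_is_subfield(2)[OF K.carrier_is_subfield] by simp
    show "\<phi> e \<in> \<phi> ` carrier K" "\<phi> p \<in> \<phi> ` carrier K" "\<phi> a \<in> \<phi> ` carrier K" "\<phi> b \<in> \<phi> ` carrier K"
      "\<phi> m \<in> \<phi> ` carrier K" "\<phi> e \<noteq> \<zero>\<^bsub>L\<^esub>" "\<phi> p \<noteq> \<zero>\<^bsub>L\<^esub>" "\<phi> m \<noteq> \<zero>\<^bsub>L\<^esub>"
      using K.params zero by auto
    show "\<one>\<^bsub>L\<^esub> \<oplus>\<^bsub>L\<^esub> \<one>\<^bsub>L\<^esub> \<noteq> \<zero>\<^bsub>L\<^esub>"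
      using zero[of "\<one>\<^bsub>K\<^esub> \<oplus>\<^bsub>K\<^esub> \<one>\<^bsub>K\<^esub>"] K.two_nonzero by (simp add: hom)
    show "\<phi> a \<otimes>\<^bsub>L\<^esub> \<phi> a \<ominus>\<^bsub>L\<^esub> \<phi> e \<otimes>\<^bsub>L\<^esub> (\<phi> b \<otimes>\<^bsub>L\<^esub> \<phi> b) = \<phi> e \<otimes>\<^bsub>L\<^esub> (\<phi> m \<otimes>\<^bsub>L\<^esub> \<phi> m)"
      using arg_cong[OF K.norm_class, of \<phi>] K.params by (simp add: diff hom)
    show "(\<exists>j\<in>\<phi> ` carrier K. j \<otimes>\<^bsub>L\<^esub> j = \<ominus>\<^bsub>L\<^esub> \<one>\<^bsub>L\<^esub>) \<or> \<phi> e = \<ominus>\<^bsub>L\<^esub> \<one>\<^bsub>L\<^esub>"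
      using K.neg_one
    proof
      assume "\<exists>j\<in>carrier K. j \<otimes>\<^bsub>K\<^esub> j = \<ominus>\<^bsub>K\<^esub> \<one>\<^bsub>K\<^esub>"
      then obtain j where j: "j \<in> carrier K" "j \<otimes>\<^bsub>K\<^esub> j = \<ominus>\<^bsub>K\<^esub> \<one>\<^bsub>K\<^esub>" by blast
      then have "\<phi> j \<otimes>\<^bsub>L\<^esub> \<phi> j = \<ominus>\<^bsub>L\<^esub> \<one>\<^bsub>L\<^esub>" by (metis hom(2,4) minus K.one_closed)
      then show ?thesis using j by blast
    next
      assume "e = \<ominus>\<^bsub>K\<^esub> \<one>\<^bsub>K\<^esub>"
      then show ?thesis using minus[of "\<one>\<^bsub>K\<^esub>"] hom(4) by simp
    qed
  next
    fix u assume "u \<in> \<phi> ` carrier K"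
    then obtain x where x: "x \<in> carrier K" "u = \<phi> x" by blast
    show "u \<otimes>\<^bsub>L\<^esub> u \<noteq> \<phi> e"
      using x K.e_nonsquare[OF x(1)] K.params(1) eq[of "x \<otimes>\<^bsub>K\<^esub> x" e] by (simp add: hom)
    show "\<exists>d\<in>{\<one>\<^bsub>L\<^esub>, \<phi> e, \<phi> p, \<phi> e \<otimes>\<^bsub>L\<^esub> \<phi> p}. \<exists>s\<in>\<phi> ` carrier K. u = d \<otimes>\<^bsub>L\<^esub> (s \<otimes>\<^bsub>L\<^esub> s)" if "u \<noteq> \<zero>\<^bsub>L\<^esub>"
    proof -
      have "x \<noteq> \<zero>\<^bsub>K\<^esub>" using that x by auto
      then obtain d s where d: "d \<in> {\<one>\<^bsub>K\<^esub>, e, p, e \<otimes>\<^bsub>K\<^esub> p}" "s \<in> carrier K" "x = d \<otimes>\<^bsub>K\<^esub> (s \<otimes>\<^bsub>K\<^esub> s)"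
        using K.classes[OF x(1)] by blast
      have "d \<in> carrier K" using d(1) K.params by auto
      then have "u = \<phi> d \<otimes>\<^bsub>L\<^esub> (\<phi> s \<otimes>\<^bsub>L\<^esub> \<phi> s)" using x(2) d by (simp add: hom)
      moreover have "\<phi> d \<in> {\<one>\<^bsub>L\<^esub>, \<phi> e, \<phi> p, \<phi> e \<otimes>\<^bsub>L\<^esub> \<phi> p}" using d(1) K.params by (auto simp: hom)
      ultimately show ?thesis using d(2) by blast
    qed
    fix w assume "w \<in> \<phi> ` carrier K"
    then obtain y where y: "y \<in> carrier K" "w = \<phi> y" by blast
    have "u \<otimes>\<^bsub>L\<^esub> u \<ominus>\<^bsub>L\<^esub> \<phi> e \<otimes>\<^bsub>L\<^esub> (w \<otimes>\<^bsub>L\<^esub> w) = \<phi> (x \<otimes>\<^bsub>K\<^esub> x \<ominus>\<^bsub>K\<^esub> e \<otimes>\<^bsub>K\<^esub> (y \<otimes>\<^bsub>K\<^esub> y))"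
      using x y K.params by (simp add: diff hom)
    then show "u \<otimes>\<^bsub>L\<^esub> u \<ominus>\<^bsub>L\<^esub> \<phi> e \<otimes>\<^bsub>L\<^esub> (w \<otimes>\<^bsub>L\<^esub> w) \<noteq> \<phi> p"
      using K.p_not_norm[OF x(1) y(1)] x(1) y(1) K.params
        eq[of "x \<otimes>\<^bsub>K\<^esub> x \<ominus>\<^bsub>K\<^esub> e \<otimes>\<^bsub>K\<^esub> (y \<otimes>\<^bsub>K\<^esub> y)" p] by simp
  qed
qed

text \<open>The last adjoined square is the element \<open>(t0 + t1 i) \<surd>p\<close> of the
  middle stage. Elements are octuples of elements of \<open>K\<close>.\<close>

definition octic_tower ::
    "('a, 'm) ring_scheme \<Rightarrow> 'a \<Rightarrow> 'a \<Rightarrow> 'a \<Rightarrow> ((('a \<times> 'a) \<times> 'a \<times> 'a) \<times> ('a \<times> 'a) \<times> 'a \<times> 'a) ring" where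
  "octic_tower K p t0 t1 =
     quadratic_extension
       (quadratic_extension (quadratic_extension K (\<ominus>\<^bsub>K\<^esub> \<one>\<^bsub>K\<^esub>)) (p, \<zero>\<^bsub>K\<^esub>))
       ((\<zero>\<^bsub>K\<^esub>, \<zero>\<^bsub>K\<^esub>), (t0, t1))"

definition tower_hom :: "('b, 'n) ring_scheme \<Rightarrow> ('a \<Rightarrow> 'b) \<Rightarrow> 'b \<Rightarrow> 'b \<Rightarrow> 'b \<Rightarrow>
    ((('a \<times> 'a) \<times> 'a \<times> 'a) \<times> ('a \<times> 'a) \<times> 'a \<times> 'a) \<Rightarrow> 'b" where
  "tower_hom B \<psi> i r y = adjoin_hom B (adjoin_hom B (adjoin_hom B \<psi> i) r) y"

definition tower_embedding :: "('a, 'm) ring_scheme \<Rightarrow> 'a \<Rightarrow> (('a \<times> 'a) \<times> 'a \<times> 'a) \<times> ('a \<times> 'a) \<times> 'a \<times> 'a" where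
  "tower_embedding K x = (((x, \<zero>\<^bsub>K\<^esub>), (\<zero>\<^bsub>K\<^esub>, \<zero>\<^bsub>K\<^esub>)), ((\<zero>\<^bsub>K\<^esub>, \<zero>\<^bsub>K\<^esub>), (\<zero>\<^bsub>K\<^esub>, \<zero>\<^bsub>K\<^esub>)))"

definition tower_generators ::
    "('a, 'm) ring_scheme \<Rightarrow> 'a \<Rightarrow> 'a \<Rightarrow> 'a \<Rightarrow> ('b, 'n) ring_scheme \<Rightarrow> ('a \<Rightarrow> 'b) \<Rightarrow> 'b \<Rightarrow> 'b \<Rightarrow> 'b \<Rightarrow> bool" where
  "tower_generators K p t0 t1 L \<phi> i r y \<longleftrightarrow>
     i \<in> carrier L \<and> r \<in> carrier L \<and> y \<in> carrier L \<and> i \<otimes>\<^bsub>L\<^esub> i = \<ominus>\<^bsub>L\<^esub> \<one>\<^bsub>L\<^esub> \<and> r \<otimes>\<^bsub>L\<^esub> r = \<phi> p \<and>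
     y \<otimes>\<^bsub>L\<^esub> y = (\<phi> t0 \<oplus>\<^bsub>L\<^esub> \<phi> t1 \<otimes>\<^bsub>L\<^esub> i) \<otimes>\<^bsub>L\<^esub> r"

text \<open>The two equations express \<open>(u + w \<surd>d)^2 = t \<surd>d\<close>. The first
  gives \<open>d w^2 = - u^2 = (i u)^2\<close>, and \<open>w\<close> is nonzero by the second, so
  \<open>d\<close> would be the square of \<open>i u / w\<close>.\<close>

lemma (in field) two_step_nonsquare:
  assumes two: "\<one> \<oplus> \<one> \<noteq> \<zero>" and i: "i \<in> carrier R" "i \<otimes> i = \<ominus> \<one>"
    and d: "d \<in> carrier R" "\<And>x. x \<in> carrier R \<Longrightarrow> x \<otimes> x \<noteq> d" and t: "t \<noteq> \<zero>"
    and u: "u \<in> carrier R" and w: "w \<in> carrier R" and 1: "u \<otimes> u \<oplus> d \<otimes> (w \<otimes> w) = \<zero>" and 2: "u \<otimes> w \<oplus> w \<otimes> u = t"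
  shows False
proof -
  have w0: "w \<noteq> \<zero>" using 2 t u by auto
  note iw = nonzero_inv[OF w w0]
  have dw: "d \<otimes> (w \<otimes> w) = \<ominus> (u \<otimes> u)" using 1 u w d by (metis a_comm m_closed minus_equality)
  have "(i \<otimes> u \<otimes> inv w) \<otimes> (i \<otimes> u \<otimes> inv w) = (i \<otimes> i) \<otimes> (u \<otimes> u) \<otimes> (inv w \<otimes> inv w)"
    using i(1) u iw(1) by algebra
  also have "\<dots> = d \<otimes> (w \<otimes> w) \<otimes> (inv w \<otimes> inv w)" unfolding i(2) dw using u iw(1) by algebra
  also have "\<dots> = d \<otimes> ((w \<otimes> inv w) \<otimes> (w \<otimes> inv w))" using d(1) w iw(1) by algebra
  also have "\<dots> = d" using iw(2) d(1) by simp
  finally show False using d(2)[of "i \<otimes> u \<otimes> inv w"] i u iw by simp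
qed

lemma adjoin_hom_image:
  "adjoin_hom B \<psi> y ` (S \<times> S) = {s \<oplus>\<^bsub>B\<^esub> t \<otimes>\<^bsub>B\<^esub> y | s t. s \<in> \<psi> ` S \<and> t \<in> \<psi> ` S}"
  by (auto simp: adjoin_hom_def image_iff)

context
  fixes K :: "('a, 'm) ring_scheme" (structure) and p a b t0 t1 :: 'a
  assumes K: "square_classes K (carrier K) (\<ominus> \<one>) p a b \<one>"
    and t: "t0 \<in> carrier K" "t1 \<in> carrier K" "t0 \<noteq> \<zero> \<or> t1 \<noteq> \<zero>"
begin

interpretation K: square_classes K "carrier K" "\<ominus> \<one>" p a b "\<one>"
  by (rule K)

abbreviation "Q1 \<equiv> quadratic_extension K (\<ominus> \<one>)"
abbreviation "Q2 \<equiv> quadratic_extension Q1 (p, \<zero>)"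

lemma field_Q1: "field Q1"
  using K.quadratic_extension_field[of "\<ominus> \<one>"] K.e_nonsquare by simp

lemma p_nonsquare_Q1: "x \<in> carrier Q1 \<Longrightarrow> x \<otimes>\<^bsub>Q1\<^esub> x \<noteq> (p, \<zero>)"
proof
  assume "x \<in> carrier Q1" "x \<otimes>\<^bsub>Q1\<^esub> x = (p, \<zero>)"
  then obtain s u where su: "s \<in> carrier K" "u \<in> carrier K"
    "s \<otimes> s \<oplus> \<ominus> \<one> \<otimes> (u \<otimes> u) = p" "s \<otimes> u \<oplus> u \<otimes> s = \<zero>"
    by (cases x) (auto simp: quadratic_extension_simps)
  have "(\<one> \<oplus> \<one>) \<otimes> (s \<otimes> u) = \<zero>"
    using su(1,2,4) by (simp add: K.l_distr K.r_distr K.m_comm)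
  then have "s = \<zero> \<or> u = \<zero>" using K.two_nonzero su(1,2) by (simp add: K.integral_iff)
  then show False
  proof
    assume "u = \<zero>"
    then show False using su K.params K.p_not_norm[of s "\<zero>"] by (simp add: K.minus_eq)
  next
    assume "s = \<zero>"
    then have pu: "p = \<ominus> \<one> \<otimes> (u \<otimes> u)" using su by simp
    \<comment> \<open>Since \<open>a^2 + b^2 = -1\<close>, also \<open>- u^2\<close> is a norm,
      namely that of \<open>u (a + b i)\<close>; so \<open>p\<close> is neither a square nor minus a
      square.\<close>
    have "(a \<otimes> u) \<otimes> (a \<otimes> u) \<ominus> \<ominus> \<one> \<otimes> ((b \<otimes> u) \<otimes> (b \<otimes> u))
        = (a \<otimes> a \<ominus> \<ominus> \<one> \<otimes> (b \<otimes> b)) \<otimes> (u \<otimes> u)"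
      using su(2) K.params(3,4) by algebra
    also have "\<dots> = p" unfolding K.norm_class pu using su(2) by simp
    finally show False
      using K.p_not_norm[of "a \<otimes> u" "b \<otimes> u"] su(2) K.params(3,4) by simp
  qed
qed

lemma field_Q2: "field Q2"
  using field.quadratic_extension_field[OF field_Q1, of "(p, \<zero>)"] p_nonsquare_Q1 K.params
  by (simp add: quadratic_extension_simps)

lemma field_octic_tower: "field (octic_tower K p t0 t1)"
  unfolding octic_tower_def
proof (rule field.quadratic_extension_field[OF field_Q2])
  show "((\<zero>, \<zero>), (t0, t1)) \<in> carrier Q2" using t by (simp add: quadratic_extension_simps)
  fix x assume "x \<in> carrier Q2"
  then obtain u w where x: "x = (u, w)" "u \<in> carrier Q1" "w \<in> carrier Q1"
    by (auto simp: quadratic_extension_simps)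
  interpret Q1: field Q1 by (rule field_Q1)
  have two: "\<one>\<^bsub>Q1\<^esub> \<oplus>\<^bsub>Q1\<^esub> \<one>\<^bsub>Q1\<^esub> \<noteq> \<zero>\<^bsub>Q1\<^esub>"
    using K.two_nonzero by (simp add: quadratic_extension_simps)
  have m1: "\<ominus>\<^bsub>Q1\<^esub> \<one>\<^bsub>Q1\<^esub> = (\<ominus> \<one>, \<zero>)"
    by (rule Q1.minus_equality) (auto simp: quadratic_extension_simps K.l_neg)
  show "x \<otimes>\<^bsub>Q2\<^esub> x \<noteq> ((\<zero>, \<zero>), (t0, t1))"
  proof
    assume *: "x \<otimes>\<^bsub>Q2\<^esub> x = ((\<zero>, \<zero>), (t0, t1))"
    show False
    proof (rule Q1.two_step_nonsquare[OF two, of "(\<zero>, \<one>)" "(p, \<zero>)" "(t0, t1)" u w])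
      show "u \<otimes>\<^bsub>Q1\<^esub> u \<oplus>\<^bsub>Q1\<^esub> (p, \<zero>) \<otimes>\<^bsub>Q1\<^esub> (w \<otimes>\<^bsub>Q1\<^esub> w) = \<zero>\<^bsub>Q1\<^esub>"
        "u \<otimes>\<^bsub>Q1\<^esub> w \<oplus>\<^bsub>Q1\<^esub> w \<otimes>\<^bsub>Q1\<^esub> u = (t0, t1)"
        using * unfolding x quadratic_extension_simps(2)[of Q1] quadratic_extension_simps(4) by simp_all
      show "(\<zero>, \<one>) \<otimes>\<^bsub>Q1\<^esub> (\<zero>, \<one>) = \<ominus>\<^bsub>Q1\<^esub> \<one>\<^bsub>Q1\<^esub>"
        unfolding m1 by (simp add: quadratic_extension_simps)
    qed (use p_nonsquare_Q1 x t K.params in \<open>auto simp: quadratic_extension_simps\<close>)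
  qed
qed

text \<open>The universal property of the whole tower, from three applications of
  \<open>adjoin_hom\<close>. It supplies automorphisms when \<open>B\<close> is the tower itself and
  isomorphisms between different extensions.\<close>

lemma tower_hom:
  assumes B: "field B" and \<psi>: "\<psi> \<in> ring_hom K B" and gens: "tower_generators K p t0 t1 B \<psi> i r y"
  shows "tower_hom B \<psi> i r y \<in> ring_hom (octic_tower K p t0 t1) B"
    "x \<in> carrier K \<Longrightarrow> tower_hom B \<psi> i r y (tower_embedding K x) = \<psi> x"
    "tower_hom B \<psi> i r y (((\<zero>, \<one>), (\<zero>, \<zero>)), ((\<zero>, \<zero>), (\<zero>, \<zero>))) = i"
    "tower_hom B \<psi> i r y (((\<zero>, \<zero>), (\<one>, \<zero>)), ((\<zero>, \<zero>), (\<zero>, \<zero>))) = r"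
    "tower_hom B \<psi> i r y (((\<zero>, \<zero>), (\<zero>, \<zero>)), ((\<one>, \<zero>), (\<zero>, \<zero>))) = y"
proof -
  interpret B: field B by (rule B)
  interpret \<psi>: ring_hom_ring K B \<psi> by (rule ring_hom_ringI2[OF K.ring_axioms B.ring_axioms \<psi>])
  have g: "i \<in> carrier B" "r \<in> carrier B" "y \<in> carrier B" "i \<otimes>\<^bsub>B\<^esub> i = \<ominus>\<^bsub>B\<^esub> \<one>\<^bsub>B\<^esub>" "r \<otimes>\<^bsub>B\<^esub> r = \<psi> p"
    "y \<otimes>\<^bsub>B\<^esub> y = (\<psi> t0 \<oplus>\<^bsub>B\<^esub> \<psi> t1 \<otimes>\<^bsub>B\<^esub> i) \<otimes>\<^bsub>B\<^esub> r"
    using gens by (auto simp: tower_generators_def)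
  have 1: "adjoin_hom B \<psi> i \<in> ring_hom Q1 B"
    by (rule B.adjoin_hom[OF K.is_cring \<psi>]) (use g in simp_all)
  have 2: "adjoin_hom B (adjoin_hom B \<psi> i) r \<in> ring_hom Q2 B"
    by (rule B.adjoin_hom[OF field.axioms(1)[OF field_Q1, THEN domain.axioms(1)] 1])
      (use g K.params in \<open>simp_all add: quadratic_extension_simps adjoin_hom_def\<close>)
  show "tower_hom B \<psi> i r y \<in> ring_hom (octic_tower K p t0 t1) B"
    unfolding tower_hom_def octic_tower_def
    by (rule B.adjoin_hom[OF field.axioms(1)[OF field_Q2, THEN domain.axioms(1)] 2])
      (use g t in \<open>simp_all add: quadratic_extension_simps adjoin_hom_def\<close>)
  show "x \<in> carrier K \<Longrightarrow> tower_hom B \<psi> i r y (tower_embedding K x) = \<psi> x"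
    using g by (simp add: tower_hom_def tower_embedding_def adjoin_hom_def)
  show "tower_hom B \<psi> i r y (((\<zero>, \<one>), (\<zero>, \<zero>)), ((\<zero>, \<zero>), (\<zero>, \<zero>))) = i"
    "tower_hom B \<psi> i r y (((\<zero>, \<zero>), (\<one>, \<zero>)), ((\<zero>, \<zero>), (\<zero>, \<zero>))) = r"
    "tower_hom B \<psi> i r y (((\<zero>, \<zero>), (\<zero>, \<zero>)), ((\<one>, \<zero>), (\<zero>, \<zero>))) = y"
    using g by (simp_all add: tower_hom_def adjoin_hom_def)
qed

abbreviation tower_span :: "('b, 'n) ring_scheme \<Rightarrow> ('a \<Rightarrow> 'b) \<Rightarrow> 'b \<Rightarrow> 'b \<Rightarrow> 'b \<Rightarrow> 'b set" where
  "tower_span B \<psi> i r y \<equiv> field.pair_span B (field.pair_span B (field.pair_span B (\<psi> ` carrier K) i) r) y"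

lemma tower_hom_image:
  assumes "field B"
  shows "tower_hom B \<psi> i r y ` carrier (octic_tower K p t0 t1) = tower_span B \<psi> i r y"
proof -
  interpret B: field B by (rule assms)
  show ?thesis
    by (simp add: octic_tower_def quadratic_extension_simps tower_hom_def adjoin_hom_image flip: B.pair_span_def)
qed

lemma tower_hom_iso:
  assumes B: "field B" and \<psi>: "\<psi> \<in> ring_hom K B" and gens: "tower_generators K p t0 t1 B \<psi> i r y"
    and span: "carrier B = tower_span B \<psi> i r y"
  shows "tower_hom B \<psi> i r y \<in> ring_iso (octic_tower K p t0 t1) B"
proof -
  have "inj_on (tower_hom B \<psi> i r y) (carrier (octic_tower K p t0 t1))"
    using non_trivial_field_hom_is_inj[OF tower_hom(1)[OF B \<psi> gens] field_octic_tower B] .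
  then show ?thesis
    using tower_hom(1)[OF B \<psi> gens] tower_hom_image[OF B, of \<psi> i r y] span
    by (simp add: ring_iso_def bij_betw_def)
qed

lemma octic_extensionI:
  assumes B: "field B" and \<psi>: "\<psi> \<in> ring_hom K B" and gens: "tower_generators K p t0 t1 B \<psi> i r y"
    and span: "carrier B = tower_span B \<psi> i r y"
    and c: "c0 \<in> carrier K" "c1 \<in> carrier K"
    and twist: "(\<psi> c0 \<oplus>\<^bsub>B\<^esub> \<psi> c1 \<otimes>\<^bsub>B\<^esub> i) \<otimes>\<^bsub>B\<^esub> (\<psi> c0 \<oplus>\<^bsub>B\<^esub> \<psi> c1 \<otimes>\<^bsub>B\<^esub> i) \<otimes>\<^bsub>B\<^esub> (\<psi> t0 \<oplus>\<^bsub>B\<^esub> \<psi> t1 \<otimes>\<^bsub>B\<^esub> i)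
      = \<psi> t0 \<ominus>\<^bsub>B\<^esub> \<psi> t1 \<otimes>\<^bsub>B\<^esub> i"
    and twist_norm: "(\<psi> c0 \<oplus>\<^bsub>B\<^esub> \<psi> c1 \<otimes>\<^bsub>B\<^esub> i) \<otimes>\<^bsub>B\<^esub> (\<psi> c0 \<ominus>\<^bsub>B\<^esub> \<psi> c1 \<otimes>\<^bsub>B\<^esub> i)
      = (if tw then \<ominus>\<^bsub>B\<^esub> \<one>\<^bsub>B\<^esub> else \<one>\<^bsub>B\<^esub>)"
  shows "octic_extension B (\<psi> ` carrier K) (\<psi> p) (\<psi> t0) (\<psi> t1) (\<psi> c0) (\<psi> c1) i r y tw"
proof -
  interpret B: field B by (rule B)
  interpret Q: field "octic_tower K p t0 t1" by (rule field_octic_tower)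
  interpret S: square_classes B "\<psi> ` carrier K" "\<psi> (\<ominus> \<one>)" "\<psi> p" "\<psi> a" "\<psi> b" "\<psi> \<one>"
    by (rule square_classes_hom_image[OF K B \<psi>])
  let ?Y = "((((\<zero>, \<zero>), (\<zero>, \<zero>)), ((\<one>, \<zero>), (\<zero>, \<zero>))))"
  let ?\<Psi> = "tower_hom B \<psi> i r y"
  let ?C = "carrier (octic_tower K p t0 t1)"
  note iso = tower_hom_iso[OF B \<psi> gens span]
  have inj: "inj_on ?\<Psi> ?C" using iso by (simp add: ring_iso_def bij_betw_def)
  have mem: "tower_embedding K x \<in> ?C" if "x \<in> carrier K" for x
    using that by (simp add: octic_tower_def quadratic_extension_simps tower_embedding_def)
  have memI: "((((\<zero>, \<one>), (\<zero>, \<zero>)), ((\<zero>, \<zero>), (\<zero>, \<zero>)))) \<in> ?C"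
    "((((\<zero>, \<zero>), (\<one>, \<zero>)), ((\<zero>, \<zero>), (\<zero>, \<zero>)))) \<in> ?C" "?Y \<in> ?C"
    by (simp_all add: octic_tower_def quadratic_extension_simps)
  have "y \<noteq> \<zero>\<^bsub>B\<^esub>"
  proof
    assume "y = \<zero>\<^bsub>B\<^esub>"
    then have "?\<Psi> ?Y = ?\<Psi> \<zero>\<^bsub>octic_tower K p t0 t1\<^esub>"
      using tower_hom(5)[OF B \<psi> gens] ring_hom_zero[OF tower_hom(1)[OF B \<psi> gens] Q.ring_axioms B.ring_axioms] by simp
    then have "?Y = \<zero>\<^bsub>octic_tower K p t0 t1\<^esub>" using inj memI(3) by (auto simp: inj_on_def)
    then show False by (simp add: octic_tower_def quadratic_extension_simps)
  qed
  \<comment> \<open>Undo the isomorphism of the tower with \<open>B\<close> given by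
    \<open>i\<close>, \<open>r\<close>, \<open>y\<close>, then evaluate the tower at the other
    solution of the relations.\<close>
  moreover have "\<exists>f\<in>ring_hom B B. (\<forall>x\<in>\<psi> ` carrier K. f x = x) \<and> f i = i' \<and> f r = r' \<and> f y = y'"
    if "tower_generators K p t0 t1 B \<psi> i' r' y'" for i' r' y'
  proof (intro bexI[of _ "tower_hom B \<psi> i' r' y' \<circ> inv_into ?C ?\<Psi>"] conjI ballI)
    have cancel: "inv_into ?C ?\<Psi> (?\<Psi> x) = x" if "x \<in> ?C" for x using inj that by simp
    have inv_hom: "inv_into ?C ?\<Psi> \<in> ring_hom B (octic_tower K p t0 t1)"
      using ring_iso_set_sym[OF Q.ring_axioms iso] by (simp add: ring_iso_def)
    show "tower_hom B \<psi> i' r' y' \<circ> inv_into ?C ?\<Psi> \<in> ring_hom B B"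
      using ring_hom_trans[OF inv_hom tower_hom(1)[OF B \<psi> that]] .
    show "(tower_hom B \<psi> i' r' y' \<circ> inv_into ?C ?\<Psi>) u = u" if u: "u \<in> \<psi> ` carrier K" for u
      using u tower_hom(2)[OF B \<psi> gens] tower_hom(2)[OF B \<psi> \<open>tower_generators K p t0 t1 B \<psi> i' r' y'\<close>] cancel[OF mem] by force
    show "(tower_hom B \<psi> i' r' y' \<circ> inv_into ?C ?\<Psi>) i = i'"
      using tower_hom(3)[OF B \<psi> gens] tower_hom(3)[OF B \<psi> that] cancel[OF memI(1)] by simp
    show "(tower_hom B \<psi> i' r' y' \<circ> inv_into ?C ?\<Psi>) r = r'"
      using tower_hom(4)[OF B \<psi> gens] tower_hom(4)[OF B \<psi> that] cancel[OF memI(2)] by simp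
    show "(tower_hom B \<psi> i' r' y' \<circ> inv_into ?C ?\<Psi>) y = y'"
      using tower_hom(5)[OF B \<psi> gens] tower_hom(5)[OF B \<psi> that] cancel[OF memI(3)] by simp
  qed
  ultimately show ?thesis
    using gens t c twist twist_norm S.params(2) span S.subfield_k S.two_nonzero
    by (intro octic_extension.intro octic_extension_axioms.intro B) (simp_all add: tower_generators_def)
qed

lemma tower_G_extension:
  assumes B: "field B" and \<psi>: "\<psi> \<in> ring_hom K B"
    and oct: "octic_extension B (\<psi> ` carrier K) p' t0' t1' c0' c1' i r y tw"
  shows "G_extension (metacyclic8 tw) K B \<psi>"
proof -
  interpret O: octic_extension B "\<psi> ` carrier K" p' t0' t1' c0' c1' i r y tw by (rule oct)
  have gal: "galois_group K B \<psi> = O.fixing_group"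
    by (simp add: galois_group_def O.fixing_group_def)
  have "O.act ` carrier (metacyclic8 tw) = carrier O.fixing_group"
    using O.act_iso by (simp add: iso_def bij_betw_def)
  then have "{x \<in> carrier B. \<forall>\<sigma>\<in>carrier (galois_group K B \<psi>). \<sigma> x = x} \<subseteq> \<psi> ` carrier K"
    using O.fixed_by_act unfolding gal by blast
  moreover have "\<psi> ` carrier K \<subseteq> {x \<in> carrier B. \<forall>\<sigma>\<in>carrier (galois_group K B \<psi>). \<sigma> x = x}"
    using ring_hom_closed[OF \<psi>] by (auto simp: galois_group_def)
  moreover have "galois_group K B \<psi> \<cong> metacyclic8 tw"
    using iso_inv_into[OF O.act_iso metacyclic8_mult_closed] unfolding gal is_iso_def by blast
  ultimately show ?thesis
    using B \<psi> O.finite_dimension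
    by (auto simp: G_extension_def finite_galois_extension_def finite_extension_def)
qed

text \<open>The tower lives in a type of octuples; \<open>image_ring\<close> copies it along
  \<open>\<iota>\<close> into the type in which extensions are sought.\<close>

lemma tower_exists:
  assumes \<iota>: "inj_on \<iota> (carrier (octic_tower K p t0 t1))"
  defines "L \<equiv> image_ring \<iota> (octic_tower K p t0 t1)"
  shows "\<exists>\<phi> i r y. field L \<and> \<phi> \<in> ring_hom K L \<and> tower_generators K p t0 t1 L \<phi> i r y \<and>
    carrier L = tower_span L \<phi> i r y"
proof -
  let ?Q = "octic_tower K p t0 t1"
  let ?I = "((((\<zero>, \<one>), (\<zero>, \<zero>)), ((\<zero>, \<zero>), (\<zero>, \<zero>))))"
  let ?R = "((((\<zero>, \<zero>), (\<one>, \<zero>)), ((\<zero>, \<zero>), (\<zero>, \<zero>))))"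
  let ?Y = "((((\<zero>, \<zero>), (\<zero>, \<zero>)), ((\<one>, \<zero>), (\<zero>, \<zero>))))"
  interpret Q: field ?Q by (rule field_octic_tower)
  have L: "field L" unfolding L_def by (rule Q.inj_imp_image_ring_is_field[OF \<iota>])
  interpret L: field L by (rule L)
  have iso: "\<iota> \<in> ring_iso ?Q L" unfolding L_def by (rule inj_imp_image_ring_iso[OF \<iota>])
  then have hom: "\<iota> \<in> ring_hom ?Q L" by (simp add: ring_iso_def)
  interpret \<iota>: ring_hom_ring ?Q L \<iota> by (rule ring_hom_ringI2[OF Q.ring_axioms L.ring_axioms hom])
  note simps = octic_tower_def quadratic_extension_simps tower_embedding_def
  have mem: "?I \<in> carrier ?Q" "?R \<in> carrier ?Q" "?Y \<in> carrier ?Q"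
    "\<And>x. x \<in> carrier K \<Longrightarrow> tower_embedding K x \<in> carrier ?Q"
    by (simp_all add: simps)
  have emb: "tower_embedding K \<in> ring_hom K ?Q"
    using t(1,2) K.params by (intro ring_hom_memI) (simp_all add: simps)
  have \<phi>: "\<iota> \<circ> tower_embedding K \<in> ring_hom K L"
    using ring_hom_trans[OF emb hom] .
  have m1: "\<ominus>\<^bsub>?Q\<^esub> \<one>\<^bsub>?Q\<^esub> = tower_embedding K (\<ominus> \<one>)"
    using t(1,2) by (intro Q.minus_equality) (simp_all add: simps K.l_neg K.params)
  have II: "?I \<otimes>\<^bsub>?Q\<^esub> ?I = \<ominus>\<^bsub>?Q\<^esub> \<one>\<^bsub>?Q\<^esub>" unfolding m1 using t(1,2) by (simp add: simps K.params)
  have RR: "?R \<otimes>\<^bsub>?Q\<^esub> ?R = tower_embedding K p" using t(1,2) by (simp add: simps K.params)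
  have YY: "?Y \<otimes>\<^bsub>?Q\<^esub> ?Y = (tower_embedding K t0 \<oplus>\<^bsub>?Q\<^esub> tower_embedding K t1 \<otimes>\<^bsub>?Q\<^esub> ?I) \<otimes>\<^bsub>?Q\<^esub> ?R"
    using t(1,2) by (simp add: simps K.params)
  have gens: "tower_generators K p t0 t1 L (\<iota> \<circ> tower_embedding K) (\<iota> ?I) (\<iota> ?R) (\<iota> ?Y)"
  proof -
    have "\<iota> ?I \<otimes>\<^bsub>L\<^esub> \<iota> ?I = \<ominus>\<^bsub>L\<^esub> \<one>\<^bsub>L\<^esub>"
      using arg_cong[OF II, of \<iota>] mem by (simp del: quadratic_extension_simps)
    moreover have "\<iota> ?R \<otimes>\<^bsub>L\<^esub> \<iota> ?R = \<iota> (tower_embedding K p)"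
      using arg_cong[OF RR, of \<iota>] mem by simp
    moreover have "\<iota> ?Y \<otimes>\<^bsub>L\<^esub> \<iota> ?Y
        = (\<iota> (tower_embedding K t0) \<oplus>\<^bsub>L\<^esub> \<iota> (tower_embedding K t1) \<otimes>\<^bsub>L\<^esub> \<iota> ?I) \<otimes>\<^bsub>L\<^esub> \<iota> ?R"
      using arg_cong[OF YY, of \<iota>] mem t by simp
    ultimately show ?thesis using mem by (simp add: tower_generators_def)
  qed
  \<comment> \<open>An octuple is the combination of products of the generators with its own entries
    as coefficients, so evaluation at the copied generators is \<open>\<iota>\<close>; surjectivity
    of \<open>\<iota>\<close> onto \<open>L\<close> then gives the span.\<close>
  have "tower_hom L (\<iota> \<circ> tower_embedding K) (\<iota> ?I) (\<iota> ?R) (\<iota> ?Y) x = \<iota> x" if x: "x \<in> carrier ?Q" for x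
  proof -
    obtain x1 x2 x3 x4 x5 x6 x7 x8 where
      xs: "x1 \<in> carrier K" "x2 \<in> carrier K" "x3 \<in> carrier K" "x4 \<in> carrier K"
        "x5 \<in> carrier K" "x6 \<in> carrier K" "x7 \<in> carrier K" "x8 \<in> carrier K"
      and x_eq: "x = (((x1, x2), (x3, x4)), ((x5, x6), (x7, x8)))"
      using x by (auto simp: simps)
    let ?e = "tower_embedding K"
    have eq: "x = ((?e x1 \<oplus>\<^bsub>?Q\<^esub> ?e x2 \<otimes>\<^bsub>?Q\<^esub> ?I) \<oplus>\<^bsub>?Q\<^esub> (?e x3 \<oplus>\<^bsub>?Q\<^esub> ?e x4 \<otimes>\<^bsub>?Q\<^esub> ?I) \<otimes>\<^bsub>?Q\<^esub> ?R) \<oplus>\<^bsub>?Q\<^esub>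
        ((?e x5 \<oplus>\<^bsub>?Q\<^esub> ?e x6 \<otimes>\<^bsub>?Q\<^esub> ?I) \<oplus>\<^bsub>?Q\<^esub> (?e x7 \<oplus>\<^bsub>?Q\<^esub> ?e x8 \<otimes>\<^bsub>?Q\<^esub> ?I) \<otimes>\<^bsub>?Q\<^esub> ?R) \<otimes>\<^bsub>?Q\<^esub> ?Y"
      using xs t(1,2) K.params by (simp add: x_eq simps)
    have "\<iota> x = ((\<iota> (?e x1) \<oplus>\<^bsub>L\<^esub> \<iota> (?e x2) \<otimes>\<^bsub>L\<^esub> \<iota> ?I) \<oplus>\<^bsub>L\<^esub> (\<iota> (?e x3) \<oplus>\<^bsub>L\<^esub> \<iota> (?e x4) \<otimes>\<^bsub>L\<^esub> \<iota> ?I) \<otimes>\<^bsub>L\<^esub> \<iota> ?R) \<oplus>\<^bsub>L\<^esub>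
        ((\<iota> (?e x5) \<oplus>\<^bsub>L\<^esub> \<iota> (?e x6) \<otimes>\<^bsub>L\<^esub> \<iota> ?I) \<oplus>\<^bsub>L\<^esub> (\<iota> (?e x7) \<oplus>\<^bsub>L\<^esub> \<iota> (?e x8) \<otimes>\<^bsub>L\<^esub> \<iota> ?I) \<otimes>\<^bsub>L\<^esub> \<iota> ?R) \<otimes>\<^bsub>L\<^esub> \<iota> ?Y"
      using mem xs by (subst eq) simp
    then show ?thesis unfolding x_eq by (simp add: tower_hom_def adjoin_hom_def)
  qed
  then have "tower_span L (\<iota> \<circ> tower_embedding K) (\<iota> ?I) (\<iota> ?R) (\<iota> ?Y) = \<iota> ` carrier ?Q"
    unfolding tower_hom_image[OF L, symmetric] by simp
  also have "\<dots> = carrier L" using iso by (simp add: ring_iso_def bij_betw_def)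
  finally show ?thesis using L \<phi> gens by metis
qed

end

section \<open>Existence and uniqueness\<close>

lemma (in field) ring_hom_compose_closed:
  assumes "f \<in> ring_hom R R" "g \<in> ring_hom R R"
  shows "compose (carrier R) f g \<in> ring_hom R R"
  using assms by (intro ring_hom_memI) (simp_all add: compose_eq endo)

lemma galois_group_mult:
  assumes "f \<in> carrier (galois_group K L \<phi>)" "g \<in> carrier (galois_group K L \<phi>)"
  shows "f \<otimes>\<^bsub>galois_group K L \<phi>\<^esub> g = compose (carrier L) f g"
  using assms by (simp add: galois_group_def BijGroup_def)

lemma galois_group_closed:
  assumes L: "field L" and \<phi>: "\<phi> \<in> ring_hom K L"
    and fg: "f \<in> carrier (galois_group K L \<phi>)" "g \<in> carrier (galois_group K L \<phi>)"
  shows "f \<otimes>\<^bsub>galois_group K L \<phi>\<^esub> g \<in> carrier (galois_group K L \<phi>)"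
proof -
  have "compose (carrier L) f g \<in> Bij (carrier L)"
    using fg by (intro compose_Bij) (simp_all add: galois_group_def)
  moreover have "compose (carrier L) f g \<in> ring_hom L L"
    using fg by (intro field.ring_hom_compose_closed[OF L]) (simp_all add: galois_group_def)
  moreover have "compose (carrier L) f g (\<phi> x) = \<phi> x" if "x \<in> carrier K" for x
    using fg that ring_hom_closed[OF \<phi> that] by (simp add: galois_group_def compose_eq)
  ultimately show ?thesis unfolding galois_group_mult[OF fg] by (simp add: galois_group_def)
qed

lemma G_extension_biquadratic_action:
  assumes S: "square_classes K (carrier K) e p a b m" and ext: "G_extension (metacyclic8 tw) K L \<phi>"
  shows "\<exists>z g h i r. biquadratic_action L (\<phi> ` carrier K) (\<phi> e) (\<phi> p) (\<phi> a) (\<phi> b) (\<phi> m) z g h i r"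
proof -
  let ?G = "galois_group K L \<phi>" and ?M = "metacyclic8 tw"
  have L: "field L" and \<phi>: "\<phi> \<in> ring_hom K L"
    and fix_eq: "{x \<in> carrier L. \<forall>\<sigma>\<in>carrier ?G. \<sigma> x = x} = \<phi> ` carrier K"
    and "?G \<cong> ?M"
    using ext by (simp_all add: G_extension_def finite_galois_extension_def finite_extension_def)
  interpret L: field L by (rule L)
  obtain f where f: "f \<in> iso ?G ?M" using \<open>?G \<cong> ?M\<close> by (auto simp: is_iso_def)
  define F where "F = inv_into (carrier ?G) f"
  have F: "F \<in> iso ?M ?G" unfolding F_def by (rule iso_inv_into[OF f galois_group_closed[OF L \<phi>]])
  have surj: "F ` carrier ?M = carrier ?G" and inj: "inj_on F (carrier ?M)"
    using F by (auto simp: iso_def bij_betw_def)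
  have mem: "F w \<in> carrier ?G" if "w \<in> carrier ?M" for w using surj that by blast
  have hom: "F w \<in> ring_hom L L" "F w \<in> extensional (carrier L)" if "w \<in> carrier ?M" for w
    using mem[OF that] by (simp_all add: galois_group_def Bij_def)
  have fix_k: "F w x = x" if "w \<in> carrier ?M" "x \<in> \<phi> ` carrier K" for w x
    using mem[OF that(1)] that(2) by (auto simp: galois_group_def)
  have comp: "F w (F w' x) = F (w \<otimes>\<^bsub>?M\<^esub> w') x"
    if "w \<in> carrier ?M" "w' \<in> carrier ?M" "x \<in> carrier L" for w w' x
  proof -
    have "F (w \<otimes>\<^bsub>?M\<^esub> w') = compose (carrier L) (F w) (F w')"
      using F that mem galois_group_mult[of "F w" K L \<phi> "F w'"] by (simp add: iso_def hom_def)
    then show ?thesis using that by (simp add: compose_eq)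
  qed
  have cM: "(n, s) \<in> carrier ?M \<longleftrightarrow> 0 \<le> n \<and> n < 4" for n s by (auto simp: carrier_metacyclic8)
  have inj_F: "x = x'" if "w \<in> carrier ?M" "x \<in> carrier L" "x' \<in> carrier L" "F w x = F w x'" for w x x'
    using mem[OF that(1)] that(2-4) by (auto simp: galois_group_def Bij_def bij_betw_def inj_on_def)
  \<comment> \<open>\<open>F (0, False)\<close> is idempotent and injective, hence the identity on
    \<open>L\<close>.\<close>
  have F_one: "F (0, False) x = x" if x: "x \<in> carrier L" for x
    using inj_F[of "(0, False)" "F (0, False) x" x] comp[of "(0, False)" "(0, False)" x] x hom(1)[of "(0, False)"]
    by (simp add: cM mult_metacyclic8 L.endo)
  \<comment> \<open>The choice is \<open>z = \<rho>^2\<close>, \<open>g = \<sigma>\<close>,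
    \<open>h = \<rho>\<close>: the commutator relation reads
    \<open>\<sigma> \<rho> = \<rho> \<sigma> \<rho>^2\<close>, which holds in both groups.\<close>
  have act: "klein_action L (\<phi> ` carrier K) (\<phi> e) (\<phi> p) (\<phi> a) (\<phi> b) (\<phi> m) (F (2, False)) (F (0, True)) (F (1, False))"
  proof (intro klein_action.intro klein_action_axioms.intro square_classes_hom_image[OF S L \<phi>])
    show "F (2, False) \<in> ring_hom L L" "F (0, True) \<in> ring_hom L L" "F (1, False) \<in> ring_hom L L"
      by (simp_all add: hom cM)
    show "F (2, False) x = x" "F (0, True) x = x" "F (1, False) x = x" if "x \<in> \<phi> ` carrier K" for x
      using fix_k[OF _ that] by (simp_all add: cM)
    show "F (2, False) (F (2, False) x) = x" if "x \<in> carrier L" for x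
      using that by (simp add: comp cM mult_metacyclic8 F_one)
    show "F (2, False) (F (0, True) x) = F (0, True) (F (2, False) x)"
      "F (2, False) (F (1, False) x) = F (1, False) (F (2, False) x)" if "x \<in> carrier L" for x
      using that by (simp_all add: comp cM mult_metacyclic8)
    show "F (0, True) (F (0, True) x) = x" "F (1, False) (F (1, False) x) = x"
      if "x \<in> carrier L" "F (2, False) x = x" for x
      using that by (simp_all add: comp cM mult_metacyclic8 F_one)
    show "F (0, True) (F (1, False) x) = F (1, False) (F (0, True) (F (2, False) x))" if "x \<in> carrier L" for x
    proof -
      have "F (2, False) x \<in> carrier L" using that hom(1)[of "(2, False)"] by (simp add: cM L.endo)
      then have "F (1, False) (F (0, True) (F (2, False) x)) = F (1, True) (F (2, False) x)"
        by (simp add: comp cM mult_metacyclic8)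
      then show ?thesis using that by (simp add: comp cM mult_metacyclic8)
    qed
    show "\<exists>x\<in>carrier L. F (2, False) x \<noteq> x"
    proof (rule ccontr)
      assume "\<not> ?thesis"
      then have "F (2, False) = F (0, False)"
        using hom(2)[of "(2, False)"] hom(2)[of "(0, False)"] F_one
        by (intro extensionalityI[of _ "carrier L"]) (auto simp: cM)
      then show False using inj_onD[OF inj, of "(2, False)" "(0, False)"] by (simp add: cM)
    qed
    fix x assume x: "x \<in> carrier L" "F (2, False) x = x" "F (0, True) x = x" "F (1, False) x = x"
    have "F w x = x" if w: "w \<in> carrier ?M" for w
    proof -
      obtain n s where ns: "w = (n, s)" "n \<in> {0, 1, 2, 3}"
        using w unfolding carrier_metacyclic8 atLeastLessThan_0_4 by blast
      have "F (3, False) x = x"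
        using comp[of "(1, False)" "(2, False)" x] x by (simp add: cM mult_metacyclic8)
      then have n: "F (n, False) x = x" using ns(2) x F_one[OF x(1)] by auto
      show ?thesis
      proof (cases s)
        case True
        have "F (n, False) (F (0, True) x) = F (n, True) x"
          using ns(2) x(1) by (subst comp) (auto simp: cM mult_metacyclic8)
        then show ?thesis using n x(3) ns(1) True by simp
      qed (use n ns in simp)
    qed
    then show "x \<in> \<phi> ` carrier K" unfolding fix_eq[symmetric] surj[symmetric] using x(1) by blast
  qed
  then obtain g' h' i r where
    "klein_action L (\<phi> ` carrier K) (\<phi> e) (\<phi> p) (\<phi> a) (\<phi> b) (\<phi> m) (F (2, False)) g' h'"
    "i \<in> carrier L" "r \<in> carrier L" "i \<otimes>\<^bsub>L\<^esub> i = \<phi> e" "r \<otimes>\<^bsub>L\<^esub> r = \<phi> p"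
    "F (2, False) i = i" "F (2, False) r = r"
    "g' i = \<ominus>\<^bsub>L\<^esub> i" "g' r = r" "h' i = i" "h' r = \<ominus>\<^bsub>L\<^esub> r"
    using klein_action.square_roots[OF act] by blast
  then show ?thesis
    by (intro exI biquadratic_action.intro biquadratic_action_axioms.intro)
qed

lemma no_metacyclic8_extension:
  assumes S: "square_classes K (carrier K) e p \<zero>\<^bsub>K\<^esub> \<one>\<^bsub>K\<^esub> m"
    and j: "j \<in> carrier K" "j \<otimes>\<^bsub>K\<^esub> j = \<ominus>\<^bsub>K\<^esub> \<one>\<^bsub>K\<^esub>"
  shows "\<not> G_extension (metacyclic8 tw) K L \<phi>"
proof
  assume ext: "G_extension (metacyclic8 tw) K L \<phi>"
  then have L: "field L" and \<phi>: "\<phi> \<in> ring_hom K L"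
    by (simp_all add: G_extension_def finite_galois_extension_def finite_extension_def)
  interpret K: square_classes K "carrier K" e p "\<zero>\<^bsub>K\<^esub>" "\<one>\<^bsub>K\<^esub>" m by (rule S)
  interpret L: field L by (rule L)
  interpret \<phi>: ring_hom_ring K L \<phi> by (rule ring_hom_ringI2[OF K.ring_axioms L.ring_axioms \<phi>])
  obtain z g h i r where action:
    "biquadratic_action L (\<phi> ` carrier K) (\<phi> e) (\<phi> p) (\<phi> \<zero>\<^bsub>K\<^esub>) (\<phi> \<one>\<^bsub>K\<^esub>) (\<phi> m) z g h i r"
    using G_extension_biquadratic_action[OF S ext] by blast
  have "\<phi> j \<otimes>\<^bsub>L\<^esub> \<phi> j = \<ominus>\<^bsub>L\<^esub> \<one>\<^bsub>L\<^esub>"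
    using arg_cong[OF j(2), of \<phi>] j(1) by simp
  then show False
    by (rule biquadratic_action.sqrt_neg_one_imp_False[OF action imageI[OF j(1)] _ \<phi>.hom_zero \<phi>.hom_one])
qed

text \<open>
  The square root \<open>y\<close> of \<open>\<theta> r\<close> generates the dihedral extension for \<open>\<theta> = 1\<close> and the quaternion
  extension for \<open>\<theta> = \<zeta> = a + b i\<close>, where \<open>a\<^sup>2 + b\<^sup>2 = -1\<close>.
\<close>

definition theta0 :: "('a, 'm) ring_scheme \<Rightarrow> 'a \<Rightarrow> bool \<Rightarrow> 'a" where
  "theta0 K a tw = (if tw then a else \<one>\<^bsub>K\<^esub>)"

definition theta1 :: "('a, 'm) ring_scheme \<Rightarrow> 'a \<Rightarrow> bool \<Rightarrow> 'a" where
  "theta1 K b tw = (if tw then b else \<zero>\<^bsub>K\<^esub>)"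

text \<open>With \<open>t = a + b i\<close> of norm -1 and conjugate \<open>t'\<close>, the element
  \<open>c = - i t'\<close> expands to \<open>- b - a i\<close>. Then
  \<open>c^2 t = - t' (t t') = t'\<close>, and the norm of \<open>c\<close> equals that of
  \<open>t\<close>, namely -1.\<close>

lemma (in cring) quaternion_twist:
  assumes c: "a \<in> carrier R" "b \<in> carrier R" "i \<in> carrier R" and ii: "i \<otimes> i = \<ominus> \<one>"
    and n: "a \<otimes> a \<oplus> b \<otimes> b = \<ominus> \<one>"
  shows "(\<ominus> b \<oplus> \<ominus> a \<otimes> i) \<otimes> (\<ominus> b \<oplus> \<ominus> a \<otimes> i) \<otimes> (a \<oplus> b \<otimes> i) = a \<ominus> b \<otimes> i"
    "(\<ominus> b \<oplus> \<ominus> a \<otimes> i) \<otimes> (\<ominus> b \<ominus> \<ominus> a \<otimes> i) = \<ominus> \<one>"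
proof -
  define t where "t = a \<oplus> b \<otimes> i"
  define t' where "t' = a \<ominus> b \<otimes> i"
  have tc: "t \<in> carrier R" "t' \<in> carrier R" using c by (simp_all add: t_def t'_def)
  have "\<ominus> (i \<otimes> t') = (i \<otimes> i) \<otimes> b \<oplus> \<ominus> a \<otimes> i" unfolding t'_def using c by algebra
  then have c1: "\<ominus> b \<oplus> \<ominus> a \<otimes> i = \<ominus> (i \<otimes> t')" using ii c by (simp add: l_minus)
  have "i \<otimes> t = (i \<otimes> i) \<otimes> b \<ominus> \<ominus> a \<otimes> i" unfolding t_def using c by algebra
  then have c2: "\<ominus> b \<ominus> \<ominus> a \<otimes> i = i \<otimes> t" using ii c by (simp add: l_minus)
  have "t \<otimes> t' = a \<otimes> a \<ominus> (i \<otimes> i) \<otimes> (b \<otimes> b)" unfolding t_def t'_def using c by algebra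
  then have tt: "t \<otimes> t' = \<ominus> \<one>" using ii n c by (simp add: l_minus minus_eq)
  have "\<ominus> (i \<otimes> t') \<otimes> \<ominus> (i \<otimes> t') \<otimes> t = (i \<otimes> i) \<otimes> (t \<otimes> t') \<otimes> t'" using c(3) tc by algebra
  also have "\<dots> = t'" unfolding ii tt using tc by (simp add: l_minus r_minus)
  finally show "(\<ominus> b \<oplus> \<ominus> a \<otimes> i) \<otimes> (\<ominus> b \<oplus> \<ominus> a \<otimes> i) \<otimes> (a \<oplus> b \<otimes> i) = a \<ominus> b \<otimes> i"
    unfolding c1 by (simp only: t_def t'_def)
  have "\<ominus> (i \<otimes> t') \<otimes> (i \<otimes> t) = \<ominus> ((i \<otimes> i) \<otimes> (t \<otimes> t'))" using c(3) tc by algebra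
  then show "(\<ominus> b \<oplus> \<ominus> a \<otimes> i) \<otimes> (\<ominus> b \<ominus> \<ominus> a \<otimes> i) = \<ominus> \<one>"
    unfolding c1 c2 ii tt by (simp add: l_minus r_minus)
qed

context
  fixes K :: "('a, 'm) ring_scheme" (structure) and p a b :: 'a
  assumes K: "square_classes K (carrier K) (\<ominus> \<one>) p a b \<one>"
begin

interpretation K: square_classes K "carrier K" "\<ominus> \<one>" p a b "\<one>"
  by (rule K)

abbreviation generates :: "bool \<Rightarrow> ('b, 'n) ring_scheme \<Rightarrow> ('a \<Rightarrow> 'b) \<Rightarrow> 'b \<Rightarrow> 'b \<Rightarrow> 'b \<Rightarrow> bool" where
  "generates tw L \<phi> i r y \<equiv>
     tower_generators K p (theta0 K a tw) (theta1 K b tw) L \<phi> i r y \<and> carrier L = tower_span K L \<phi> i r y"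

lemma norm_zeta: "a \<otimes> a \<oplus> b \<otimes> b = \<ominus> \<one>"
  using K.norm_class K.params(3,4) by (simp add: K.l_minus K.minus_eq)

lemma theta_closed:
  "theta0 K a tw \<in> carrier K" "theta1 K b tw \<in> carrier K"
  "theta0 K a tw \<noteq> \<zero> \<or> theta1 K b tw \<noteq> \<zero>"
proof -
  show "theta0 K a tw \<in> carrier K" "theta1 K b tw \<in> carrier K"
    using K.params by (simp_all add: theta0_def theta1_def)
  have "\<not> (a = \<zero> \<and> b = \<zero>)"
    using norm_zeta K.params(6) by (metis K.l_null K.l_zero K.zero_closed)
  then show "theta0 K a tw \<noteq> \<zero> \<or> theta1 K b tw \<noteq> \<zero>"
    by (auto simp: theta0_def theta1_def)
qed

lemma generates_G_extension:
  assumes L: "field L" and \<phi>: "\<phi> \<in> ring_hom K L" and gen: "generates tw L \<phi> i r y"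
  shows "G_extension (metacyclic8 tw) K L \<phi>"
proof -
  interpret L: field L by (rule L)
  interpret \<phi>: ring_hom_ring K L \<phi> by (rule ring_hom_ringI2[OF K.ring_axioms L.ring_axioms \<phi>])
  have ab: "a \<in> carrier K" "b \<in> carrier K" using K.params by auto
  have i: "i \<in> carrier L" "i \<otimes>\<^bsub>L\<^esub> i = \<ominus>\<^bsub>L\<^esub> \<one>\<^bsub>L\<^esub>" using gen by (auto simp: tower_generators_def)
  note octic = octic_extensionI[OF K theta_closed L \<phi> conjunct1[OF gen] conjunct2[OF gen]]
  show ?thesis
  proof (cases tw)
    case True
    have "\<phi> a \<otimes>\<^bsub>L\<^esub> \<phi> a \<oplus>\<^bsub>L\<^esub> \<phi> b \<otimes>\<^bsub>L\<^esub> \<phi> b = \<ominus>\<^bsub>L\<^esub> \<one>\<^bsub>L\<^esub>"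
      using arg_cong[OF norm_zeta, of \<phi>] ab by simp
    then show ?thesis
      using L.quaternion_twist[OF _ _ i, of "\<phi> a" "\<phi> b"] ab True
      \<comment> \<open>The twisting element is \<open>- b - a i\<close> from
        \<open>quaternion_twist\<close>; in the dihedral case, where \<open>\<theta> = 1\<close>, it
        is simply 1.\<close>
      by (intro tower_G_extension[OF K theta_closed[of tw] L \<phi> octic[of "\<ominus> b" "\<ominus> a"]])
        (simp_all add: theta0_def theta1_def)
  next
    case False
    then show ?thesis
      using i by (intro tower_G_extension[OF K theta_closed[of tw] L \<phi> octic[of "\<one>" "\<zero>"]])
        (simp_all add: theta0_def theta1_def L.minus_eq)
  qed
qed

lemma G_extension_generates:
  assumes ext: "G_extension (metacyclic8 tw) K L \<phi>"
  shows "\<exists>i r y. generates tw L \<phi> i r y"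
proof -
  have L: "field L" and \<phi>: "\<phi> \<in> ring_hom K L" and gal: "galois_group K L \<phi> \<cong> metacyclic8 tw"
    using ext by (simp_all add: G_extension_def finite_galois_extension_def finite_extension_def)
  interpret L: field L by (rule L)
  interpret \<phi>: ring_hom_ring K L \<phi> by (rule ring_hom_ringI2[OF K.ring_axioms L.ring_axioms \<phi>])
  obtain z g h i r where
    "biquadratic_action L (\<phi> ` carrier K) (\<phi> (\<ominus> \<one>)) (\<phi> p) (\<phi> a) (\<phi> b) (\<phi> \<one>) z g h i r"
    using G_extension_biquadratic_action[OF K ext] by blast
  then interpret A: biquadratic_action L "\<phi> ` carrier K" "\<phi> (\<ominus> \<one>)" "\<phi> p" "\<phi> a" "\<phi> b" "\<phi> \<one>" z g h i r .
  have e: "\<phi> (\<ominus> \<one>) = \<ominus>\<^bsub>L\<^esub> \<one>\<^bsub>L\<^esub>" by simp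
  obtain y where y: "y \<in> carrier L" "y \<noteq> \<zero>\<^bsub>L\<^esub>" "z y = \<ominus>\<^bsub>L\<^esub> y"
    "y \<otimes>\<^bsub>L\<^esub> y = r \<or> y \<otimes>\<^bsub>L\<^esub> y = A.\<zeta> \<otimes>\<^bsub>L\<^esub> r"
    using A.quadratic_generator_neg_one[OF e] by auto
  have span: "carrier L = tower_span K L \<phi> i r y"
  proof
    show "carrier L \<subseteq> tower_span K L \<phi> i r y" using A.decomposition[OF _ y(1-3)] by blast
    show "tower_span K L \<phi> i r y \<subseteq> carrier L"
      using A.k_closed A.i_closed A.r_closed y(1) by (intro L.pair_span_closed) auto
  qed
  \<comment> \<open>The value of \<open>y^2\<close> determines a type \<open>tw'\<close> that is not
    yet known to be the type \<open>tw\<close> of the given group. Computing the Galois group from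
    the generators and comparing with \<open>metacyclic8_not_iso\<close> forces
    \<open>tw' = tw\<close>.\<close>
  have "\<exists>tw'. generates tw' L \<phi> i r y"
    using y(4)
  proof
    assume "y \<otimes>\<^bsub>L\<^esub> y = r"
    then have "tower_generators K p (theta0 K a False) (theta1 K b False) L \<phi> i r y"
      using y(1) A.i_closed A.r_closed A.ii A.rr e by (simp add: tower_generators_def theta0_def theta1_def)
    then show ?thesis using span by blast
  next
    assume "y \<otimes>\<^bsub>L\<^esub> y = A.\<zeta> \<otimes>\<^bsub>L\<^esub> r"
    then have "tower_generators K p (theta0 K a True) (theta1 K b True) L \<phi> i r y"
      using y(1) A.i_closed A.r_closed A.ii A.rr e
      by (simp add: tower_generators_def theta0_def theta1_def A.\<zeta>_def)
    then show ?thesis using span by blast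
  qed
  then obtain tw' where gen: "generates tw' L \<phi> i r y" ..
  then have "galois_group K L \<phi> \<cong> metacyclic8 tw'"
    using generates_G_extension[OF L \<phi> gen] by (simp add: G_extension_def)
  then obtain f f' where ff: "f \<in> iso (galois_group K L \<phi>) (metacyclic8 tw)"
    "f' \<in> iso (galois_group K L \<phi>) (metacyclic8 tw')"
    using gal by (auto simp: is_iso_def)
  note inv = iso_inv_into[OF ff(1) galois_group_closed[OF L \<phi>]] iso_inv_into[OF ff(2) galois_group_closed[OF L \<phi>]]
  have "metacyclic8 tw \<cong> metacyclic8 tw'" "metacyclic8 tw' \<cong> metacyclic8 tw"
    using iso_set_trans[OF inv(1) ff(2)] iso_set_trans[OF inv(2) ff(1)] unfolding is_iso_def by blast+
  then have "tw = tw'" using metacyclic8_not_iso by (cases tw; cases tw') auto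
  then show ?thesis using gen by blast
qed

text \<open>Both fields are isomorphic over \<open>K\<close> to the same formal tower.\<close>

lemma generates_unique:
  assumes L: "field L" "\<phi> \<in> ring_hom K L" "generates tw L \<phi> i r y"
    and L': "field L'" "\<phi>' \<in> ring_hom K L'" "generates tw L' \<phi>' i' r' y'"
  shows "K_isomorphic K L \<phi> L' \<phi>'"
proof -
  let ?Q = "octic_tower K p (theta0 K a tw) (theta1 K b tw)"
  let ?f = "tower_hom L \<phi> i r y" and ?f' = "tower_hom L' \<phi>' i' r' y'"
  note tower = tower_hom_iso[OF K theta_closed] tower_hom(2)[OF K theta_closed] field_octic_tower[OF K theta_closed]
  have f: "?f \<in> ring_iso ?Q L" using tower(1)[OF L(1,2)] L(3) by blast
  have f': "?f' \<in> ring_iso ?Q L'" using tower(1)[OF L'(1,2)] L'(3) by blast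
  have inv_f: "inv_into (carrier ?Q) ?f \<in> ring_iso L ?Q"
    using ring_iso_set_sym[OF field.is_ring[OF tower(3)] f] .
  have "(?f' \<circ> inv_into (carrier ?Q) ?f) (\<phi> x) = \<phi>' x" if x: "x \<in> carrier K" for x
  proof -
    have "tower_embedding K x \<in> carrier ?Q"
      using x by (simp add: octic_tower_def quadratic_extension_simps tower_embedding_def)
    then have "inv_into (carrier ?Q) ?f (?f (tower_embedding K x)) = tower_embedding K x"
      using f by (intro inv_into_f_f) (simp_all add: ring_iso_def bij_betw_def)
    moreover have "?f (tower_embedding K x) = \<phi> x" using tower(2)[OF L(1,2) _ x] L(3) by blast
    moreover have "?f' (tower_embedding K x) = \<phi>' x" using tower(2)[OF L'(1,2) _ x] L'(3) by blast
    ultimately show ?thesis by simp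
  qed
  then show ?thesis
    using ring_iso_set_trans[OF inv_f f'] unfolding K_isomorphic_def by blast
qed

lemma metacyclic8_extension_unique:
  fixes \<iota> :: "(('a \<times> 'a) \<times> 'a \<times> 'a) \<times> ('a \<times> 'a) \<times> 'a \<times> 'a \<Rightarrow> 'b"
  assumes \<iota>: "inj_on \<iota> (carrier (octic_tower K p (theta0 K a tw) (theta1 K b tw)))"
  shows "\<exists>(L :: 'b ring) \<phi>. G_extension (metacyclic8 tw) K L \<phi> \<and>
    (\<forall>(L' :: 'b ring) \<phi>'. G_extension (metacyclic8 tw) K L' \<phi>' \<longrightarrow> K_isomorphic K L \<phi> L' \<phi>')"
proof -
  obtain L :: "'b ring" and \<phi> i r y where L: "field L" "\<phi> \<in> ring_hom K L" "generates tw L \<phi> i r y"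
    using tower_exists[OF K theta_closed \<iota>] by blast
  have "K_isomorphic K L \<phi> L' \<phi>'" if ext: "G_extension (metacyclic8 tw) K L' \<phi>'" for L' :: "'b ring" and \<phi>'
  proof -
    have L': "field L'" "\<phi>' \<in> ring_hom K L'"
      using ext by (simp_all add: G_extension_def finite_galois_extension_def finite_extension_def)
    obtain i' r' y' where "generates tw L' \<phi>' i' r' y'" using G_extension_generates[OF ext] by blast
    then show ?thesis by (rule generates_unique[OF L L'])
  qed
  then show ?thesis using generates_G_extension[OF L] by blast
qed

end

section \<open>Room for the tower in the target type\<close>

lemma (in discretely_valued_field) infinite_carrier: "infinite (carrier K)"
proof
  assume "finite (carrier K)"
  then have "finite (v ` (carrier K - {\<zero>}))" by simp
  then show False by (simp add: v_surj)
qed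

lemma inj_on_comp_map_prod:
  assumes f: "inj_on f (A \<times> A)" "f ` (A \<times> A) \<subseteq> A" and g: "inj_on g B" "g ` B \<subseteq> A"
  shows "inj_on (f \<circ> map_prod g g) (B \<times> B)" "(f \<circ> map_prod g g) ` (B \<times> B) \<subseteq> A"
proof -
  have sub: "map_prod g g ` (B \<times> B) \<subseteq> A \<times> A" using g(2) by (auto simp: map_prod_def)
  show "inj_on (f \<circ> map_prod g g) (B \<times> B)"
    by (rule comp_inj_on[OF map_prod_inj_on[OF g(1) g(1)] inj_on_subset[OF f(1) sub]])
  show "(f \<circ> map_prod g g) ` (B \<times> B) \<subseteq> A"
    using image_mono[OF sub, of f] f(2) unfolding image_comp[symmetric] by (rule subset_trans)
qed

text \<open>An infinite set absorbs its square. Iterating an injection of pairs three times packs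
  octuples into single elements of \<open>A\<close>, which \<open>\<iota>\<close> then carries to
  the target type.\<close>

lemma inj_on_octuples:
  fixes \<iota> :: "'a \<Rightarrow> 'b"
  assumes inf: "infinite A" and \<iota>: "inj_on \<iota> A"
  shows "\<exists>\<kappa> :: (('a \<times> 'a) \<times> 'a \<times> 'a) \<times> ('a \<times> 'a) \<times> 'a \<times> 'a \<Rightarrow> 'b.
    inj_on \<kappa> (((A \<times> A) \<times> (A \<times> A)) \<times> ((A \<times> A) \<times> (A \<times> A)))"
proof -
  have "( |A \<times> A|, |A| ) \<in> ordIso" using card_of_Times_same_infinite[OF inf] .
  then have "( |A \<times> A|, |A| ) \<in> ordLeq" by (rule ordIso_imp_ordLeq)
  then have "\<exists>f. inj_on f (A \<times> A) \<and> f ` (A \<times> A) \<subseteq> A" by (simp only: card_of_ordLeq)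
  then obtain f where f: "inj_on f (A \<times> A)" "f ` (A \<times> A) \<subseteq> A" by blast
  note step = inj_on_comp_map_prod[OF f]
  define f4 where "f4 = f \<circ> map_prod f f"
  define f8 where "f8 = f \<circ> map_prod f4 f4"
  have f4: "inj_on f4 ((A \<times> A) \<times> A \<times> A)" "f4 ` ((A \<times> A) \<times> A \<times> A) \<subseteq> A"
    unfolding f4_def by (rule step[OF f])+
  have "inj_on f8 (((A \<times> A) \<times> A \<times> A) \<times> (A \<times> A) \<times> A \<times> A)"
    "f8 ` (((A \<times> A) \<times> A \<times> A) \<times> (A \<times> A) \<times> A \<times> A) \<subseteq> A"
    unfolding f8_def by (rule step[OF f4])+
  then have "inj_on (\<iota> \<circ> f8) (((A \<times> A) \<times> A \<times> A) \<times> (A \<times> A) \<times> A \<times> A)"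
    using comp_inj_on inj_on_subset[OF \<iota>] by blast
  then show ?thesis by (intro exI[of _ "\<iota> \<circ> f8"])
qed

theorem proposition8p5:
  fixes K :: "('a, 'm) ring_scheme"
    and v :: "'a \<Rightarrow> int"
    and p q :: nat
  assumes K: "local_field K v"
    and p: "p = ring_characteristic (residue_field K v)" "p \<noteq> 2"
    and q: "q = order (residue_field K v)"
    and universe: "\<exists>\<iota> :: 'a \<Rightarrow> 'b. inj_on \<iota> (carrier K)"
  shows "((\<exists>(L :: 'b ring) \<phi>. G_extension dihedral8 K L \<phi> \<or> G_extension quaternion8 K L \<phi>)
            \<longleftrightarrow> [int q = -1] (mod 4))
       \<and> ([int q = -1] (mod 4) \<longrightarrow>
            (\<exists>(L :: 'b ring) \<phi>. G_extension dihedral8 K L \<phi> \<and>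
               (\<forall>(L' :: 'b ring) \<phi>'. G_extension dihedral8 K L' \<phi>' \<longrightarrow> K_isomorphic K L \<phi> L' \<phi>')) \<and>
            (\<exists>(L :: 'b ring) \<phi>. G_extension quaternion8 K L \<phi> \<and>
               (\<forall>(L' :: 'b ring) \<phi>'. G_extension quaternion8 K L' \<phi>' \<longrightarrow> K_isomorphic K L \<phi> L' \<phi>')))"
proof -
  interpret local_field K v by (rule K)
  have char: "ring_characteristic (residue_field K v) \<noteq> 2" using p by simp
  \<comment> \<open>Both groups become values of one family, so each remaining claim is proved once
    for an arbitrary \<open>tw\<close>.\<close>
  have G: "G_extension dihedral8 K L \<phi> \<longleftrightarrow> G_extension (metacyclic8 False) K L \<phi>"
    "G_extension quaternion8 K L \<phi> \<longleftrightarrow> G_extension (metacyclic8 True) K L \<phi>" for L :: "'b ring" and \<phi>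
    by (simp_all add: metacyclic8_False G_extension_def iso_quaternion8_iff)
  have q4: "[int q = -1] (mod 4) \<longleftrightarrow> q mod 4 = 3"
    by (simp add: cong_def) presburger
  have "odd q" using odd_residue_field_order[OF char] q by simp
  have "q mod 4 = 1 \<or> q mod 4 = 3" using \<open>odd q\<close> by presburger
  then consider "q mod 4 = 1" | "q mod 4 = 3" by blast
  then show ?thesis
  proof cases
    case 1
    obtain e \<pi> m j where S: "square_classes K (carrier K) e \<pi> \<zero>\<^bsub>K\<^esub> \<one>\<^bsub>K\<^esub> m" "j \<in> carrier K" "j \<otimes>\<^bsub>K\<^esub> j = \<ominus>\<^bsub>K\<^esub> \<one>\<^bsub>K\<^esub>"
      using square_classes_1_mod_4[OF char 1[unfolded q]] by blast
    have "\<not> G_extension (metacyclic8 tw) K L \<phi>" for tw and L :: "'b ring" and \<phi>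
      by (rule no_metacyclic8_extension[OF S])
    then show ?thesis unfolding G q4 using 1 by simp
  next
    case 3: 2
    obtain \<pi> a b where S: "square_classes K (carrier K) (\<ominus>\<^bsub>K\<^esub> \<one>\<^bsub>K\<^esub>) \<pi> a b \<one>\<^bsub>K\<^esub>"
      using square_classes_3_mod_4[OF char 3[unfolded q]] by blast
    obtain \<iota> :: "'a \<Rightarrow> 'b" where "inj_on \<iota> (carrier K)" using universe by blast
    then obtain \<kappa> :: "(('a \<times> 'a) \<times> 'a \<times> 'a) \<times> ('a \<times> 'a) \<times> 'a \<times> 'a \<Rightarrow> 'b" where
      "inj_on \<kappa> (((carrier K \<times> carrier K) \<times> carrier K \<times> carrier K) \<times> (carrier K \<times> carrier K) \<times> carrier K \<times> carrier K)"
      using inj_on_octuples[OF infinite_carrier] by blast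
    then have \<kappa>: "inj_on \<kappa> (carrier (octic_tower K \<pi> t0 t1))" for t0 t1
      by (simp add: octic_tower_def quadratic_extension_simps)
    have ext: "\<exists>(L :: 'b ring) \<phi>. G_extension (metacyclic8 tw) K L \<phi> \<and>
        (\<forall>(L' :: 'b ring) \<phi>'. G_extension (metacyclic8 tw) K L' \<phi>' \<longrightarrow> K_isomorphic K L \<phi> L' \<phi>')" for tw
      by (rule metacyclic8_extension_unique[OF S \<kappa>])
    obtain L :: "'b ring" and \<phi> where L: "G_extension (metacyclic8 False) K L \<phi>"
      using ext[of False] by (elim exE conjE)
    show ?thesis
      unfolding G q4
    proof (intro conjI impI)
      show "(\<exists>(L :: 'b ring) \<phi>. G_extension (metacyclic8 False) K L \<phi> \<or> G_extension (metacyclic8 True) K L \<phi>)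
          \<longleftrightarrow> q mod 4 = 3"
        using L 3 by metis
    qed (rule ext)+
  qed
qed

end
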